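(* Let $\mathcal X: y^m=f(x)$ be a Kummer curve over $\mathbb F_q$ and let $Q_1,\dots,Q_n$ be pairwise distinct totally ramified places of $\mathbb F_q(\mathcal X)/\mathbb F_q(x)$ lying over $P_1,\dots,P_n$, all as described in the context, with $2\le n\le q$. Suppose $\lambda_s\equiv 1\pmod m$ for every $1\le s\le n$. Let $D$ be a divisor of $\mathbb F_q(\mathcal X)$ with support contained in $\{Q_1,\dots,Q_n\}$. Then $D$ is a non-special divisor of degree $g(\mathcal X)-1$ if and only if $$\beta(m-1)\le\cdots\le\beta(2)\le\beta(1)\le n-1$$ and $$D=m\sum_{k=1}^nj_kQ_k+\sum_{k=1}^n\alpha_{\sigma(k)}Q_k$$ for some $(j_1,\dots,j_n)\in\mathbb Z^n$ with $\sum_{k=1}^nj_k=-1$ and some permutation $\sigma$ of $\{1,\dots,n\}$, where $(\alpha_1,\dots,\alpha_n)$ is the non-decreasing $n$-tuple with entries in $\{0,1,\dots,m-1\}$ in which the value $0$ occurs exactly $n-1-\beta(1)$ times, the value $i$ occurs exactly $\beta(i)-\beta(i+1)$ times for each $1\le i\le m-2$, and the value $m-1$ occurs exactly $\beta(m-1)+1$ times.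
   Context: Let $\mathbb F_q$ be the finite field with $q$ elements, $m\ge 2$ an integer with $\operatorname{char}(\mathbb F_q)\nmid m$, and $f(x)\in\mathbb F_q[x]$ a polynomial with $\deg f\ge 2$, all of whose roots lie in $\mathbb F_q$, and which is not a $d$-th power of an element of $\mathbb F_q(x)$ for any divisor $d\ge 2$ of $m$. Let $\mathcal X$ be the curve $y^m=f(x)$, with function field $\mathbb F_q(\mathcal X)=\mathbb F_q(x,y)$, whose genus $g(\mathcal X)$ is assumed to be at least $1$. Let $P_1,\dots,P_r$ be all the places of $\mathbb F_q(x)$ that are zeros or the pole of $f(x)$, and let $\lambda_k=\nu_{P_k}(f)$ be the valuation of $f$ at $P_k$ (so $\lambda_k=-\deg f$ if $P_k$ is the pole). For some $n\le r$, the places $P_1,\dots,P_n$ (possibly including the pole of $f$) are totally ramified in $\mathbb F_q(\mathcal X)/\mathbb F_q(x)$, and $Q_k$ is the unique place of $\mathbb F_q(\mathcal X)$ over $P_k$, $1\le k\le n$. For $1\le i\le m-1$ put $$\beta(i)=\sum_{k=1}^{r}\left\lceil\frac{i\lambda_k}{m}\right\rceil-1.$$ A divisor $G$ of a function field of genus $g$ is non-special if $\ell(G)=\deg(G)+1-g$, where $\ell(G)$ is the dimension of the Riemann-Roch space $\mathcal L(G)$. *)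

theory Defs
  imports
    "HOL-Computational_Algebra.Computational_Algebra"
    "HOL-Library.Cardinality"
    "HOL-Library.Poly_Mapping"
    "HOL-Combinatorics.Permutations"
    "HOL-Number_Theory.Cong"
    "HOL-Algebra.Algebraic_Closure_Type"
    "Jordan_Normal_Form.Matrix"
begin

text \<open>
  A function field \<open>F/K\<close> is a field type \<open>'f\<close> together with the embedding
  \<open>c :: 'k \<Rightarrow> 'f\<close> of its constant field. The rational function field \<open>K(x)\<close> is
  \<open>'k poly fract\<close>, embedded constants being given by \<open>const_fract\<close>; an extension \<open>F\<close> of
  \<open>K(x)\<close> is a type \<open>'f\<close> with a field homomorphism \<open>h :: 'k poly fract \<Rightarrow> 'f\<close>, and
  its constants are then embedded by \<open>h \<circ> const_fract\<close>.
  The conventions on places, divisors and genus are those of Stichtenoth's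
  \<open>Algebraic Function Fields and Codes\<close>.
\<close>

definition const_fract :: "'k::field \<Rightarrow> 'k poly fract" where
  "const_fract a = to_fract [:a:]"

definition is_subfield :: "'f::field set \<Rightarrow> bool" where
  "is_subfield S \<longleftrightarrow> 1 \<in> S \<and> (\<forall>u\<in>S. \<forall>v\<in>S. u - v \<in> S \<and> u * v \<in> S) \<and> (\<forall>u\<in>S. inverse u \<in> S)"

definition ext_degree :: "('e::field \<Rightarrow> 'f::field) \<Rightarrow> nat" where
  "ext_degree h = vector_space.dim (\<lambda>a v. h a * v) UNIV"


subsection \<open>Places and valuations\<close>

definition valuation_ring :: "('k::field \<Rightarrow> 'f::field) \<Rightarrow> 'f set \<Rightarrow> bool" where
  "valuation_ring c R \<longleftrightarrow>
     1 \<in> R \<and> (\<forall>u\<in>R. \<forall>v\<in>R. u - v \<in> R \<and> u * v \<in> R) \<and>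
     range c \<subset> R \<and> R \<subset> UNIV \<and> (\<forall>z. z \<in> R \<or> inverse z \<in> R)"

text \<open>A place is the maximal ideal of a valuation ring, i.e. its set of non-units.\<close>

definition place :: "('k::field \<Rightarrow> 'f::field) \<Rightarrow> 'f set \<Rightarrow> bool" where
  "place c P \<longleftrightarrow> (\<exists>R. valuation_ring c R \<and> P = {z \<in> R. z = 0 \<or> inverse z \<notin> R})"

text \<open>The valuation ring is recovered from its maximal ideal.\<close>

definition place_ring :: "'f::field set \<Rightarrow> 'f set" where
  "place_ring P = {z. z = 0 \<or> inverse z \<notin> P}"

text \<open>
  For \<open>z \<noteq> 0\<close> this is the exponent \<open>n\<close> in \<open>z = t\<^sup>n u\<close>, with \<open>t\<close> a prime
  element of \<open>P\<close> and \<open>u\<close> a unit of the valuation ring. The value at \<open>0\<close>, which should be infinite,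
  is meaningless and never used.
\<close>

definition place_val :: "'f::field set \<Rightarrow> 'f \<Rightarrow> int" where
  "place_val P z = (THE n. \<exists>t u. P = (\<lambda>w. t * w) ` place_ring P \<and>
     u \<noteq> 0 \<and> u \<in> place_ring P \<and> inverse u \<in> place_ring P \<and> z = t powi n * u)"

text \<open>The residue classes of the elements of \<open>B\<close> form a \<open>K\<close>-basis of the residue field at \<open>P\<close>.\<close>

definition residue_basis :: "('k::field \<Rightarrow> 'f::field) \<Rightarrow> 'f set \<Rightarrow> 'f set \<Rightarrow> bool" where
  "residue_basis c P B \<longleftrightarrow> finite B \<and> B \<subseteq> place_ring P \<and>
     (\<forall>z\<in>place_ring P. \<exists>!a. (\<forall>b. b \<notin> B \<longrightarrow> a b = 0) \<and> z - (\<Sum>b\<in>B. c (a b) * b) \<in> P)"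

definition place_degree :: "('k::field \<Rightarrow> 'f::field) \<Rightarrow> 'f set \<Rightarrow> nat" where
  "place_degree c P = (THE d. \<exists>B. residue_basis c P B \<and> card B = d)"


subsection \<open>Divisors, Riemann-Roch spaces, genus\<close>

type_synonym 'f divisor = "'f set \<Rightarrow>\<^sub>0 int"

definition is_divisor :: "('k::field \<Rightarrow> 'f::field) \<Rightarrow> 'f divisor \<Rightarrow> bool" where
  "is_divisor c G \<longleftrightarrow> (\<forall>P\<in>Poly_Mapping.keys G. place c P)"

definition div_degree :: "('k::field \<Rightarrow> 'f::field) \<Rightarrow> 'f divisor \<Rightarrow> int" where
  "div_degree c G =
     (\<Sum>P\<in>Poly_Mapping.keys G. Poly_Mapping.lookup G P * int (place_degree c P))"

definition riemann_roch_space :: "('k::field \<Rightarrow> 'f::field) \<Rightarrow> 'f divisor \<Rightarrow> 'f set" where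
  "riemann_roch_space c G =
     {z. z \<noteq> 0 \<longrightarrow> (\<forall>P. place c P \<longrightarrow> place_val P z \<ge> - Poly_Mapping.lookup G P)}"

definition ell :: "('k::field \<Rightarrow> 'f::field) \<Rightarrow> 'f divisor \<Rightarrow> nat" where
  "ell c G = vector_space.dim (\<lambda>a v. c a * v) (riemann_roch_space c G)"

definition genus :: "('k::field \<Rightarrow> 'f::field) \<Rightarrow> int" where
  "genus c = (GREATEST g. \<exists>G. is_divisor c G \<and> g = div_degree c G - int (ell c G) + 1)"

definition non_special :: "('k::field \<Rightarrow> 'f::field) \<Rightarrow> 'f divisor \<Rightarrow> bool" where
  "non_special c G \<longleftrightarrow> int (ell c G) = div_degree c G + 1 - genus c"


subsection \<open>Extensions of function fields\<close>

text \<open>\<open>Q\<close> is a place of the extension, \<open>P\<close> a place of the base field, \<open>c\<close> the constants of the base.\<close>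

definition lies_over ::
  "('k::field \<Rightarrow> 'e::field) \<Rightarrow> ('e \<Rightarrow> 'f::field) \<Rightarrow> 'f set \<Rightarrow> 'e set \<Rightarrow> bool" where
  "lies_over c h Q P \<longleftrightarrow> place (h \<circ> c) Q \<and> place c P \<and> h ` P \<subseteq> Q"

definition ramification_index :: "('e::field \<Rightarrow> 'f::field) \<Rightarrow> 'f set \<Rightarrow> 'e set \<Rightarrow> nat" where
  "ramification_index h Q P =
     (THE e. \<forall>z. z \<noteq> 0 \<longrightarrow> place_val Q (h z) = int e * place_val P z)"

definition totally_ramified ::
  "('k::field \<Rightarrow> 'e::field) \<Rightarrow> ('e \<Rightarrow> 'f::field) \<Rightarrow> 'e set \<Rightarrow> bool" where
  "totally_ramified c h P \<longleftrightarrow>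
     (\<exists>Q. {Q'. lies_over c h Q' P} = {Q} \<and> ramification_index h Q P = ext_degree h)"


subsection \<open>The combinatorial data of a Kummer curve\<close>

definition kummer_beta :: "nat \<Rightarrow> nat \<Rightarrow> (nat \<Rightarrow> int) \<Rightarrow> nat \<Rightarrow> int" where
  "kummer_beta m r lam i = (\<Sum>k=1..r. \<lceil>real_of_int (int i * lam k) / real m\<rceil>) - 1"

text \<open>\<open>\<alpha> 1, \<dots>, \<alpha> n\<close> is the non-decreasing tuple with the multiplicities prescribed by \<open>b\<close>.\<close>

definition alpha_tuple :: "nat \<Rightarrow> nat \<Rightarrow> (nat \<Rightarrow> int) \<Rightarrow> (nat \<Rightarrow> nat) \<Rightarrow> bool" where
  "alpha_tuple m n b \<alpha> \<longleftrightarrow>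
     mono_on {1..n} \<alpha> \<and> \<alpha> ` {1..n} \<subseteq> {0..m - 1} \<and>
     int (card {k\<in>{1..n}. \<alpha> k = 0}) = int n - 1 - b 1 \<and>
     (\<forall>i\<in>{1..m - 2}. int (card {k\<in>{1..n}. \<alpha> k = i}) = b i - b (i + 1)) \<and>
     int (card {k\<in>{1..n}. \<alpha> k = m - 1}) = b (m - 1) + 1"

end

theory Submission
  imports Defs
begin

text \<open>
  Let \<open>d\<^sub>k\<close> be the coefficient of \<open>Q\<^sub>k\<close> in \<open>D\<close>. As some \<open>\<lambda>\<^sub>k\<close> is prime to \<open>m\<close>, the powers
  \<open>1, y, \<dots>, y\<^bsup>m-1\<^esup>\<close> form a basis over \<open>K(x)\<close>, and a function lies in \<open>\<L>(D)\<close> iff each of its components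
  \<open>z\<^sub>i y\<^sup>i\<close> does: at the \<open>Q\<^sub>k\<close> the components have distinct valuations, elsewhere a Frobenius power
  separates them. Hence \<open>\<ell>(D) = \<Sum>\<^sub>i max(0, \<delta>\<^sub>i + 1)\<close> with \<open>\<delta>\<^sub>i = \<Sum>\<^sub>k \<lfloor>(i \<lambda>\<^sub>k + d\<^sub>k) / m\<rfloor>\<close>.
  For \<open>D = m M Q\<^sub>1\<close> with \<open>M\<close> large this gives \<open>g = \<Sum>\<^sub>i \<beta>(i)\<close>, once Riemann's inequality is
  available. Since the constant field is finite, the degrees and dimensions needed for it are
  read off from cardinalities.

  A divisor \<open>D\<close> of degree \<open>g - 1\<close> is non-special iff all \<open>\<delta>\<^sub>i\<close> are negative. Write \<open>d\<^sub>k = m j\<^sub>k + a\<^sub>k\<close> with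
  \<open>0 \<le> a\<^sub>k < m\<close> and let \<open>N(t)\<close> be the number of \<open>k\<close> with \<open>a\<^sub>k \<ge> t\<close>. Summing the inequalities
  \<open>\<delta>\<^sub>i \<le> -1\<close> and comparing with the degree forces \<open>\<Sum>\<^sub>k j\<^sub>k = -1\<close> and \<open>N(t) = \<beta>(t) + 1\<close> for all \<open>t\<close>, i.e.
  \<open>(a\<^sub>1, \<dots>, a\<^sub>n)\<close> is a rearrangement of \<open>\<alpha>\<close>.
\<close>

section \<open>Places\<close>

text \<open>A place is given only by a valuation ring, so discreteness, finite residue degree and
  the finiteness of zeros all have to be proved. They have one source, the pigeonhole bound
  \<open>card_le_height\<close>: elements that are pairwise incongruent modulo a function of height
  \<open>\<delta>\<close> number at most \<open>CARD('k) ^ (m * \<delta>)\<close>. For zeros this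
  yields only half of the degree formula, an upper bound. It suffices because Riemann's inequality
  uses rational functions with a single pole whose height equals the pole order, and there the bound
  loses nothing. Riemann's inequality is unavoidable because \<open>genus\<close> is a greatest
  value over all divisors: the multiples of \<open>Q 1\<close> show that
  \<open>\<Sum> \<beta>(i)\<close> is attained, not that it is an upper bound. The other obstacle is
  a place where the valuation of \<open>f\<close> shares a factor with \<open>m\<close>: different
  components may have equal valuations there. A Frobenius power takes over: it permutes the
  exponents modulo \<open>m\<close> and fixes only the class of 0.\<close>

lemma place_ring_of_place:
  assumes "valuation_ring c R"
  shows "place_ring {z \<in> R. z = 0 \<or> inverse z \<notin> R} = R"
proof -
  have "0 \<in> R" using assms unfolding valuation_ring_def
    by (metis diff_self)
  moreover have "z \<in> R \<or> inverse z \<in> R" for z using assms unfolding valuation_ring_def by blast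
  ultimately show ?thesis
    unfolding place_ring_def by (auto simp: inverse_eq_iff_eq)
qed

lemma place_valuation_ring:
  assumes "place c P"
  shows "valuation_ring c (place_ring P)"
    and "P = {z \<in> place_ring P. z = 0 \<or> inverse z \<notin> place_ring P}"
proof -
  obtain R where R: "valuation_ring c R" "P = {z \<in> R. z = 0 \<or> inverse z \<notin> R}"
    using assms unfolding place_def by blast
  with place_ring_of_place[OF R(1)] show "valuation_ring c (place_ring P)"
    and "P = {z \<in> place_ring P. z = 0 \<or> inverse z \<notin> place_ring P}" by simp_all
qed

lemma place_of_valuation_ring:
  "valuation_ring c R \<Longrightarrow> place c {z \<in> R. z = 0 \<or> inverse z \<notin> R}"
  unfolding place_def by blast

section \<open>Ring and ideal arithmetic at a single place\<close>

context
  fixes c :: "'k::field \<Rightarrow> 'f::field" and P :: "'f set"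
  assumes P: "place c P"
begin

private lemma vr: "valuation_ring c (place_ring P)"
  by (rule place_valuation_ring[OF P])

lemma place_ring_1: "1 \<in> place_ring P"
  using vr unfolding valuation_ring_def by blast

lemma place_ring_diff: "a \<in> place_ring P \<Longrightarrow> b \<in> place_ring P \<Longrightarrow> a - b \<in> place_ring P"
  using vr unfolding valuation_ring_def by blast

lemma place_ring_mult: "a \<in> place_ring P \<Longrightarrow> b \<in> place_ring P \<Longrightarrow> a * b \<in> place_ring P"
  using vr unfolding valuation_ring_def by blast

lemma place_ring_0: "0 \<in> place_ring P"
  by (simp add: place_ring_def)

lemma place_ring_minus: "a \<in> place_ring P \<Longrightarrow> - a \<in> place_ring P"
  using place_ring_diff[OF place_ring_0] by simp

lemma place_ring_add: "a \<in> place_ring P \<Longrightarrow> b \<in> place_ring P \<Longrightarrow> a + b \<in> place_ring P"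
  using place_ring_diff[of a "- b"] place_ring_minus by simp

lemma place_ring_power: "a \<in> place_ring P \<Longrightarrow> a ^ n \<in> place_ring P"
  by (induction n) (auto intro: place_ring_1 place_ring_mult)

lemma place_ring_sum: "(\<And>i. i \<in> I \<Longrightarrow> g i \<in> place_ring P) \<Longrightarrow> sum g I \<in> place_ring P"
  by (induction I rule: infinite_finite_induct) (auto intro: place_ring_0 place_ring_add)

lemma place_ring_const: "c a \<in> place_ring P"
  using vr unfolding valuation_ring_def by blast

lemma place_ring_total: "a \<notin> place_ring P \<Longrightarrow> inverse a \<in> place_ring P"
  using vr unfolding valuation_ring_def by blast

lemma place_ring_neq_UNIV: "place_ring P \<noteq> UNIV"
  using vr unfolding valuation_ring_def by auto

lemma place_subset: "P \<subseteq> place_ring P"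
  using place_valuation_ring(2)[OF P] by blast

lemma in_place_iff: "z \<in> P \<longleftrightarrow> z = 0 \<or> inverse z \<notin> place_ring P"
  using place_valuation_ring(2)[OF P] place_ring_total place_ring_0 by blast

lemma place_0: "0 \<in> P"
  by (simp add: in_place_iff)

lemma place_not_1: "1 \<notin> P"
  using place_ring_1 by (simp add: in_place_iff)

lemma place_mult: "a \<in> P \<Longrightarrow> b \<in> place_ring P \<Longrightarrow> a * b \<in> P"
proof (rule ccontr)
  assume *: "a \<in> P" "b \<in> place_ring P" "a * b \<notin> P"
  then have nz: "a \<noteq> 0" "b \<noteq> 0" and "inverse (a * b) \<in> place_ring P" by (auto simp: in_place_iff)
  moreover have "inverse (a * b) * b = inverse a" using nz by simp
  ultimately have "inverse a \<in> place_ring P" using place_ring_mult *(2) by metis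
  with * nz show False by (simp add: in_place_iff)
qed

lemma place_add: assumes "a \<in> P" "b \<in> P" shows "a + b \<in> P"
proof (cases "a = 0 \<or> b = 0")
  case True then show ?thesis using assms by auto
next
  case False
  have *: "u + v \<in> P" if "u \<in> P" "v / u \<in> place_ring P" "u \<noteq> 0" for u v
  proof -
    have "u + v = u * (1 + v / u)" using that by (simp add: distrib_left)
    then show ?thesis using place_mult[OF that(1) place_ring_add[OF place_ring_1 that(2)]] by simp
  qed
  have "inverse (b / a) = a / b" by simp
  then have "b / a \<in> place_ring P \<or> a / b \<in> place_ring P" using place_ring_total by metis
  then show ?thesis using * False assms by (metis add.commute)
qed

lemma place_minus: "a \<in> P \<Longrightarrow> - a \<in> P"
  using place_mult[of a "- 1"] place_ring_1 place_ring_minus by simp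

lemma place_diff: "a \<in> P \<Longrightarrow> b \<in> P \<Longrightarrow> a - b \<in> P"
  using place_add[of a "- b"] place_minus by simp

lemma place_sum: "(\<And>i. i \<in> I \<Longrightarrow> g i \<in> P) \<Longrightarrow> sum g I \<in> P"
  by (induction I rule: infinite_finite_induct) (auto intro: place_0 place_add)

lemma place_nontrivial: obtains z where "z \<in> P" "z \<noteq> 0"
proof -
  obtain z where "z \<notin> place_ring P" using place_ring_neq_UNIV by blast
  then have "inverse z \<in> P" "inverse z \<noteq> 0" using place_ring_0 by (auto simp: in_place_iff)
  then show ?thesis using that by blast
qed

lemma place_const: assumes "field_hom c" "a \<noteq> 0" shows "c a \<notin> P"
proof -
  interpret field_hom c by fact
  have "c (inverse a) \<in> place_ring P" by (rule place_ring_const)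
  then show ?thesis using assms(2) by (simp add: in_place_iff hom_inverse)
qed

end

lemma place_ring_inj: "place c P \<Longrightarrow> place c P' \<Longrightarrow> place_ring P = place_ring P' \<Longrightarrow> P = P'"
  using place_valuation_ring(2)[of c P] place_valuation_ring(2)[of c P'] by simp

section \<open>Units, uniformizers and discrete valuations\<close>

definition place_unit :: "'f::field set \<Rightarrow> 'f \<Rightarrow> bool" where
  "place_unit P u \<longleftrightarrow> u \<noteq> 0 \<and> u \<in> place_ring P \<and> inverse u \<in> place_ring P"

text \<open>Stronger than generating \<open>P\<close>: for a valuation of higher rank the powers of
  a generator do not reach every element. The mere existence of such a \<open>t\<close> therefore
  says that the valuation is discrete of rank one.\<close>

definition uniformizer :: "'f::field set \<Rightarrow> 'f \<Rightarrow> bool" where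
  "uniformizer P t \<longleftrightarrow> t \<in> P \<and> t \<noteq> 0 \<and> (\<forall>z. z \<noteq> 0 \<longrightarrow> (\<exists>n u. place_unit P u \<and> z = t powi n * u))"

definition discrete_place :: "('k::field \<Rightarrow> 'f::field) \<Rightarrow> 'f set \<Rightarrow> bool" where
  "discrete_place c P \<longleftrightarrow> place c P \<and> (\<exists>t. uniformizer P t)"

lemma place_unit_mult: "place c P \<Longrightarrow> place_unit P u \<Longrightarrow> place_unit P v \<Longrightarrow> place_unit P (u * v)"
  unfolding place_unit_def by (auto simp: place_ring_mult)

lemma place_unit_inverse: "place_unit P u \<Longrightarrow> place_unit P (inverse u)"
  unfolding place_unit_def by auto

lemma place_unit_power: "place c P \<Longrightarrow> place_unit P u \<Longrightarrow> place_unit P (u powi n)"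
  unfolding place_unit_def by (auto simp: power_int_def place_ring_power power_inverse[symmetric])

lemma place_unit_iff: "place c P \<Longrightarrow> place_unit P u \<longleftrightarrow> u \<in> place_ring P \<and> u \<notin> P"
  unfolding place_unit_def using place_0 in_place_iff by blast

context
  fixes c :: "'k::field \<Rightarrow> 'f::field" and P :: "'f set"
  assumes P: "place c P"
begin

lemma power_int_unit_eq_0:
  assumes t: "t \<in> P" "t \<noteq> 0" and u: "place_unit P (t powi n)"
  shows "n = 0"
proof (rule ccontr)
  assume "n \<noteq> 0"
  have *: "t ^ Suc k \<in> P" for k
    using place_mult[OF P t(1) place_ring_power[OF P]] place_subset[OF P] t(1) by auto
  obtain k where "n = int (Suc k) \<or> n = - int (Suc k)"
    using \<open>n \<noteq> 0\<close> by (metis int_cases int_cases2 of_nat_0 old.nat.exhaust minus_zero)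
  then have "t powi n = t ^ Suc k \<or> t powi n = inverse (t ^ Suc k)"
    by (auto simp del: of_nat_Suc simp: power_int_minus)
  then have "place_unit P (t ^ Suc k)"
    using u place_unit_inverse[of P "t powi n"] by auto
  with * show False using place_unit_iff[OF P] by blast
qed

text \<open>\<open>place_val\<close> is worded through generators of \<open>P\<close>, and this puts
  a uniformizer within its reach. A nonzero element of \<open>P\<close> has exponent at least 1, as
  otherwise its inverse would be integral.\<close>

lemma uniformizer_generates:
  assumes "uniformizer P t"
  shows "P = (\<lambda>w. t * w) ` place_ring P"
proof
  have t: "t \<in> P" "t \<noteq> 0" using assms unfolding uniformizer_def by auto
  then show "(\<lambda>w. t * w) ` place_ring P \<subseteq> P" using place_mult[OF P] by auto
  show "P \<subseteq> (\<lambda>w. t * w) ` place_ring P"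
  proof
    fix z assume z: "z \<in> P"
    have "inverse t * z \<in> place_ring P"
    proof (cases "z = 0")
      case True then show ?thesis using place_ring_0[OF P] by simp
    next
      case False
      obtain n u where u: "place_unit P u" "z = t powi n * u"
        using assms False unfolding uniformizer_def by blast
      have "n \<ge> 1"
      proof (rule ccontr)
        assume "\<not> n \<ge> 1"
        then obtain k where "n = - int k" by (metis int_one_le_iff_zero_less nonpos_int_cases not_less)
        then have "inverse z = t ^ k * inverse u" using u t by (simp add: power_int_minus)
        then have "inverse z \<in> place_ring P"
          using u(1) t place_subset[OF P] unfolding place_unit_def
          by (metis place_ring_mult[OF P] place_ring_power[OF P] subsetD)
        then show False using z False in_place_iff[OF P] by blast
      qed
      then obtain k where "n = int (Suc k)" by (metis nonneg_int_cases add.commute int_ops(4) zle_iff_zadd)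
      then have "inverse t * z = t ^ k * u" using u t by (simp del: of_nat_Suc)
      then show ?thesis using u(1) t place_subset[OF P] unfolding place_unit_def
          by (metis place_ring_mult[OF P] place_ring_power[OF P] subsetD)
    qed
    moreover have "z = t * (inverse t * z)" using t by simp
    ultimately show "z \<in> (\<lambda>w. t * w) ` place_ring P" by blast
  qed
qed

lemma place_val_eq:
  assumes "uniformizer P t" "place_unit P u"
  shows "place_val P (t powi n * u) = n"
  unfolding place_val_def
proof (rule the_equality)
  show "\<exists>s v. P = (\<lambda>w. s * w) ` place_ring P \<and> v \<noteq> 0 \<and> v \<in> place_ring P \<and> inverse v \<in> place_ring P \<and>
    t powi n * u = s powi n * v"
    using uniformizer_generates[OF assms(1)] assms(2) unfolding place_unit_def by blast
next
  fix n' assume "\<exists>s v. P = (\<lambda>w. s * w) ` place_ring P \<and> v \<noteq> 0 \<and> v \<in> place_ring P \<and> inverse v \<in> place_ring P \<and>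
    t powi n * u = s powi n' * v"
  then obtain s v where s: "P = (\<lambda>w. s * w) ` place_ring P" and v: "place_unit P v"
    and eq: "t powi n * u = s powi n' * v" unfolding place_unit_def by blast
  have t: "t \<in> P" "t \<noteq> 0" using assms unfolding uniformizer_def by auto
  obtain a where a: "a \<in> place_ring P" "t = s * a" using s t by blast
  then have s0: "s \<noteq> 0" "s \<in> P" using t s place_ring_1[OF P] by (auto intro: rev_image_eqI)
  then obtain b where b: "b \<in> place_ring P" "s = t * b" using uniformizer_generates[OF assms(1)] by blast
  \<comment> \<open>Any other generator \<open>s\<close> is \<open>t * b\<close> with
    \<open>b\<close> a unit, so a change of generator affects only the unit part and the exponent is
    well defined.\<close>
  have "a * b = 1" using a b s0 t
    by (metis mult.assoc mult.commute mult_cancel_right1)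
  then have "place_unit P b" unfolding place_unit_def using a b
    by (metis inverse_unique mult.commute mult_zero_right zero_neq_one)
  then have ub: "place_unit P (b powi n' * v * inverse u)"
    by (intro place_unit_mult[OF P] place_unit_power[OF P] place_unit_inverse v assms(2))
  have "t powi (n - n') = b powi n' * v * inverse u"
  proof -
    have "t powi n * u = t powi n' * b powi n' * v" using eq b by (simp add: power_int_mult_distrib)
    moreover have "u \<noteq> 0" using assms(2) unfolding place_unit_def by auto
    ultimately have "t powi n = t powi n' * (b powi n' * v * inverse u)" by (simp add: field_simps)
    then show ?thesis using t by (simp add: power_int_diff)
  qed
  then show "n' = n" using power_int_unit_eq_0[OF t, of "n - n'"] ub by simp
qed

end

text \<open>Admitting 0 by hand replaces the convention that its valuation is infinite. As
  \<open>k\<close> may be negative, conditions on poles take this form too.\<close>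

definition val_ideal :: "'f::field set \<Rightarrow> int \<Rightarrow> 'f set" where
  "val_ideal P k = {z. z = 0 \<or> place_val P z \<ge> k}"

lemma discrete_place_place: "discrete_place c P \<Longrightarrow> place c P"
  unfolding discrete_place_def by blast

context
  fixes c :: "'k::field \<Rightarrow> 'f::field" and P :: "'f set"
  assumes dP: "discrete_place c P"
begin

private lemma P: "place c P" using dP unfolding discrete_place_def by blast

lemma place_val_form:
  obtains t where "t \<in> P" "t \<noteq> 0" "place_val P t = 1"
    "\<forall>z. z \<noteq> 0 \<longrightarrow> (\<exists>u. place_unit P u \<and> z = t powi place_val P z * u)"
    "\<forall>n u. place_unit P u \<longrightarrow> place_val P (t powi n * u) = n"
proof -
  obtain t where t: "uniformizer P t" using dP unfolding discrete_place_def by blast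
  have 1: "place_unit P 1" using place_ring_1[OF P] unfolding place_unit_def by simp
  show ?thesis
  proof (rule that[of t])
    show "t \<in> P" "t \<noteq> 0" using t unfolding uniformizer_def by auto
    show "place_val P t = 1" using place_val_eq[OF P t 1, of 1] by simp
    show "\<forall>n u. place_unit P u \<longrightarrow> place_val P (t powi n * u) = n"
      using place_val_eq[OF P t] by blast
    show "\<forall>z. z \<noteq> 0 \<longrightarrow> (\<exists>u. place_unit P u \<and> z = t powi place_val P z * u)"
      using t place_val_eq[OF P t] unfolding uniformizer_def by metis
  qed
qed

lemma place_val_mult:
  assumes "a \<noteq> 0" "b \<noteq> 0"
  shows "place_val P (a * b) = place_val P a + place_val P b"
proof -
  obtain t where t: "t \<in> P" "t \<noteq> 0"
    and f: "\<And>z. z \<noteq> 0 \<Longrightarrow> \<exists>u. place_unit P u \<and> z = t powi place_val P z * u"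
    and v: "\<And>n u. place_unit P u \<Longrightarrow> place_val P (t powi n * u) = n"
    using place_val_form by metis
  obtain u1 u2 where u: "place_unit P u1" "a = t powi place_val P a * u1"
    "place_unit P u2" "b = t powi place_val P b * u2" using f assms by blast
  have "a * b = t powi (place_val P a + place_val P b) * (u1 * u2)"
    using t u(2,4) by (metis (no_types, lifting) mult.assoc mult.left_commute power_int_add)
  then show ?thesis using v place_unit_mult[OF P u(1,3)] by simp
qed

lemma place_val_1: "place_val P 1 = 0"
  using place_val_mult[of 1 1] by simp

lemma place_val_inverse: "a \<noteq> 0 \<Longrightarrow> place_val P (inverse a) = - place_val P a"
  using place_val_mult[of a "inverse a"] place_val_1 by simp

lemma place_val_divide: "a \<noteq> 0 \<Longrightarrow> b \<noteq> 0 \<Longrightarrow> place_val P (a / b) = place_val P a - place_val P b"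
  by (simp add: divide_inverse place_val_mult place_val_inverse)

lemma place_val_power: "a \<noteq> 0 \<Longrightarrow> place_val P (a ^ n) = int n * place_val P a"
  by (induction n) (auto simp: place_val_1 place_val_mult algebra_simps)

lemma place_val_power_int: "a \<noteq> 0 \<Longrightarrow> place_val P (a powi n) = n * place_val P a"
  by (auto simp: power_int_def place_val_power place_val_inverse)

lemma place_val_prod:
  "(\<And>i. i \<in> I \<Longrightarrow> g i \<noteq> 0) \<Longrightarrow> place_val P (prod g I) = (\<Sum>i\<in>I. place_val P (g i))"
  by (induction I rule: infinite_finite_induct) (auto simp: place_val_1 place_val_mult)

lemma place_ring_val: "z \<in> place_ring P \<longleftrightarrow> z \<in> val_ideal P 0"
proof (cases "z = 0")
  case True then show ?thesis using place_ring_0[OF P] unfolding val_ideal_def by simp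
next
  case False
  obtain t where t: "t \<in> P" "t \<noteq> 0"
    and f: "\<And>z. z \<noteq> 0 \<Longrightarrow> \<exists>u. place_unit P u \<and> z = t powi place_val P z * u"
    using place_val_form by metis
  obtain u where u: "place_unit P u" "z = t powi place_val P z * u" using f[OF False] by blast
  show ?thesis
  proof (cases "place_val P z \<ge> 0")
    case True
    then have "z = t ^ nat (place_val P z) * u" using u(2) by (simp add: power_int_def)
    then have "z \<in> place_ring P" using u(1) t place_subset[OF P] unfolding place_unit_def
      by (metis place_ring_mult[OF P] place_ring_power[OF P] subsetD)
    then show ?thesis using True unfolding val_ideal_def by simp
  next
    case neg: False
    then obtain k where k: "place_val P z = - int (Suc k)"
      by (metis int_cases negative_zless_0 of_nat_0_le_iff)
    have "inverse z = inverse (t powi (- int (Suc k))) * inverse u" using u(2) k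
      by (metis inverse_mult_distrib)
    also have "\<dots> = t * (t ^ k * inverse u)" by (simp add: power_int_minus del: of_nat_Suc)
    finally have "inverse z = t * (t ^ k * inverse u)" .
    then have "inverse z \<in> P" using u(1) t place_subset[OF P] unfolding place_unit_def
      by (metis place_ring_mult[OF P] place_ring_power[OF P] place_mult[OF P] subsetD)
    then have "z \<notin> place_ring P" using False in_place_iff[OF P, of "inverse z"] by simp
    then show ?thesis using neg False unfolding val_ideal_def by simp
  qed
qed

lemma place_val_nonneg: "z \<noteq> 0 \<Longrightarrow> z \<in> place_ring P \<longleftrightarrow> place_val P z \<ge> 0"
  by (simp add: place_ring_val val_ideal_def)

lemma place_val_pos: "z \<noteq> 0 \<Longrightarrow> z \<in> P \<longleftrightarrow> place_val P z > 0"
  using place_val_nonneg[of "inverse z"] by (auto simp: in_place_iff[OF P] place_val_inverse)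

lemma in_place_val: "z \<in> P \<longleftrightarrow> z \<in> val_ideal P 1"
  using place_val_pos[of z] place_0[OF P] by (cases "z = 0") (auto simp: val_ideal_def)

text \<open>Division by \<open>b\<close> carries the fractional ideal onto the valuation ring, from
  which it inherits its additive closure.\<close>

lemma in_val_ideal_iff:
  "b \<noteq> 0 \<Longrightarrow> z \<in> val_ideal P (place_val P b) \<longleftrightarrow> z / b \<in> place_ring P"
  by (cases "z = 0") (auto simp: place_ring_val val_ideal_def place_val_divide)

lemma exists_place_val: obtains t where "t \<noteq> 0" "place_val P t = k"
proof -
  obtain t where t: "t \<noteq> 0" "place_val P t = 1" using place_val_form by metis
  then show ?thesis using that[of "t powi k"] by (simp add: place_val_power_int)
qed

lemma val_ideal_mult: "a \<in> val_ideal P k \<Longrightarrow> b \<in> val_ideal P l \<Longrightarrow> a * b \<in> val_ideal P (k + l)"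
  by (cases "a = 0 \<or> b = 0") (auto simp: val_ideal_def place_val_mult)

lemma val_ideal_add: assumes "a \<in> val_ideal P k" "b \<in> val_ideal P k" shows "a + b \<in> val_ideal P k"
proof -
  obtain t where t: "t \<noteq> 0" "place_val P t = k" by (rule exists_place_val)
  have "(a + b) / t = a / t + b / t" by (simp add: add_divide_distrib)
  then show ?thesis using assms in_val_ideal_iff[OF t(1)] t(2) place_ring_add[OF P] by metis
qed

lemma val_ideal_minus: assumes "a \<in> val_ideal P k" shows "- a \<in> val_ideal P k"
proof -
  obtain t where t: "t \<noteq> 0" "place_val P t = k" by (rule exists_place_val)
  have "(- a) / t = - (a / t)" by simp
  then show ?thesis using assms in_val_ideal_iff[OF t(1)] t(2) place_ring_minus[OF P] by metis
qed

lemma val_ideal_diff: "a \<in> val_ideal P k \<Longrightarrow> b \<in> val_ideal P k \<Longrightarrow> a - b \<in> val_ideal P k"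
  using val_ideal_add[of a k "- b"] val_ideal_minus by simp

lemma val_ideal_0: "0 \<in> val_ideal P k"
  by (simp add: val_ideal_def)

lemma val_ideal_sum: "(\<And>i. i \<in> I \<Longrightarrow> g i \<in> val_ideal P k) \<Longrightarrow> sum g I \<in> val_ideal P k"
  by (induction I rule: infinite_finite_induct) (auto intro: val_ideal_0 val_ideal_add)

lemma val_ideal_mono: "k \<le> l \<Longrightarrow> z \<in> val_ideal P l \<Longrightarrow> z \<in> val_ideal P k"
  by (auto simp: val_ideal_def)

lemma val_ideal_const: "c a \<in> val_ideal P 0"
  using place_ring_const[OF P] place_ring_val by blast

text \<open>The sum stays in the ideal of level \<open>place_val P a\<close> but cannot enter the
  next one, which contains \<open>b\<close> and not \<open>a\<close>.\<close>

lemma place_val_add_eq: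
  assumes "a \<noteq> 0" "b = 0 \<or> place_val P a < place_val P b"
  shows "a + b \<noteq> 0" "place_val P (a + b) = place_val P a"
proof -
  let ?k = "place_val P a"
  have a: "a \<in> val_ideal P ?k" and na: "a \<notin> val_ideal P (?k + 1)" using assms by (auto simp: val_ideal_def)
  have b: "b \<in> val_ideal P (?k + 1)" using assms by (auto simp: val_ideal_def)
  have 1: "a + b \<in> val_ideal P ?k" using val_ideal_add[OF a val_ideal_mono[OF _ b]] by simp
  have 2: "a + b \<notin> val_ideal P (?k + 1)"
  proof
    assume "a + b \<in> val_ideal P (?k + 1)"
    from val_ideal_diff[OF this b] na show False by simp
  qed
  show "a + b \<noteq> 0" "place_val P (a + b) = ?k" using 1 2 by (auto simp: val_ideal_def)
qed

lemma place_val_minus: "place_val P (- a) = place_val P a"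
proof (cases "a = 0")
  case False
  have "- a \<in> val_ideal P (place_val P a)" "a \<in> val_ideal P (place_val P (- a))"
    using val_ideal_minus[of a] val_ideal_minus[of "- a"] by (auto simp: val_ideal_def)
  then show ?thesis using False by (auto simp: val_ideal_def)
qed simp

lemma place_val_const: "field_hom c \<Longrightarrow> a \<noteq> 0 \<Longrightarrow> place_val P (c a) = 0"
proof -
  assume c: "field_hom c" and a: "a \<noteq> 0"
  interpret field_hom c by fact
  have "c a \<noteq> 0" using a by simp
  then show ?thesis using place_val_nonneg[of "c a"] place_val_pos[of "c a"] place_const[OF P c a] place_ring_const[OF P] by fastforce
qed

text \<open>The term of least valuation cannot be cancelled by the others, so a bound on the sum
  passes to every term. This separates the components of a function wherever the valuation of
  \<open>f\<close> is prime to \<open>m\<close>.\<close>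

lemma val_ideal_sum_distinct:
  assumes "finite I" and s: "sum g I \<in> val_ideal P k"
    and d: "\<And>i j. i \<in> I \<Longrightarrow> j \<in> I \<Longrightarrow> i \<noteq> j \<Longrightarrow> g i \<noteq> 0 \<Longrightarrow> g j \<noteq> 0 \<Longrightarrow> place_val P (g i) \<noteq> place_val P (g j)"
    and i: "i \<in> I"
  shows "g i \<in> val_ideal P k"
proof (rule ccontr)
  assume n: "g i \<notin> val_ideal P k"
  define J where "J = {j \<in> I. g j \<noteq> 0}"
  have J: "finite J" "i \<in> J" using assms n by (auto simp: J_def val_ideal_def)
  define l where "l = Min ((\<lambda>j. place_val P (g j)) ` J)"
  have "l \<in> (\<lambda>j. place_val P (g j)) ` J" unfolding l_def by (rule Min_in) (use J in auto)
  then obtain j where j: "j \<in> J" "l = place_val P (g j)" by blast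
  have le: "l \<le> place_val P (g j')" if "j' \<in> J" for j' unfolding l_def using J that by simp
  have "l < k" using le[OF J(2)] n J by (auto simp: val_ideal_def J_def)
  have "sum g (I - {j}) \<in> val_ideal P (l + 1)"
  proof (rule val_ideal_sum)
    fix j' assume j': "j' \<in> I - {j}"
    show "g j' \<in> val_ideal P (l + 1)"
    proof (cases "g j' = 0")
      case False
      then have "j' \<in> J" using j' by (auto simp: J_def)
      moreover have "place_val P (g j') \<noteq> l" using d[of j' j] j' j False by (auto simp: J_def)
      ultimately show ?thesis using le[of j'] by (auto simp: val_ideal_def)
    qed (simp add: val_ideal_0)
  qed
  moreover have "sum g I = g j + sum g (I - {j})" using assms(1) j by (auto simp: J_def intro: sum.remove)
  moreover have "sum g I \<in> val_ideal P (l + 1)" using val_ideal_mono[OF _ s] \<open>l < k\<close> by simp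
  ultimately have "g j \<in> val_ideal P (l + 1)" using val_ideal_diff[of "sum g I" "l + 1" "sum g (I - {j})"] by simp
  then show False using j by (auto simp: val_ideal_def J_def)
qed

text \<open>Rank one is the point: a single \<open>z\<close> with a pole at \<open>P\<close>, raised
  to a high power, absorbs the pole of any \<open>w\<close>, so a strictly larger ring would be the
  whole field.\<close>

lemma place_ring_maximal:
  assumes P': "place c' P'" and sub: "place_ring P \<subseteq> place_ring P'"
  shows "place_ring P = place_ring P'"
proof (rule ccontr)
  assume "place_ring P \<noteq> place_ring P'"
  then obtain z where z: "z \<in> place_ring P'" "z \<notin> place_ring P" using sub by blast
  then have z0: "z \<noteq> 0" using place_ring_0[OF P] by auto
  then have neg: "place_val P z \<le> - 1" using z place_val_nonneg[of z] by auto
  have "w \<in> place_ring P'" for w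
  proof (cases "w = 0")
    case True then show ?thesis using place_ring_0[OF P'] by simp
  next
    case False
    define n where "n = nat (- place_val P w)"
    have "place_val P (w / z ^ n) = place_val P w - int n * place_val P z"
      using False z0 by (simp add: place_val_divide place_val_power)
    also have "\<dots> \<ge> 0"
    proof -
      have "int n * (- 1) \<ge> int n * place_val P z" using neg by (intro mult_left_mono) auto
      then show ?thesis unfolding n_def by linarith
    qed
    finally have "w / z ^ n \<in> place_ring P'" using sub place_val_nonneg[of "w / z ^ n"] False z0 by auto
    from place_ring_mult[OF P' this place_ring_power[OF P' z(1), of n]] show ?thesis using z0 by simp
  qed
  then show False using place_ring_neq_UNIV[OF P'] by blast
qed

lemma discrete_place_subset_eq:
  assumes "place c P'" "P' \<subseteq> P"
  shows "P' = P"
proof -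
  have "place_ring P \<subseteq> place_ring P'" using assms unfolding place_ring_def by blast
  from place_ring_maximal[OF assms(1) this] show ?thesis using place_ring_inj[OF P assms(1)] by simp
qed

end

section \<open>Existence of places\<close>

text \<open>Chevalley's extension argument. Zorn's lemma gives a subring \<open>M\<close> maximal
  among those that contain \<open>B\<close> and omit \<open>inverse \<pi>\<close>. If it contained
  neither \<open>z\<close> nor \<open>inverse z\<close>, adjoining either would produce
  \<open>inverse \<pi>\<close>, and two polynomial relations of least degree would shorten each
  other.\<close>

lemma valuation_ring_exists:
  fixes c :: "'k::field \<Rightarrow> 'f::field" and B :: "'f set"
  assumes c: "field_hom c" and B1: "1 \<in> B"
    and B: "\<And>u v. u \<in> B \<Longrightarrow> v \<in> B \<Longrightarrow> u - v \<in> B" "\<And>u v. u \<in> B \<Longrightarrow> v \<in> B \<Longrightarrow> u * v \<in> B"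
    and cB: "range c \<subseteq> B" and pi: "\<pi> \<in> B" "inverse \<pi> \<notin> B"
  obtains R where "valuation_ring c R" "B \<subseteq> R" "inverse \<pi> \<notin> R"
proof -
  interpret c: field_hom c by fact
  define ring where "ring S \<longleftrightarrow> 1 \<in> S \<and> (\<forall>u\<in>S. \<forall>v\<in>S. u - v \<in> S \<and> u * v \<in> S)" for S :: "'f set"
  define \<A> where "\<A> = {S. ring S \<and> B \<subseteq> S \<and> inverse \<pi> \<notin> S}"
  have "B \<in> \<A>" using B B1 pi unfolding \<A>_def ring_def by blast
  moreover have "\<Union>\<C> \<in> \<A>" if C: "\<C> \<noteq> {}" "subset.chain \<A> \<C>" for \<C>
  proof -
    have sub: "\<C> \<subseteq> \<A>" and chain: "\<And>S T. S \<in> \<C> \<Longrightarrow> T \<in> \<C> \<Longrightarrow> S \<subseteq> T \<or> T \<subseteq> S"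
      using C(2) unfolding subset.chain_def by blast+
    obtain S where S: "S \<in> \<C>" using C(1) by blast
    have "ring (\<Union>\<C>)" unfolding ring_def
    proof (intro conjI ballI)
      show "1 \<in> \<Union>\<C>" using S sub unfolding \<A>_def ring_def by blast
      fix u v assume "u \<in> \<Union>\<C>" "v \<in> \<Union>\<C>"
      then obtain Y Z where YZ: "Y \<in> \<C>" "Z \<in> \<C>" "u \<in> Y" "v \<in> Z" by blast
      then obtain W where W: "W \<in> \<C>" "u \<in> W" "v \<in> W" using chain[of Y Z] by blast
      then have "ring W" using sub unfolding \<A>_def by blast
      then show "u - v \<in> \<Union>\<C>" "u * v \<in> \<Union>\<C>" using W unfolding ring_def by blast+
    qed
    then show ?thesis using sub S unfolding \<A>_def by blast
  qed
  ultimately obtain M where M: "M \<in> \<A>" and max: "\<And>S. S \<in> \<A> \<Longrightarrow> M \<subseteq> S \<Longrightarrow> S = M"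
    using subset_Zorn_nonempty[of \<A>] by blast
  have M1: "1 \<in> M" and Md: "\<And>u v. u \<in> M \<Longrightarrow> v \<in> M \<Longrightarrow> u - v \<in> M"
    and Mm: "\<And>u v. u \<in> M \<Longrightarrow> v \<in> M \<Longrightarrow> u * v \<in> M" and BM: "B \<subseteq> M" and piM: "inverse \<pi> \<notin> M"
    using M unfolding \<A>_def ring_def by blast+
  have M0: "0 \<in> M" using Md[OF M1 M1] by simp
  have Ma: "u + v \<in> M" if "u \<in> M" "v \<in> M" for u v using Md[OF that(1) Md[OF M0 that(2)]] by simp
  have Ms: "sum g I \<in> M" if "\<And>i. i \<in> I \<Longrightarrow> g i \<in> M" for g :: "nat \<Rightarrow> 'f" and I
    using that by (induction I rule: infinite_finite_induct) (auto intro: M0 Ma)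
  have pi0: "\<pi> \<noteq> 0" using pi by auto
  define I where "I = (\<lambda>a. \<pi> * a) ` M"
  have I0: "0 \<in> I" using M0 unfolding I_def by force
  have Ia: "u + v \<in> I" if "u \<in> I" "v \<in> I" for u v
    using that Ma unfolding I_def by (auto simp: distrib_left[symmetric])
  have Im: "u * v \<in> I" if "u \<in> I" "v \<in> M" for u v
    using that Mm unfolding I_def by (auto simp: mult.assoc)
  have Id: "u - v \<in> I" if "u \<in> I" "v \<in> I" for u v
    using that Md unfolding I_def by (auto simp: right_diff_distrib[symmetric])
  have IM: "I \<subseteq> M" using pi BM Mm unfolding I_def by blast
  have I1: "1 \<notin> I"
  proof
    assume "1 \<in> I"
    then obtain a where a: "a \<in> M" "1 = \<pi> * a" unfolding I_def by blast
    then have "inverse \<pi> = a" by (simp add: inverse_unique)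
    then show False using a piM by simp
  qed
  \<comment> \<open>Records that adjoining \<open>z\<close> to \<open>M\<close> produces
    \<open>inverse \<pi>\<close>: that identity is multiplied by \<open>\<pi>\<close>, which moves
    its coefficients into the ideal \<open>I\<close>.\<close>
  define rel where "rel z p \<longleftrightarrow> (\<forall>i. poly.coeff p i \<in> I) \<and> poly p z = 1" for z :: 'f and p
  have ex: "\<exists>p. rel z p" if z: "z \<notin> M" for z
  proof -
    define S where "S = (\<lambda>p. poly p z) ` {p. \<forall>i. poly.coeff p i \<in> M}"
    have "M \<subseteq> S"
    proof
      fix a assume "a \<in> M"
      then have "\<forall>i. poly.coeff [:a:] i \<in> M" using M0 by (simp add: coeff_pCons split: nat.split)
      then show "a \<in> S" unfolding S_def by (intro image_eqI[where x = "[:a:]"]) auto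
    qed
    have "\<forall>i. poly.coeff [:0, 1:] i \<in> M" using M0 M1 by (simp add: coeff_pCons split: nat.split)
    then have "z \<in> S" unfolding S_def by (intro image_eqI[where x = "[:0, 1:]"]) auto
    have "ring S" unfolding ring_def
    proof (intro conjI ballI)
      show "1 \<in> S" using \<open>M \<subseteq> S\<close> M1 by blast
      fix u v assume "u \<in> S" "v \<in> S"
      then obtain p q where pq: "u = poly p z" "v = poly q z" "\<forall>i. poly.coeff p i \<in> M" "\<forall>i. poly.coeff q i \<in> M"
        unfolding S_def by blast
      have "\<forall>i. poly.coeff (p - q) i \<in> M" "\<forall>i. poly.coeff (p * q) i \<in> M"
        using pq Md Mm by (auto simp: coeff_mult intro!: Ms)
      then show "u - v \<in> S" "u * v \<in> S" unfolding S_def pq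
        by (intro image_eqI[where x = "p - q"], simp, simp, intro image_eqI[where x = "p * q"], simp, simp)
    qed
    have "S \<notin> \<A>" using max[of S] \<open>M \<subseteq> S\<close> \<open>z \<in> S\<close> z by blast
    then have "inverse \<pi> \<in> S" using \<open>ring S\<close> BM \<open>M \<subseteq> S\<close> unfolding \<A>_def by blast
    then obtain p where p: "inverse \<pi> = poly p z" "\<forall>i. poly.coeff p i \<in> M" unfolding S_def by blast
    have "rel z (Polynomial.smult \<pi> p)" unfolding rel_def I_def using p pi0 by (auto simp: p(1)[symmetric])
    then show ?thesis by blast
  qed
  have step: "\<exists>q. rel z q \<and> Polynomial.degree q < Polynomial.degree p"
    if p: "rel z p" and p': "rel (inverse z) p'" and le: "Polynomial.degree p' \<le> Polynomial.degree p" for z p p'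
  proof -
    define n where "n = Polynomial.degree p"
    define n' where "n' = Polynomial.degree p'"
    define an where "an = poly.coeff p n"
    define b where "b j = poly.coeff p' j" for j
    \<comment> \<open>The relation for \<open>inverse z\<close> expresses \<open>1 - b 0\<close> by
      the terms \<open>b j * inverse z ^ j\<close> with \<open>j \<ge> 1\<close>. After multiplying
      the relation for \<open>z\<close> by \<open>1 - b 0\<close>, this rewrites its top term
      through the powers \<open>z ^ (n - j)\<close>; the exponents make sense because
      \<open>n' \<le> n\<close>.\<close>
    define q where "q = [:b 0:] + Polynomial.smult (1 - b 0) (p - Polynomial.monom an n)
      + (\<Sum>j=1..n'. Polynomial.monom (an * b j) (n - j))"
    have aI: "poly.coeff p i \<in> I" and bI: "b j \<in> I" for i j using p p' unfolding rel_def b_def by auto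
    have n: "n > 0"
    proof (rule ccontr)
      assume "\<not> n > 0"
      then have "p = [:poly.coeff p 0:]" unfolding n_def using degree_0_id[of p] by simp
      then have "poly p z = poly.coeff p 0" by (metis add.right_neutral mult_zero_right poly_0 poly_pCons)
      then show False using p aI[of 0] I1 unfolding rel_def by simp
    qed
    have z0: "z \<noteq> 0"
    proof
      assume "z = 0"
      then have "poly p' (inverse z) = b 0" by (simp add: b_def poly_0_coeff_0)
      then show False using p' bI[of 0] I1 unfolding rel_def by simp
    qed
    have "poly p' (inverse z) = (\<Sum>j\<le>n'. b j * inverse z ^ j)" by (simp add: poly_altdef n'_def b_def)
    also have "\<dots> = b 0 + (\<Sum>j=1..n'. b j * inverse z ^ j)"
      by (simp add: atMost_atLeast0 sum.atLeast_Suc_atMost)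
    finally have b1: "(\<Sum>j=1..n'. b j * inverse z ^ j) = 1 - b 0"
      using p' unfolding rel_def by (simp add: eq_diff_eq add.commute)
    have "(\<Sum>j=1..n'. an * b j * z ^ (n - j)) = (\<Sum>j=1..n'. an * z ^ n * (b j * inverse z ^ j))"
    proof (rule sum.cong)
      fix j assume "j \<in> {1..n'}"
      then have "j \<le> n" using le unfolding n_def n'_def by auto
      then show "an * b j * z ^ (n - j) = an * z ^ n * (b j * inverse z ^ j)"
        using z0 by (simp add: power_diff power_inverse field_simps)
    qed simp
    also have "\<dots> = an * z ^ n * (1 - b 0)" using b1 by (simp add: sum_distrib_left[symmetric])
    finally have "poly q z = b 0 + (1 - b 0) * (1 - an * z ^ n) + an * z ^ n * (1 - b 0)"
      using p unfolding q_def rel_def by (simp add: poly_sum poly_monom)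
    also have "\<dots> = 1" by (simp add: algebra_simps)
    finally have "poly q z = 1" .
    moreover have "poly.coeff q i \<in> I" for i
    proof -
      have 1: "poly.coeff [:b 0:] i \<in> I" using bI I0 by (simp add: coeff_pCons split: nat.split)
      have M2: "1 - b 0 \<in> M" using Md[OF M1] bI IM by blast
      have 2: "poly.coeff (Polynomial.smult (1 - b 0) (p - Polynomial.monom an n)) i \<in> I"
        using Im[OF _ M2] Id[OF aI] aI I0 unfolding an_def by (auto simp: mult.commute)
      have "sum g J \<in> I" if "\<And>i. i \<in> J \<Longrightarrow> g i \<in> I" for g :: "nat \<Rightarrow> 'f" and J
        using that by (induction J rule: infinite_finite_induct) (auto intro: I0 Ia)
      moreover have "poly.coeff (Polynomial.monom (an * b j) (n - j)) i \<in> I" for j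
        using I0 Im[OF aI] bI IM unfolding an_def by auto
      ultimately have 3: "poly.coeff (\<Sum>j=1..n'. Polynomial.monom (an * b j) (n - j)) i \<in> I"
        by (simp add: coeff_sum)
      show ?thesis unfolding q_def using Ia[OF Ia[OF 1 2] 3] by simp
    qed
    moreover have "Polynomial.degree q < n"
    proof -
      have "poly.coeff q i = 0" if "n - 1 < i" for i
      proof -
        have "i \<ge> n" using that n by auto
        have 1: "poly.coeff [:b 0:] i = 0" using \<open>i \<ge> n\<close> n by (simp add: coeff_pCons split: nat.split)
        have 2: "poly.coeff (p - Polynomial.monom an n) i = 0"
          using \<open>i \<ge> n\<close> coeff_eq_0[of p i] unfolding an_def n_def by (cases "i = Polynomial.degree p") auto
        have 3: "poly.coeff (\<Sum>j=1..n'. Polynomial.monom (an * b j) (n - j)) i = 0"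
          unfolding coeff_sum by (rule sum.neutral) (use \<open>i \<ge> n\<close> n in auto)
        show ?thesis unfolding q_def coeff_add coeff_smult 1 2 3 by simp
      qed
      then have "Polynomial.degree q \<le> n - 1" by (intro degree_le) auto
      then show ?thesis using n by simp
    qed
    ultimately show ?thesis unfolding rel_def n_def by blast
  qed
  have "z \<in> M \<or> inverse z \<in> M" for z
  proof (rule ccontr)
    assume *: "\<not> (z \<in> M \<or> inverse z \<in> M)"
    define d where "d w = (LEAST n. \<exists>p. rel w p \<and> Polynomial.degree p = n)" for w
    have dex: "\<exists>p. rel w p \<and> Polynomial.degree p = d w" if "w \<notin> M" for w
      unfolding d_def by (rule LeastI_ex) (use ex[OF that] in blast)
    have dle: "d w \<le> Polynomial.degree p" if "rel w p" for w p
      unfolding d_def by (rule Least_le) (use that in blast)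
    \<comment> \<open>The reduction is symmetric in \<open>z\<close> and its inverse, so each of the
      two least degrees would have to be smaller than the other.\<close>
    have "d w < d w'" if w: "w \<notin> M" "w' \<notin> M" "w' = inverse w" for w w'
    proof (rule ccontr)
      assume "\<not> d w < d w'"
      obtain p p' where "rel w p" "Polynomial.degree p = d w" "rel w' p'" "Polynomial.degree p' = d w'"
        using dex w by blast
      then show False using step[of w p p'] dle[of w] w(3) \<open>\<not> d w < d w'\<close> by fastforce
    qed
    from this[of z "inverse z"] this[of "inverse z" z] * show False by simp
  qed
  \<comment> \<open>The constants must form a proper subset. If they exhausted \<open>M\<close>,
    then \<open>M\<close> would be a field and contain \<open>inverse \<pi>\<close>.\<close>
  moreover have "range c \<noteq> M"
  proof
    assume "range c = M"
    then obtain a where "\<pi> = c a" using pi BM by blast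
    then have "inverse \<pi> = c (inverse a)" by (simp add: c.hom_inverse)
    then show False using piM \<open>range c = M\<close> by blast
  qed
  ultimately have "valuation_ring c M"
    unfolding valuation_ring_def using M1 Md Mm cB BM piM by blast
  then show ?thesis using that BM piM by blast
qed

lemma place_exists:
  fixes c :: "'k::field \<Rightarrow> 'f::field" and B :: "'f set"
  assumes c: "field_hom c" and B1: "1 \<in> B"
    and B: "\<And>u v. u \<in> B \<Longrightarrow> v \<in> B \<Longrightarrow> u - v \<in> B" "\<And>u v. u \<in> B \<Longrightarrow> v \<in> B \<Longrightarrow> u * v \<in> B"
    and cB: "range c \<subseteq> B" and pi: "\<pi> \<in> B" "inverse \<pi> \<notin> B"
  obtains Q where "place c Q" "B \<subseteq> place_ring Q" "\<pi> \<in> Q"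
proof -
  obtain R where R: "valuation_ring c R" "B \<subseteq> R" "inverse \<pi> \<notin> R"
    by (rule valuation_ring_exists[OF assms]) auto
  show ?thesis
    by (rule that[OF place_of_valuation_ring[OF R(1)]])
       (use R pi place_ring_of_place[OF R(1)] in auto)
qed


section \<open>Counting over a finite constant field\<close>

lemma vector_space_hom:
  assumes "field_hom c" shows "vector_space (\<lambda>a v. c a * v)"
proof -
  interpret field_hom c by fact
  show ?thesis by standard (auto simp: algebra_simps hom_add hom_mult)
qed

text \<open>Coordinates in a basis biject the space with functions into a finite set. A dimension is
  thus the logarithm of a cardinality, and every statement about \<open>ell\<close> becomes a
  count.\<close>

lemma card_subspace:
  fixes c :: "'k::{field,finite} \<Rightarrow> 'f::field"
  assumes c: "field_hom c" and fin: "finite V" and V0: "0 \<in> V"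
    and V: "\<And>u v. u \<in> V \<Longrightarrow> v \<in> V \<Longrightarrow> u + v \<in> V" "\<And>a v. v \<in> V \<Longrightarrow> c a * v \<in> V"
  shows "card V = CARD('k) ^ vector_space.dim (\<lambda>a v. c a * v) V"
proof -
  interpret c: field_hom c by fact
  interpret vs: vector_space "\<lambda>a v. c a * v" by (rule vector_space_hom[OF c])
  obtain B where B: "B \<subseteq> V" "vs.independent B" "V \<subseteq> vs.span B" "card B = vs.dim V"
    by (rule vs.basis_exists)
  have finB: "finite B" using finite_subset[OF B(1) fin] .
  have Vs: "sum g I \<in> V" if "\<And>i. i \<in> I \<Longrightarrow> g i \<in> V" for g :: "'f \<Rightarrow> 'f" and I
    using that by (induction I rule: infinite_finite_induct) (auto intro: V V0)
  have "bij_betw (\<lambda>a. \<Sum>b\<in>B. c (a b) * b) (B \<rightarrow>\<^sub>E UNIV) V"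
    unfolding bij_betw_def
  proof
    show "inj_on (\<lambda>a. \<Sum>b\<in>B. c (a b) * b) (B \<rightarrow>\<^sub>E UNIV)"
    proof
      fix a a' :: "'f \<Rightarrow> 'k" assume a: "a \<in> B \<rightarrow>\<^sub>E UNIV" "a' \<in> B \<rightarrow>\<^sub>E UNIV"
        and eq: "(\<Sum>b\<in>B. c (a b) * b) = (\<Sum>b\<in>B. c (a' b) * b)"
      have "(\<Sum>b\<in>B. c (a b - a' b) * b) = 0"
        using eq by (simp add: c.hom_minus left_diff_distrib sum_subtractf)
      from vs.independentD[OF B(2) finB order_refl this] have "a b = a' b" if "b \<in> B" for b
        using that by fastforce
      then show "a = a'" using a by (intro PiE_ext) auto
    qed
    show "(\<lambda>a. \<Sum>b\<in>B. c (a b) * b) ` (B \<rightarrow>\<^sub>E UNIV) = V"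
    proof
      show "(\<lambda>a. \<Sum>b\<in>B. c (a b) * b) ` (B \<rightarrow>\<^sub>E UNIV) \<subseteq> V" using B(1) by (auto intro!: Vs V)
      show "V \<subseteq> (\<lambda>a. \<Sum>b\<in>B. c (a b) * b) ` (B \<rightarrow>\<^sub>E UNIV)"
      proof
        fix v assume "v \<in> V"
        then have "v \<in> range (\<lambda>u. \<Sum>b\<in>B. c (u b) * b)" using B(3) vs.span_finite[OF finB] by auto
        then obtain u where "v = (\<Sum>b\<in>B. c (u b) * b)" by blast
        then have "v = (\<Sum>b\<in>B. c (restrict u B b) * b)" by simp
        then show "v \<in> (\<lambda>a. \<Sum>b\<in>B. c (a b) * b) ` (B \<rightarrow>\<^sub>E UNIV)"
          by (intro image_eqI[where x = "restrict u B"]) auto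
      qed
    qed
  qed
  then have "card (B \<rightarrow>\<^sub>E (UNIV :: 'k set)) = card V" by (rule bij_betw_same_card)
  then show ?thesis using finB B(4) by (simp add: card_PiE)
qed

section \<open>Residue fields and place degrees by counting representatives\<close>

definition residue_reps :: "'f::field set \<Rightarrow> 'f set \<Rightarrow> bool" where
  "residue_reps P V \<longleftrightarrow> V \<subseteq> place_ring P \<and> (\<forall>z\<in>place_ring P. \<exists>!v. v \<in> V \<and> z - v \<in> P)"

lemma residue_reps_card:
  assumes P: "place c P" and V: "residue_reps P V" "residue_reps P W"
  shows "card V = card W"
proof -
  have "\<exists>g. bij_betw g V W" if V: "residue_reps P V" and W: "residue_reps P W" for V W
  proof -
    define g where "g v = (THE w. w \<in> W \<and> v - w \<in> P)" for v
    have g: "g v \<in> W \<and> v - g v \<in> P" if "v \<in> V" for v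
      unfolding g_def by (rule theI') (use that V W in \<open>unfold residue_reps_def, blast\<close>)
    have "bij_betw g V W" unfolding bij_betw_def
    proof
      show "inj_on g V"
      proof
        fix v v' assume v: "v \<in> V" "v' \<in> V" "g v = g v'"
        have "v - v' = (v - g v) - (v' - g v')" using v by simp
        then have "v - v' \<in> P" using place_diff[OF P] g v by metis
        then have "v \<in> V \<and> v - v \<in> P" "v' \<in> V \<and> v - v' \<in> P" using v place_0[OF P] by auto
        moreover have "v \<in> place_ring P" using v V unfolding residue_reps_def by blast
        ultimately show "v = v'" using V unfolding residue_reps_def by blast
      qed
      show "g ` V = W"
      proof
        show "g ` V \<subseteq> W" using g by blast
        show "W \<subseteq> g ` V"
        proof
          fix w assume w: "w \<in> W"
          then have wr: "w \<in> place_ring P" using W unfolding residue_reps_def by blast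
          then obtain v where v: "v \<in> V" "w - v \<in> P" using V unfolding residue_reps_def by blast
          have "w - g v \<in> P" using place_add[OF P v(2) conjunct2[OF g[OF v(1)]]] by simp
          then have "g v \<in> W \<and> w - g v \<in> P" "w \<in> W \<and> w - w \<in> P"
            using g[OF v(1)] w place_0[OF P] by auto
          then have "g v = w" using W wr unfolding residue_reps_def by blast
          then show "w \<in> g ` V" using v by blast
        qed
      qed
    qed
    then show ?thesis by blast
  qed
  then show ?thesis using V bij_betw_same_card by blast
qed

text \<open>A bound on families of pairwise incongruent elements, with no quotient formed, is
  exactly what \<open>card_le_height\<close> delivers.\<close>

definition finite_residue :: "'f::field set \<Rightarrow> bool" where
  "finite_residue P \<longleftrightarrow> (\<exists>k. \<forall>I (g :: nat \<Rightarrow> 'f). finite I \<longrightarrow> g ` I \<subseteq> place_ring P \<longrightarrow>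
     (\<forall>i\<in>I. \<forall>j\<in>I. i \<noteq> j \<longrightarrow> g i - g j \<notin> P) \<longrightarrow> card I \<le> k)"

lemma residue_basis_reps:
  fixes c :: "'k::{field,finite} \<Rightarrow> 'f::field"
  assumes P: "place c P" and B: "residue_basis c P B"
  shows "residue_reps P ((\<lambda>a. \<Sum>b\<in>B. c (a b) * b) ` {a. \<forall>b. b \<notin> B \<longrightarrow> a b = 0})" (is "residue_reps P (?s ` ?A)")
    and "card ((\<lambda>a. \<Sum>b\<in>B. c (a b) * b) ` {a. \<forall>b. b \<notin> B \<longrightarrow> a b = 0}) = CARD('k) ^ card B"
proof -
  have fin: "finite B" and BR: "B \<subseteq> place_ring P"
    and u: "\<And>z. z \<in> place_ring P \<Longrightarrow> \<exists>!a. (\<forall>b. b \<notin> B \<longrightarrow> a b = 0) \<and> z - ?s a \<in> P"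
    using B unfolding residue_basis_def by auto
  have sR: "?s a \<in> place_ring P" for a
    using BR by (intro place_ring_sum[OF P] place_ring_mult[OF P] place_ring_const[OF P]) auto
  show "residue_reps P (?s ` ?A)" unfolding residue_reps_def
  proof (intro conjI ballI)
    show "?s ` ?A \<subseteq> place_ring P" using sR by blast
    fix z assume z: "z \<in> place_ring P"
    show "\<exists>!v. v \<in> ?s ` ?A \<and> z - v \<in> P"
      using u[OF z] by auto
  qed
  have "inj_on ?s ?A"
  proof
    fix a a' assume "a \<in> ?A" "a' \<in> ?A" "?s a = ?s a'"
    then show "a = a'" using u[OF sR[of a]] place_0[OF P] by auto
  qed
  then have "card (?s ` ?A) = card ?A" by (rule card_image)
  also have "bij_betw (\<lambda>a. restrict a B) ?A (B \<rightarrow>\<^sub>E (UNIV :: 'k set))"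
    by (rule bij_betw_byWitness[where f' = "\<lambda>a b. if b \<in> B then a b else 0"])
       (auto simp: fun_eq_iff extensional_def PiE_def)
  then have "card ?A = CARD('k) ^ card B" using fin by (simp add: bij_betw_same_card card_PiE)
  finally show "card (?s ` ?A) = CARD('k) ^ card B" .
qed

lemma card_constants_gt_1: "CARD('k::{field,finite}) > 1"
proof -
  have "card {0, 1 :: 'k} \<le> CARD('k)" by (intro card_mono) auto
  then show ?thesis by simp
qed

text \<open>A set independent modulo \<open>P\<close> and of largest size is a basis, since an
  integral element outside its span could be added to it.\<close>

lemma residue_basis_exists:
  fixes c :: "'k::{field,finite} \<Rightarrow> 'f::field"
  assumes c: "field_hom c" and P: "place c P" and fr: "finite_residue P"
  shows "\<exists>B. residue_basis c P B"
proof -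
  interpret c: field_hom c by fact
  define s where "s B a = (\<Sum>b\<in>B. c (a b) * b)" for B and a :: "'f \<Rightarrow> 'k"
  define ind where "ind B \<longleftrightarrow> finite B \<and> B \<subseteq> place_ring P \<and> (\<forall>a. s B a \<in> P \<longrightarrow> (\<forall>b\<in>B. a b = 0))" for B
  obtain k where k: "\<And>I (g :: nat \<Rightarrow> 'f). finite I \<Longrightarrow> g ` I \<subseteq> place_ring P \<Longrightarrow>
     (\<And>i j. i \<in> I \<Longrightarrow> j \<in> I \<Longrightarrow> i \<noteq> j \<Longrightarrow> g i - g j \<notin> P) \<Longrightarrow> card I \<le> k"
    using fr unfolding finite_residue_def by metis
  have sR: "s B a \<in> place_ring P" if "B \<subseteq> place_ring P" for a B
    unfolding s_def using that by (intro place_ring_sum[OF P] place_ring_mult[OF P] place_ring_const[OF P]) auto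
  \<comment> \<open>Different coefficient vectors give incongruent sums, so
    \<open>CARD('k) ^ card B\<close> is at most the bound \<open>k\<close> for incongruent families,
    and \<open>card B\<close> is smaller still.\<close>
  have bound: "card B \<le> k" if "ind B" for B
  proof -
    have fin: "finite B" and BR: "B \<subseteq> place_ring P" using that unfolding ind_def by auto
    define A where "A = (B \<rightarrow>\<^sub>E (UNIV :: 'k set))"
    have finA: "finite A" unfolding A_def using fin by (intro finite_PiE) auto
    obtain e where e: "bij_betw e {..<card A} A" using finA ex_bij_betw_nat_finite lessThan_atLeast0 by metis
    have "card {..<card A} \<le> k"
    proof (rule k[of _ "\<lambda>i. s B (e i)"])
      show "(\<lambda>i. s B (e i)) ` {..<card A} \<subseteq> place_ring P" using sR[OF BR] by blast
      fix i j assume ij: "i \<in> {..<card A}" "j \<in> {..<card A}" "i \<noteq> j"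
      show "s B (e i) - s B (e j) \<notin> P"
      proof
        assume "s B (e i) - s B (e j) \<in> P"
        then have "s B (\<lambda>b. e i b - e j b) \<in> P"
          by (simp add: s_def c.hom_minus left_diff_distrib sum_subtractf)
        then have "\<forall>b\<in>B. e i b = e j b" using that unfolding ind_def by auto
        moreover have "e i \<in> A" "e j \<in> A" using e ij bij_betwE by blast+
        ultimately have "e i = e j" unfolding A_def by (intro PiE_ext) auto
        then show False using e ij unfolding bij_betw_def inj_on_def by blast
      qed
    qed simp
    then have "CARD('k) ^ card B \<le> k" using fin by (simp add: A_def card_PiE)
    moreover have "card B < CARD('k) ^ card B" using card_constants_gt_1[where 'k = 'k] by (intro power_gt_expt) simp
    ultimately show ?thesis by simp
  qed
  have "ind {}" unfolding ind_def s_def by simp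
  then obtain B where B: "ind B" and max: "\<And>B'. ind B' \<Longrightarrow> card B' \<le> card B"
    using ex_has_greatest_nat[of ind "{}" card "Suc k"] bound by (metis le_imp_less_Suc)
  have fin: "finite B" and BR: "B \<subseteq> place_ring P" and Bi: "\<And>a b. s B a \<in> P \<Longrightarrow> b \<in> B \<Longrightarrow> a b = 0"
    using B unfolding ind_def by auto
  have span: "\<exists>a. z - s B a \<in> P" if z: "z \<in> place_ring P" for z
  proof (cases "z \<in> B")
    case True
    have "s B (\<lambda>b. if b = z then 1 else 0) = (\<Sum>b\<in>B. if b = z then b else 0)"
      unfolding s_def by (rule sum.cong) auto
    also have "\<dots> = z" using True fin by simp
    finally show ?thesis using place_0[OF P] by (intro exI[of _ "\<lambda>b. if b = z then 1 else 0"]) simp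
  next
    case False
    then have "\<not> ind (insert z B)" using max[of "insert z B"] fin by auto
    then obtain a where a: "s (insert z B) a \<in> P" "\<exists>b\<in>insert z B. a b \<noteq> 0"
      unfolding ind_def using fin BR z by auto
    have e: "s (insert z B) a = c (a z) * z + s B a" unfolding s_def using fin False by simp
    have az: "a z \<noteq> 0"
    proof
      assume "a z = 0"
      then have "s B a \<in> P" using a(1) e by simp
      then show False using Bi a(2) \<open>a z = 0\<close> by auto
    qed
    have "s (insert z B) a * c (inverse (a z)) \<in> P" by (rule place_mult[OF P a(1) place_ring_const[OF P]])
    also have "s (insert z B) a * c (inverse (a z)) = z - s B (\<lambda>b. - a b * inverse (a z))"
      unfolding e unfolding s_def using az
      by (simp add: c.hom_uminus c.hom_mult c.hom_inverse sum_negf sum_distrib_left algebra_simps)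
    finally show ?thesis by blast
  qed
  have "residue_basis c P B" unfolding residue_basis_def
  proof (intro conjI ballI)
    fix z assume z: "z \<in> place_ring P"
    obtain a where a: "z - s B a \<in> P" using span[OF z] by blast
    define a' where "a' b = (if b \<in> B then a b else 0)" for b
    have sa: "s B a' = s B a" unfolding s_def a'_def by (rule sum.cong) auto
    show "\<exists>!a. (\<forall>b. b \<notin> B \<longrightarrow> a b = 0) \<and> z - (\<Sum>b\<in>B. c (a b) * b) \<in> P"
    proof (rule ex1I[of _ a'])
      show "(\<forall>b. b \<notin> B \<longrightarrow> a' b = 0) \<and> z - (\<Sum>b\<in>B. c (a' b) * b) \<in> P"
        using a sa unfolding s_def a'_def by auto
      fix a'' assume a'': "(\<forall>b. b \<notin> B \<longrightarrow> a'' b = 0) \<and> z - (\<Sum>b\<in>B. c (a'' b) * b) \<in> P"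
      have "z - s B a' \<in> P" "z - s B a'' \<in> P" using a a'' sa unfolding s_def by simp_all
      from place_diff[OF P this]
      have "s B (\<lambda>b. a'' b - a' b) \<in> P"
        by (simp add: s_def c.hom_minus left_diff_distrib sum_subtractf)
      then have "a'' b = a' b" if "b \<in> B" for b using Bi[of _ b] that by fastforce
      then show "a'' = a'" using a'' unfolding a'_def by (auto simp: fun_eq_iff)
    qed
  qed (use fin BR in auto)
  then show ?thesis by blast
qed

text \<open>\<open>place_degree\<close> is a definite description, so bases of different sizes must
  be excluded: a basis yields \<open>CARD('k) ^ card B\<close> representatives, and all sets of
  representatives are equinumerous.\<close>

lemma residue_reps_exist:
  fixes c :: "'k::{field,finite} \<Rightarrow> 'f::field"
  assumes c: "field_hom c" and P: "place c P" and fr: "finite_residue P"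
  obtains V where "residue_reps P V" "finite V" "card V = CARD('k) ^ place_degree c P" "place_degree c P > 0"
proof -
  obtain B where B: "residue_basis c P B" using residue_basis_exists[OF assms] by blast
  have eq: "card B' = card B" if B': "residue_basis c P B'" for B'
  proof -
    have "CARD('k) ^ card B' = CARD('k) ^ card B"
      using residue_reps_card[OF P residue_basis_reps(1)[OF P B'] residue_basis_reps(1)[OF P B]]
        residue_basis_reps(2)[OF P B'] residue_basis_reps(2)[OF P B] by simp
    then show ?thesis using card_constants_gt_1[where 'k = 'k] by simp
  qed
  have d: "place_degree c P = card B" unfolding place_degree_def
  proof (rule the_equality)
    show "\<exists>B'. residue_basis c P B' \<and> card B' = card B" using B by blast
    show "d = card B" if "\<exists>B'. residue_basis c P B' \<and> card B' = d" for d
      using that eq by blast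
  qed
  have fin: "finite B" using B unfolding residue_basis_def by auto
  have "card B \<noteq> 0"
  proof
    assume "card B = 0"
    then have "B = {}" using fin by simp
    then have "(1 :: 'f) - 0 \<in> P" using B place_ring_1[OF P] unfolding residue_basis_def by auto
    then show False using place_not_1[OF P] by simp
  qed
  let ?V = "((\<lambda>a. \<Sum>b\<in>B. c (a b) * b) ` {a. \<forall>b. b \<notin> B \<longrightarrow> a b = 0})"
  have "card ?V \<noteq> 0" using residue_basis_reps(2)[OF P B] by simp
  then have "finite ?V" by (meson card.infinite)
  then show ?thesis using that residue_basis_reps[OF P B] d \<open>card B \<noteq> 0\<close> by simp
qed

section \<open>Polynomials of bounded degree, amplification and common denominators\<close>

lemma card_poly_degree_less:
  "bij_betw (\<lambda>p. restrict (poly.coeff p) {..<n}) {p :: 'k::{field,finite} poly. \<forall>i\<ge>n. poly.coeff p i = 0} ({..<n} \<rightarrow>\<^sub>E UNIV)"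
  "finite {p :: 'k poly. \<forall>i\<ge>n. poly.coeff p i = 0}"
  "card {p :: 'k poly. \<forall>i\<ge>n. poly.coeff p i = 0} = CARD('k) ^ n"
proof -
  have eq: "poly.coeff (\<Sum>i<n. Polynomial.monom (a i) i) j = (if j < n then a j else 0)"
    for a :: "nat \<Rightarrow> 'k" and j
    by (simp add: coeff_sum)
  show bij: "bij_betw (\<lambda>p. restrict (poly.coeff p) {..<n}) {p :: 'k poly. \<forall>i\<ge>n. poly.coeff p i = 0} ({..<n} \<rightarrow>\<^sub>E UNIV)"
  proof (rule bij_betw_byWitness[where f' = "\<lambda>a. \<Sum>i<n. Polynomial.monom (a i) i"])
    show "\<forall>p\<in>{p :: 'k poly. \<forall>i\<ge>n. poly.coeff p i = 0}.
      (\<Sum>i<n. Polynomial.monom (restrict (poly.coeff p) {..<n} i) i) = p"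
      by (auto simp: poly_eq_iff eq)
    show "\<forall>a\<in>{..<n} \<rightarrow>\<^sub>E (UNIV :: 'k set). restrict (poly.coeff (\<Sum>i<n. Polynomial.monom (a i) i)) {..<n} = a"
    proof
      fix a :: "nat \<Rightarrow> 'k" assume "a \<in> {..<n} \<rightarrow>\<^sub>E (UNIV :: 'k set)"
      then show "restrict (poly.coeff (\<Sum>i<n. Polynomial.monom (a i) i)) {..<n} = a"
        by (intro PiE_ext[of _ "{..<n}" "\<lambda>_. UNIV"]) (simp_all add: eq)
    qed
    show "(\<lambda>a. \<Sum>i<n. Polynomial.monom (a i) i) ` ({..<n} \<rightarrow>\<^sub>E (UNIV :: 'k set)) \<subseteq> {p :: 'k poly. \<forall>i\<ge>n. poly.coeff p i = 0}"
      by (simp add: image_subset_iff eq)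
  qed (simp add: image_subset_iff)
  have "finite ({..<n} \<rightarrow>\<^sub>E (UNIV :: 'k set))" by (intro finite_PiE) auto
  then show "finite {p :: 'k poly. \<forall>i\<ge>n. poly.coeff p i = 0}" using bij bij_betw_finite by blast
  show "card {p :: 'k poly. \<forall>i\<ge>n. poly.coeff p i = 0} = CARD('k) ^ n"
    using bij_betw_same_card[OF bij] by (simp add: card_PiE)
qed

text \<open>\<open>K\<close> does not depend on \<open>N\<close>, so exponential growth swallows it.
  Bounds known up to a constant factor become exact in this way.\<close>

lemma power_growth_le:
  fixes a b K :: nat
  assumes "\<And>N. a ^ N \<le> K * b ^ N" "b > 0"
  shows "a \<le> b"
proof (rule ccontr)
  assume "\<not> a \<le> b"
  then have "real a / real b > 1" using assms(2) by simp
  then obtain N where N: "real K < (real a / real b) ^ N" using real_arch_pow by blast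
  have "real (a ^ N) \<le> real (K * b ^ N)" using assms(1) of_nat_le_iff by blast
  then have "(real a / real b) ^ N \<le> real K" using assms(2) by (simp add: power_divide field_simps)
  then show False using N by simp
qed

lemma common_denominator:
  assumes "finite I"
  shows "\<exists>D n. D \<noteq> 0 \<and> (\<forall>i\<in>I. to_fract D * a i = to_fract (n i :: 'a::idom))"
  using assms
proof induction
  case empty then show ?case by (auto intro: exI[of _ 1])
next
  case (insert j I)
  then obtain D n where D: "D \<noteq> 0" "\<forall>i\<in>I. to_fract D * a i = to_fract (n i)" by blast
  obtain u v where uv: "a j = Fract u v" "v \<noteq> 0" by (cases "a j") auto
  have "to_fract v * a j = to_fract u" using uv by (simp add: to_fract_def eq_fract)
  then have "to_fract (D * v) * a j = to_fract (D * u)" by (simp add: mult.assoc)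
  moreover have "to_fract (D * v) * a i = to_fract (v * n i)" if "i \<in> I" for i
    using D(2) that by (simp add: mult.assoc mult.left_commute)
  ultimately show ?case using D(1) uv(2) insert.hyps
    by (intro exI[of _ "D * v"] exI[of _ "\<lambda>i. if i = j then D * u else v * n i"]) auto
qed

lemma const_fract_0: "const_fract 0 = 0"
  by (simp add: const_fract_def)

lemma field_hom_const_fract: "field_hom const_fract"
  by standard (simp_all add: const_fract_def one_pCons[symmetric] to_fract_mult[symmetric] to_fract_add[symmetric]
    del: to_fract_mult to_fract_add)

lemma field_hom_comp: "field_hom g \<Longrightarrow> field_hom h \<Longrightarrow> field_hom (h \<circ> g)"
proof -
  assume "field_hom g" "field_hom h"
  interpret g: field_hom g by fact
  interpret h: field_hom h by fact
  show ?thesis by standard (simp_all add: g.hom_add h.hom_add g.hom_mult h.hom_mult)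
qed

text \<open>
  The elements \<open>b 0, \<dots>, b (m - 1)\<close> generate \<open>F\<close> as a vector space over \<open>K(x)\<close>; they need not be
  independent, so that \<open>K(x)\<close> itself is the case \<open>m = 1\<close>.
\<close>

locale function_field =
  fixes h :: "'k::{field,finite} poly fract \<Rightarrow> 'f::field" and b :: "nat \<Rightarrow> 'f" and m :: nat
  assumes hom: "field_hom h" and span: "\<exists>a. z = (\<Sum>i<m. h (a i) * b i)"
begin

sublocale h: field_hom h by (rule hom)

abbreviation c :: "'k \<Rightarrow> 'f" where "c \<equiv> h \<circ> const_fract"

abbreviation hp :: "'k poly \<Rightarrow> 'f" where "hp p \<equiv> h (to_fract p)"

lemma c_hom: "field_hom c"
  by (rule field_hom_comp[OF field_hom_const_fract hom])

sublocale c: field_hom "h \<circ> const_fract" by (rule c_hom)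

lemma hp_simps:
  "h (u + v) = h u + h v" "h (u * v) = h u * h v" "h (u - v) = h u - h v" "hp 0 = 0" "hp 1 = 1"
  by (simp_all add: h.hom_add h.hom_mult h.hom_minus)

lemma hp_eq_0: "hp p = 0 \<longleftrightarrow> p = 0"
  by simp

lemma hp_sum: "hp (sum g I) = (\<Sum>i\<in>I. hp (g i))"
  by (induction I rule: infinite_finite_induct) (auto simp: h.hom_add)

section \<open>Boxes of functions with bounded coordinates, and heights\<close>

definition bounded_coords :: "'k poly \<Rightarrow> nat \<Rightarrow> 'f set" where
  "bounded_coords D C = {z. \<exists>p. (\<forall>l<m. Polynomial.degree (p l) \<le> C) \<and> hp D * z = (\<Sum>l<m. hp (p l) * b l)}"

text \<open>An inequality only, because dependent generators can give one element several coordinate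
  vectors. What matters later is the growth rate \<open>m\<close> in \<open>C\<close>; the
  denominator does not enter.\<close>

lemma bounded_coords_card:
  assumes "D \<noteq> 0"
  shows "finite (bounded_coords D C)" "card (bounded_coords D C) \<le> CARD('k) ^ (m * (C + 1))"
proof -
  let ?S = "{p :: 'k poly. \<forall>i\<ge>C+1. poly.coeff p i = 0}"
  let ?A = "{..<m} \<rightarrow>\<^sub>E ?S"
  have fin: "finite ?A" by (intro finite_PiE) (auto intro: card_poly_degree_less)
  have "bounded_coords D C \<subseteq> (\<lambda>p. (\<Sum>l<m. hp (p l) * b l) / hp D) ` ?A"
  proof
    fix z assume "z \<in> bounded_coords D C"
    then obtain p where p: "\<forall>l<m. Polynomial.degree (p l) \<le> C" "hp D * z = (\<Sum>l<m. hp (p l) * b l)"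
      unfolding bounded_coords_def by blast
    have "z = (\<Sum>l<m. hp (restrict p {..<m} l) * b l) / hp D"
      using p(2) assms by (simp add: field_simps hp_eq_0)
    moreover have "restrict p {..<m} \<in> ?A" using p(1) by (auto intro!: coeff_eq_0)
    ultimately show "z \<in> (\<lambda>p. (\<Sum>l<m. hp (p l) * b l) / hp D) ` ?A" by blast
  qed
  then show "finite (bounded_coords D C)" "card (bounded_coords D C) \<le> CARD('k) ^ (m * (C + 1))"
    using finite_subset[OF _ finite_imageI[OF fin]] surj_card_le[OF fin]
    by (auto simp: card_PiE card_poly_degree_less(3) power_mult power_mult_distrib[symmetric] power_commutes
        mult.commute[of m] simp del: mult_Suc mult_Suc_right)
qed

lemma bounded_coords_add: "z \<in> bounded_coords D C \<Longrightarrow> w \<in> bounded_coords D C \<Longrightarrow> z + w \<in> bounded_coords D C"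
proof -
  assume "z \<in> bounded_coords D C" "w \<in> bounded_coords D C"
  then obtain p q where "\<forall>l<m. Polynomial.degree (p l) \<le> C" "hp D * z = (\<Sum>l<m. hp (p l) * b l)"
    "\<forall>l<m. Polynomial.degree (q l) \<le> C" "hp D * w = (\<Sum>l<m. hp (q l) * b l)"
    unfolding bounded_coords_def by blast
  then show ?thesis unfolding bounded_coords_def
    by (intro CollectI exI[of _ "\<lambda>l. p l + q l"])
       (auto simp: degree_add_le hp_simps distrib_left distrib_right sum.distrib)
qed

lemma bounded_coords_0: "0 \<in> bounded_coords D C"
  unfolding bounded_coords_def by (intro CollectI exI[of _ "\<lambda>_. 0"]) (simp add: hp_simps)

lemma bounded_coords_sum: "(\<And>i. i \<in> I \<Longrightarrow> g i \<in> bounded_coords D C) \<Longrightarrow> sum g I \<in> bounded_coords D C"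
  by (induction I rule: infinite_finite_induct) (auto intro: bounded_coords_0 bounded_coords_add)

lemma bounded_coords_mono: "C \<le> C' \<Longrightarrow> bounded_coords D C \<subseteq> bounded_coords D C'"
  unfolding bounded_coords_def by (blast intro: order_trans)

lemma bounded_coords_mult_denominator: "z \<in> bounded_coords D C \<Longrightarrow> z \<in> bounded_coords (d * D) (C + Polynomial.degree d)"
proof -
  assume "z \<in> bounded_coords D C"
  then obtain p where p: "\<forall>l<m. Polynomial.degree (p l) \<le> C" "hp D * z = (\<Sum>l<m. hp (p l) * b l)"
    unfolding bounded_coords_def by blast
  have "Polynomial.degree (d * p l) \<le> C + Polynomial.degree d" if "l < m" for l
    using degree_mult_le[of d "p l"] p(1) that by fastforce
  moreover have "hp (d * D) * z = (\<Sum>l<m. hp (d * p l) * b l)"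
    using p(2) by (simp add: hp_simps sum_distrib_left mult.assoc)
  ultimately show ?thesis unfolding bounded_coords_def by (intro CollectI exI[of _ "\<lambda>l. d * p l"]) auto
qed

lemma in_bounded_coords: "\<exists>D C. D \<noteq> 0 \<and> z \<in> bounded_coords D C"
proof -
  obtain a where a: "z = (\<Sum>i<m. h (a i) * b i)" using span by blast
  obtain D n where D: "D \<noteq> 0" "\<forall>i\<in>{..<m}. to_fract D * a i = to_fract (n i)"
    using common_denominator[of "{..<m}" a] by blast
  have "hp D * z = (\<Sum>i<m. h (to_fract D * a i) * b i)"
    unfolding a by (simp add: sum_distrib_left h.hom_mult mult.assoc)
  also have "\<dots> = (\<Sum>i<m. hp (n i) * b i)" using D(2) by (intro sum.cong) auto
  finally have "z \<in> bounded_coords D (Max ((\<lambda>i. Polynomial.degree (n i)) ` {..<m}))"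
    unfolding bounded_coords_def by (intro CollectI exI[of _ n]) auto
  then show ?thesis using D(1) by blast
qed

lemma common_bounded_coords:
  assumes "finite S"
  shows "\<exists>D C. D \<noteq> 0 \<and> S \<subseteq> bounded_coords D C"
  using assms
proof induction
  case empty then show ?case by (auto intro: exI[of _ 1])
next
  case (insert z S)
  then obtain D C where D: "D \<noteq> 0" "S \<subseteq> bounded_coords D C" by blast
  obtain D' C' where D': "D' \<noteq> 0" "z \<in> bounded_coords D' C'" using in_bounded_coords by blast
  let ?C = "max (C + Polynomial.degree D') (C' + Polynomial.degree D)"
  have "z \<in> bounded_coords (D' * D) ?C" if "z \<in> S" for z
    using bounded_coords_mult_denominator[of z D C D'] bounded_coords_mono[of "C + Polynomial.degree D'" ?C "D' * D"] that D(2) by auto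
  then have "S \<subseteq> bounded_coords (D' * D) ?C" by blast
  moreover have "z \<in> bounded_coords (D' * D) ?C"
    using bounded_coords_mult_denominator[OF D'(2), of D] bounded_coords_mono[of "C' + Polynomial.degree D" ?C "D' * D"] by (auto simp: mult.commute)
  ultimately show ?case using D(1) D'(1) by (intro exI[of _ "D' * D"] exI[of _ ?C]) auto
qed

text \<open>Multiplication by \<open>\<pi>\<close> has a matrix of height at most \<open>\<delta>\<close> with respect to \<open>b\<close>.\<close>

definition has_height :: "'f \<Rightarrow> nat \<Rightarrow> bool" where
  "has_height \<pi> \<delta> \<longleftrightarrow> (\<exists>d. d \<noteq> 0 \<and> Polynomial.degree d \<le> \<delta> \<and> (\<forall>i<m. \<pi> * b i \<in> bounded_coords d \<delta>))"

lemma exists_height: "\<exists>\<delta>. has_height \<pi> \<delta>"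
proof -
  obtain D C where D: "D \<noteq> 0" "(\<lambda>i. \<pi> * b i) ` {..<m} \<subseteq> bounded_coords D C"
    using common_bounded_coords[of "(\<lambda>i. \<pi> * b i) ` {..<m}"] by auto
  then have "has_height \<pi> (max C (Polynomial.degree D))" unfolding has_height_def
    using bounded_coords_mono[of C "max C (Polynomial.degree D)" D] by (intro exI[of _ D]) auto
  then show ?thesis by blast
qed

lemma has_height_hom:
  assumes "hp d * \<pi> = hp n" "d \<noteq> 0" "Polynomial.degree d \<le> \<delta>" "Polynomial.degree n \<le> \<delta>"
  shows "has_height \<pi> \<delta>"
  unfolding has_height_def
proof (intro exI[of _ d] conjI allI impI)
  fix i assume i: "i < m"
  have "hp d * (\<pi> * b i) = hp n * b i" using assms(1) by (simp add: mult.assoc[symmetric])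
  also have "\<dots> = (\<Sum>l<m. hp (if l = i then n else 0) * b l)"
    using i by (simp add: if_distrib if_distribR hp_simps cong: if_cong)
  finally show "\<pi> * b i \<in> bounded_coords d \<delta>" unfolding bounded_coords_def
    using assms(4) by (intro CollectI exI[of _ "\<lambda>l. if l = i then n else 0"]) auto
qed (use assms in auto)

lemma bounded_coords_mult:
  assumes d: "\<forall>i<m. \<pi> * b i \<in> bounded_coords d \<delta>" and w: "w \<in> bounded_coords D C"
  shows "\<pi> * w \<in> bounded_coords (d * D) (C + \<delta>)"
proof -
  obtain p where p: "\<forall>l<m. Polynomial.degree (p l) \<le> C" "hp D * w = (\<Sum>l<m. hp (p l) * b l)"
    using w unfolding bounded_coords_def by blast
  have "\<forall>l. \<exists>q. l < m \<longrightarrow> (\<forall>j<m. Polynomial.degree (q j) \<le> \<delta>) \<and> hp d * (\<pi> * b l) = (\<Sum>j<m. hp (q j) * b j)"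
    using d unfolding bounded_coords_def by blast
  then obtain q where q: "\<And>l j. l < m \<Longrightarrow> j < m \<Longrightarrow> Polynomial.degree (q l j) \<le> \<delta>"
    "\<And>l. l < m \<Longrightarrow> hp d * (\<pi> * b l) = (\<Sum>j<m. hp (q l j) * b j)" by metis
  have "hp (d * D) * (\<pi> * w) = hp d * \<pi> * (hp D * w)" by (simp add: hp_simps)
  also have "\<dots> = (\<Sum>l<m. hp (p l) * (hp d * (\<pi> * b l)))" unfolding p(2) by (simp add: sum_distrib_left algebra_simps)
  also have "\<dots> = (\<Sum>l<m. \<Sum>j<m. hp (p l * q l j) * b j)" using q(2)
    by (intro sum.cong) (auto simp: sum_distrib_left hp_simps mult.assoc)
  also have "\<dots> = (\<Sum>j<m. hp (\<Sum>l<m. p l * q l j) * b j)"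
    by (subst sum.swap) (simp only: hp_sum sum_distrib_right)
  finally have eq: "hp (d * D) * (\<pi> * w) = (\<Sum>j<m. hp (\<Sum>l<m. p l * q l j) * b j)" .
  have "Polynomial.degree (\<Sum>l<m. p l * q l j) \<le> C + \<delta>" if "j < m" for j
    using p(1) q(1) that by (intro degree_sum_le order_trans[OF degree_mult_le] add_mono) auto
  with eq show ?thesis unfolding bounded_coords_def
    by (intro CollectI exI[of _ "\<lambda>j. \<Sum>l<m. p l * q l j"] conjI) simp_all
qed

lemma bounded_coords_mult_power:
  assumes "\<forall>i<m. \<pi> * b i \<in> bounded_coords d \<delta>" "w \<in> bounded_coords D C"
  shows "\<pi> ^ j * w \<in> bounded_coords (d ^ j * D) (C + j * \<delta>)"
proof (induction j)
  case 0 then show ?case using assms(2) by simp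
next
  case (Suc j)
  from bounded_coords_mult[OF assms(1) Suc] show ?case by (simp add: mult.assoc algebra_simps)
qed

text \<open>
  The sums \<open>\<Sum>j<N. \<pi>^j * g (e j)\<close> are pairwise distinct, and lie in a set whose cardinality
  grows like \<open>CARD('k) ^ (m * \<delta> * N)\<close>.
\<close>

lemma card_le_height:
  assumes A: "\<And>u v. u \<in> A \<Longrightarrow> v \<in> A \<Longrightarrow> u - v \<in> A" "\<And>u v. u \<in> A \<Longrightarrow> v \<in> A \<Longrightarrow> u * v \<in> A"
    and pi: "\<pi> \<in> A" "\<pi> \<noteq> 0" "has_height \<pi> \<delta>"
    and I: "finite I" and g: "\<And>i. i \<in> I \<Longrightarrow> g i \<in> A"
    and ne: "\<And>i j. i \<in> I \<Longrightarrow> j \<in> I \<Longrightarrow> i \<noteq> j \<Longrightarrow> (g i - g j) / \<pi> \<notin> A"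
  shows "card I \<le> CARD('k) ^ (m * \<delta>)"
proof -
  obtain d where d: "d \<noteq> 0" "Polynomial.degree d \<le> \<delta>" "\<forall>i<m. \<pi> * b i \<in> bounded_coords d \<delta>"
    using pi(3) unfolding has_height_def by blast
  obtain D C where D: "D \<noteq> 0" "g ` I \<subseteq> bounded_coords D C" using common_bounded_coords[of "g ` I"] I by auto
  have A0: "0 \<in> A" using A(1)[OF pi(1) pi(1)] by simp
  have Aa: "u + v \<in> A" if "u \<in> A" "v \<in> A" for u v using A(1)[OF that(1) A(1)[OF A0 that(2)]] by simp
  have As: "(\<Sum>j<N. \<pi> ^ j * g (e j)) \<in> A" if "\<And>j. j < N \<Longrightarrow> e j \<in> I" for N e
    using that
  proof (induction N arbitrary: e)
    case 0 then show ?case using A0 by simp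
  next
    case (Suc N)
    have "(\<Sum>j<Suc N. \<pi> ^ j * g (e j)) = g (e 0) + \<pi> * (\<Sum>j<N. \<pi> ^ j * g (e (Suc j)))"
      by (subst sum.lessThan_Suc_shift) (simp add: sum_distrib_left mult.assoc)
    then show ?case using Suc.prems Suc.IH[of "\<lambda>j. e (Suc j)"] by (auto intro!: Aa A pi g)
  qed
  \<comment> \<open>Digits in base \<open>\<pi>\<close> are compared from the lowest: the first
    digits differ by \<open>\<pi>\<close> times an element of \<open>A\<close>, which the
    incongruence of the family forbids unless they agree.\<close>
  have inj: "\<forall>j<N. e j = e' j"
    if "(\<Sum>j<N. \<pi> ^ j * g (e j)) = (\<Sum>j<N. \<pi> ^ j * g (e' j))" "\<And>j. j < N \<Longrightarrow> e j \<in> I" "\<And>j. j < N \<Longrightarrow> e' j \<in> I" for N e e'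
    using that
  proof (induction N arbitrary: e e')
    case (Suc N)
    let ?r = "\<lambda>e. \<Sum>j<N. \<pi> ^ j * g (e (Suc j))"
    have sh: "(\<Sum>j<Suc N. \<pi> ^ j * g (e j)) = g (e 0) + \<pi> * ?r e" for e
      by (subst sum.lessThan_Suc_shift) (simp add: sum_distrib_left mult.assoc)
    have eq: "g (e 0) + \<pi> * ?r e = g (e' 0) + \<pi> * ?r e'" using Suc.prems(1) unfolding sh .
    then have "g (e 0) - g (e' 0) = \<pi> * (?r e' - ?r e)" by (simp add: algebra_simps)
    then have "(g (e 0) - g (e' 0)) / \<pi> = ?r e' - ?r e" using pi(2) by simp
    moreover have "?r e' - ?r e \<in> A" using Suc.prems(2,3) by (intro A(1) As) auto
    ultimately have e0: "e 0 = e' 0" using ne[of "e 0" "e' 0"] Suc.prems(2,3) by auto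
    then have "?r e = ?r e'" using eq pi(2) by simp
    from Suc.IH[OF this] Suc.prems(2,3) have "\<forall>j<N. e (Suc j) = e' (Suc j)" by auto
    then show ?case using e0 by (auto simp: less_Suc_eq_0_disj)
  qed simp
  have "card I ^ N \<le> CARD('k) ^ (m * (C + 1)) * (CARD('k) ^ (m * \<delta>)) ^ N" for N
  proof -
    let ?E = "{..<N} \<rightarrow>\<^sub>E I"
    let ?s = "\<lambda>e. \<Sum>j<N. \<pi> ^ j * g (e j)"
    have "inj_on ?s ?E"
    proof
      fix e e' assume e: "e \<in> ?E" "e' \<in> ?E" "?s e = ?s e'"
      have "\<forall>j<N. e j = e' j" by (rule inj[OF e(3)]) (use e in auto)
      then show "e = e'" using e by (intro PiE_ext) auto
    qed
    moreover have "?s ` ?E \<subseteq> bounded_coords (d ^ N * D) (C + N * \<delta>)"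
    proof (intro image_subsetI bounded_coords_sum)
      fix e j assume e: "e \<in> ?E" and j: "j \<in> {..<N}"
      have "\<pi> ^ j * g (e j) \<in> bounded_coords (d ^ j * D) (C + j * \<delta>)"
        by (rule bounded_coords_mult_power[OF d(3)]) (use e j D in auto)
      \<comment> \<open>The factor \<open>d ^ (N - j)\<close> brings all terms to one denominator.
        Its cost of at most \<open>\<delta> * (N - j)\<close> in degree complements the
        \<open>j * \<delta>\<close> already spent.\<close>
      from bounded_coords_mult_denominator[OF this, of "d ^ (N - j)"]
      have 1: "\<pi> ^ j * g (e j) \<in> bounded_coords (d ^ N * D) (C + j * \<delta> + Polynomial.degree (d ^ (N - j)))"
        using j by (simp add: mult.assoc[symmetric] power_add[symmetric])
      have "Polynomial.degree (d ^ (N - j)) \<le> \<delta> * (N - j)"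
        using degree_power_le[of d "N - j"] d(2) by (meson mult_le_mono1 order_trans)
      then have "C + j * \<delta> + Polynomial.degree (d ^ (N - j)) \<le> C + j * \<delta> + \<delta> * (N - j)" by simp
      also have "\<dots> = C + N * \<delta>" using j by (simp add: algebra_simps diff_mult_distrib2)
      finally show "\<pi> ^ j * g (e j) \<in> bounded_coords (d ^ N * D) (C + N * \<delta>)" using 1 bounded_coords_mono by blast
    qed
    ultimately have "card ?E \<le> card (bounded_coords (d ^ N * D) (C + N * \<delta>))"
      using bounded_coords_card(1)[of "d ^ N * D"] d(1) D(1) by (intro card_inj_on_le) auto
    also have "\<dots> \<le> CARD('k) ^ (m * (C + N * \<delta> + 1))" using d(1) D(1) by (intro bounded_coords_card) auto
    also have "\<dots> = CARD('k) ^ (m * (C + 1)) * (CARD('k) ^ (m * \<delta>)) ^ N"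
      by (simp add: power_add power_mult[symmetric] algebra_simps)
    finally show ?thesis using I by (simp add: card_PiE)
  qed
  \<comment> \<open>The factor that stems from the initial bound \<open>C\<close> is constant in
    \<open>N\<close> and is amplified away.\<close>
  then show ?thesis by (rule power_growth_le) simp
qed

text \<open>The source of discreteness. The \<open>z i\<close> have strictly decreasing valuations,
  all below that of \<open>\<pi>\<close>, so a nontrivial constant combination of them has the
  valuation of one of its terms and is not divisible by \<open>\<pi>\<close>. Hence the
  \<open>CARD('k) ^ k\<close> combinations are pairwise incongruent modulo
  \<open>\<pi>\<close>.\<close>

lemma chain_length_le_height:
  assumes Q: "place c Q" and pi: "\<pi> \<noteq> 0" "has_height \<pi> \<delta>"
    and z: "\<And>i. i < k \<Longrightarrow> z i \<in> place_ring Q \<and> z i \<noteq> 0 \<and> \<pi> / z i \<in> Q"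
    and zz: "\<And>i j. i < j \<Longrightarrow> j < k \<Longrightarrow> z i / z j \<in> Q"
  shows "k \<le> m * \<delta>"
proof (cases "k = 0")
  case False
  let ?A = "{..<k} \<rightarrow>\<^sub>E (UNIV :: 'k set)"
  have "\<pi> / z 0 * z 0 \<in> Q" using z[of 0] place_mult[OF Q, of "\<pi> / z 0" "z 0"] False by blast
  moreover have "z 0 \<noteq> 0" using z[of 0] False by blast
  ultimately have piR: "\<pi> \<in> place_ring Q" using place_subset[OF Q] by auto
  have "card ?A \<le> CARD('k) ^ (m * \<delta>)"
  proof (rule card_le_height[OF place_ring_diff[OF Q] place_ring_mult[OF Q] piR pi, where g = "\<lambda>a. \<Sum>i<k. c (a i) * z i"])
    show "(\<Sum>i<k. c (a i) * z i) \<in> place_ring Q" for a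
      using z by (intro place_ring_sum[OF Q] place_ring_mult[OF Q] place_ring_const[OF Q]) auto
  next
    fix a a' assume a: "a \<in> ?A" "a' \<in> ?A" "a \<noteq> a'"
    define e where "e i = a i - a' i" for i
    define J where "J = {i. i < k \<and> e i \<noteq> 0}"
    have "J \<noteq> {}" using a PiE_ext[OF a(1,2)] unfolding J_def e_def by fastforce
    \<comment> \<open>Valuations decrease along the chain, so the largest index with a nonzero
      coefficient carries the leading term.\<close>
    define j where "j = Max J"
    have j: "j \<in> J" unfolding j_def by (rule Max_in) (use \<open>J \<noteq> {}\<close> in \<open>auto simp: J_def\<close>)
    have jm: "e i = 0" if "j < i" "i < k" for i
      using that Max_ge[of J i] unfolding j_def by (fastforce simp: J_def)
    have zj: "z j \<noteq> 0" "\<pi> / z j \<in> Q" using z[of j] j unfolding J_def by auto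
    have s: "(\<Sum>i<k. c (a i) * z i) - (\<Sum>i<k. c (a' i) * z i) = (\<Sum>i<k. c (e i) * z i)"
      unfolding e_def by (simp only: c.hom_minus left_diff_distrib sum_subtractf)
    show "((\<Sum>i<k. c (a i) * z i) - (\<Sum>i<k. c (a' i) * z i)) / \<pi> \<notin> place_ring Q"
    proof
      assume "((\<Sum>i<k. c (a i) * z i) - (\<Sum>i<k. c (a' i) * z i)) / \<pi> \<in> place_ring Q"
      from place_mult[OF Q zj(2) this]
      have "(\<Sum>i<k. c (e i) * z i) / z j \<in> Q" unfolding s using pi(1) by simp
      moreover have "(\<Sum>i\<in>{..<k} - {j}. c (e i) * z i) / z j \<in> Q"
        unfolding sum_divide_distrib
      proof (rule place_sum[OF Q])
        fix i assume i: "i \<in> {..<k} - {j}"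
        show "c (e i) * z i / z j \<in> Q"
        proof (cases "i < j")
          case True
          then have "z i / z j \<in> Q" using zz j unfolding J_def by auto
          from place_mult[OF Q this place_ring_const[OF Q, of "e i"]] show ?thesis by (simp add: mult.commute)
        next
          case False
          then have "e i = 0" using jm i by auto
          then show ?thesis using place_0[OF Q] by (simp add: const_fract_0)
        qed
      qed
      moreover have "(\<Sum>i<k. c (e i) * z i) = c (e j) * z j + (\<Sum>i\<in>{..<k} - {j}. c (e i) * z i)"
        using j unfolding J_def by (intro sum.remove) auto
      ultimately have "c (e j) \<in> Q"
        using place_diff[OF Q, of "(\<Sum>i<k. c (e i) * z i) / z j" "(\<Sum>i\<in>{..<k} - {j}. c (e i) * z i) / z j"] zj(1)
        by (simp add: add_divide_distrib)
      then show False using place_const[OF Q c_hom] j unfolding J_def by blast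
    qed
  qed (auto intro: finite_PiE)
  then have "CARD('k) ^ k \<le> CARD('k) ^ (m * \<delta>)" by (simp add: card_PiE)
  then show ?thesis using card_constants_gt_1[where 'k = 'k] by simp
qed simp

text \<open>Without an element of least positive valuation one could descend forever from a fixed
  \<open>\<pi>\<close>, against the bound on chains.\<close>

lemma exists_place_generator:
  assumes Q: "place c Q"
  obtains t where "t \<in> Q" "t \<noteq> 0" "\<And>z. z \<in> Q \<Longrightarrow> z / t \<in> place_ring Q"
proof (rule ccontr)
  assume "\<not> thesis"
  then have "\<And>t. t \<in> Q \<Longrightarrow> t \<noteq> 0 \<Longrightarrow> \<exists>z. z \<in> Q \<and> z / t \<notin> place_ring Q" using that by blast
  then obtain nx where nx: "\<And>t. t \<in> Q \<Longrightarrow> t \<noteq> 0 \<Longrightarrow> nx t \<in> Q \<and> nx t / t \<notin> place_ring Q" by metis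
  have nx2: "nx t \<in> Q \<and> nx t \<noteq> 0 \<and> t / nx t \<in> Q" if "t \<in> Q" "t \<noteq> 0" for t
    using nx[OF that] in_place_iff[OF Q, of "t / nx t"] place_ring_0[OF Q] by auto
  obtain \<pi> where pi: "\<pi> \<in> Q" "\<pi> \<noteq> 0" by (rule place_nontrivial[OF Q])
  obtain \<delta> where h: "has_height \<pi> \<delta>" using exists_height by blast
  define w where "w n = (nx ^^ n) \<pi>" for n
  have w: "w n \<in> Q \<and> w n \<noteq> 0" for n
    by (induction n) (use pi nx2 in \<open>auto simp: w_def\<close>)
  have w1: "w n / w (Suc n) \<in> Q" for n using nx2[of "w n"] w[of n] by (simp add: w_def)
  have ww: "w i / w j \<in> Q" if "i < j" for i j
    using that
  proof (induction j)
    case (Suc j)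
    show ?case
    proof (cases "i = j")
      case True then show ?thesis using w1 by simp
    next
      case False
      then have "w i / w j \<in> Q" using Suc by simp
      then have "w i / w j * (w j / w (Suc j)) \<in> Q"
        by (rule place_mult[OF Q]) (use w1[of j] place_subset[OF Q] in blast)
      also have "w i / w j * (w j / w (Suc j)) = w i / w (Suc j)" using w[of j] by simp
      finally show ?thesis .
    qed
  qed simp
  \<comment> \<open>One member more than the bound allows. The chain starts at \<open>w 1\<close>,
    since its members must have valuation strictly below that of \<open>w 0 = \<pi>\<close>.\<close>
  have "Suc (m * \<delta>) \<le> m * \<delta>"
  proof (rule chain_length_le_height[OF Q pi(2) h, where z = "\<lambda>i. w (Suc i)"])
    show "w (Suc i) \<in> place_ring Q \<and> w (Suc i) \<noteq> 0 \<and> \<pi> / w (Suc i) \<in> Q" for i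
      using w[of "Suc i"] ww[of 0 "Suc i"] place_subset[OF Q] by (auto simp: w_def)
    show "i < j \<Longrightarrow> w (Suc i) / w (Suc j) \<in> Q" for i j by (rule ww) simp
  qed
  then show False by simp
qed

text \<open>The powers of a generator \<open>t\<close> that divide an integral \<open>z\<close> form
  a chain, so there is a greatest one. The remaining quotient is a unit, since otherwise
  \<open>t\<close> would divide it once more.\<close>

lemma discrete:
  assumes Q: "place c Q"
  shows "discrete_place c Q"
proof -
  obtain t where t: "t \<in> Q" "t \<noteq> 0" "\<And>z. z \<in> Q \<Longrightarrow> z / t \<in> place_ring Q"
    by (rule exists_place_generator[OF Q]) blast
  have tR: "t ^ n \<in> place_ring Q" for n using t(1) place_subset[OF Q] place_ring_power[OF Q] by auto
  have tQ: "t ^ n \<in> Q" if n: "n > 0" for n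
  proof -
    obtain k where "n = Suc k" using n by (cases n) auto
    then show ?thesis using place_mult[OF Q t(1) tR[of k]] by simp
  qed
  have *: "\<exists>n u. place_unit Q u \<and> z = t ^ n * u" if z: "z \<in> place_ring Q" "z \<noteq> 0" for z
  proof -
    obtain \<delta> where h: "has_height z \<delta>" using exists_height by blast
    \<comment> \<open>The powers are listed from \<open>t ^ (n - 1)\<close> down to
      \<open>t ^ 0\<close>, because a chain has decreasing valuations.\<close>
    have bound: "n \<le> m * \<delta>" if n: "z / t ^ n \<in> place_ring Q" for n
    proof (rule chain_length_le_height[OF Q z(2) h, where z = "\<lambda>i. t ^ (n - 1 - i)"])
      fix i assume "i < n"
      then have "n - (n - 1 - i) > 0" by auto
      have "n = (n - 1 - i) + (n - (n - 1 - i))" using \<open>i < n\<close> by auto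
      then have e: "t ^ n = t ^ (n - 1 - i) * t ^ (n - (n - 1 - i))" by (metis power_add)
      have "t ^ (n - (n - 1 - i)) * (z / t ^ n) \<in> Q"
        using place_mult[OF Q tQ n] \<open>n - (n - 1 - i) > 0\<close> by blast
      also have "t ^ (n - (n - 1 - i)) * (z / t ^ n) = z / t ^ (n - 1 - i)" unfolding e using t(2) by simp
      finally show "t ^ (n - 1 - i) \<in> place_ring Q \<and> t ^ (n - 1 - i) \<noteq> 0 \<and> z / t ^ (n - 1 - i) \<in> Q"
        using tR t(2) by auto
    next
      fix i j assume "i < j" "j < n"
      then have "t ^ (n - 1 - i) / t ^ (n - 1 - j) = t ^ (j - i)"
        using t(2) by (simp add: power_diff[symmetric])
      then show "t ^ (n - 1 - i) / t ^ (n - 1 - j) \<in> Q" using tQ[of "j - i"] \<open>i < j\<close> by simp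
    qed
    define n where "n = (GREATEST n. z / t ^ n \<in> place_ring Q)"
    have n: "z / t ^ n \<in> place_ring Q" unfolding n_def
      by (rule GreatestI_nat[where k = 0 and b = "m * \<delta>"]) (use z bound in auto)
    have "z / t ^ Suc n \<notin> place_ring Q"
    proof
      assume "z / t ^ Suc n \<in> place_ring Q"
      then have "Suc n \<le> n" unfolding n_def by (rule Greatest_le_nat[where b = "m * \<delta>"]) (use bound in auto)
      then show False by simp
    qed
    then have "z / t ^ n \<notin> Q" using t(3)[of "z / t ^ n"] by (auto simp: mult.commute)
    then have "place_unit Q (z / t ^ n)" using n place_unit_iff[OF Q] by blast
    moreover have "z = t ^ n * (z / t ^ n)" using t(2) by simp
    ultimately show ?thesis by blast
  qed
  have "\<exists>n u. place_unit Q u \<and> z = t powi n * u" if z0: "z \<noteq> 0" for z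
  proof (cases "z \<in> place_ring Q")
    case True
    then obtain n u where "place_unit Q u" "z = t ^ n * u" using *[OF _ z0] by blast
    then show ?thesis by (intro exI[of _ "int n"] exI[of _ u]) simp
  next
    case False
    then have "inverse z \<in> place_ring Q" by (rule place_ring_total[OF Q])
    then obtain n u where u: "place_unit Q u" "inverse z = t ^ n * u" using *[of "inverse z"] z0 by auto
    then have "z = inverse (t ^ n * u)" by (metis inverse_inverse_eq)
    then have "z = t powi (- int n) * inverse u" by (simp add: power_int_minus)
    then show ?thesis using place_unit_inverse[OF u(1)] by blast
  qed
  then show ?thesis unfolding discrete_place_def uniformizer_def using Q t by blast
qed

text \<open>Elements incongruent modulo \<open>Q\<close> are incongruent modulo any nonzero
  \<open>\<pi>\<close> in \<open>Q\<close>, so the height of one such \<open>\<pi>\<close> bounds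
  the number of residue classes.\<close>

lemma finite_residue:
  assumes Q: "place c Q"
  shows "finite_residue Q"
proof -
  obtain \<pi> where pi: "\<pi> \<in> Q" "\<pi> \<noteq> 0" by (rule place_nontrivial[OF Q])
  obtain \<delta> where h: "has_height \<pi> \<delta>" using exists_height by blast
  have "card I \<le> CARD('k) ^ (m * \<delta>)"
    if I: "finite I" "g ` I \<subseteq> place_ring Q" "\<And>i j. i \<in> I \<Longrightarrow> j \<in> I \<Longrightarrow> i \<noteq> j \<Longrightarrow> g i - g j \<notin> Q"
    for I and g :: "nat \<Rightarrow> 'f"
  proof (rule card_le_height[OF place_ring_diff[OF Q] place_ring_mult[OF Q] _ pi(2) h I(1)])
    show "\<pi> \<in> place_ring Q" using pi place_subset[OF Q] by blast
    show "i \<in> I \<Longrightarrow> g i \<in> place_ring Q" for i using I(2) by blast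
    fix i j assume ij: "i \<in> I" "j \<in> I" "i \<noteq> j"
    show "(g i - g j) / \<pi> \<notin> place_ring Q"
    proof
      assume "(g i - g j) / \<pi> \<in> place_ring Q"
      from place_mult[OF Q pi(1) this] show False using I(3)[OF ij] pi(2) by simp
    qed
  qed
  then show ?thesis unfolding finite_residue_def
    by (intro exI[of _ "CARD('k) ^ (m * \<delta>)"] allI impI) simp
qed

end

section \<open>Weak approximation\<close>

context
  fixes c :: "'k::field \<Rightarrow> 'f::field"
begin

text \<open>By maximality neither valuation ring contains the other; the quotient of two witnesses
  of this has strict signs at both places.\<close>

lemma discrete_places_separate:
  assumes Q: "discrete_place c Q" "discrete_place c Q'" "Q \<noteq> Q'"
  obtains u where "u \<noteq> 0" "place_val Q u > 0" "place_val Q' u < 0"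
proof -
  note pl = discrete_place_place[OF Q(1)] discrete_place_place[OF Q(2)]
  obtain z1 where z1: "z1 \<in> place_ring Q" "z1 \<notin> place_ring Q'"
    using place_ring_maximal[OF Q(1) pl(2)] place_ring_inj[OF pl] Q(3) by blast
  obtain z2 where z2: "z2 \<in> place_ring Q'" "z2 \<notin> place_ring Q"
    using place_ring_maximal[OF Q(2) pl(1)] place_ring_inj[OF pl] Q(3) by blast
  have nz: "z1 \<noteq> 0" "z2 \<noteq> 0" using z1 z2 place_ring_0[OF pl(1)] place_ring_0[OF pl(2)] by auto
  have "place_val Q z1 \<ge> 0" "place_val Q' z1 < 0" "place_val Q' z2 \<ge> 0" "place_val Q z2 < 0"
    using z1 z2 nz place_val_nonneg[OF Q(1)] place_val_nonneg[OF Q(2)] by (auto simp: not_le[symmetric])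
  then show ?thesis using that[of "z1 / z2"] nz
    by (simp add: place_val_divide[OF Q(1)] place_val_divide[OF Q(2)])
qed

lemma exists_zero_with_poles:
  assumes S: "finite S" and dS: "\<And>Q'. Q' \<in> S \<Longrightarrow> discrete_place c Q'"
    and Q: "discrete_place c Q" "Q \<notin> S"
  shows "\<exists>u. u \<noteq> 0 \<and> place_val Q u > 0 \<and> (\<forall>Q'\<in>S. place_val Q' u < 0)"
  using S dS Q(2)
proof (induction S)
  case empty
  obtain t where "t \<noteq> 0" "place_val Q t = 1" by (rule exists_place_val[OF Q(1)])
  then show ?case by (intro exI[of _ t]) auto
next
  case (insert R S)
  have dR: "discrete_place c R" and RQ: "Q \<noteq> R" and dS: "\<And>Q'. Q' \<in> S \<Longrightarrow> discrete_place c Q'"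
    using insert.prems by auto
  obtain y where y: "y \<noteq> 0" "place_val Q y > 0" "\<And>Q'. Q' \<in> S \<Longrightarrow> place_val Q' y < 0"
    using insert.IH insert.prems by auto
  obtain z where z: "z \<noteq> 0" "place_val Q z > 0" "place_val R z < 0"
    by (rule discrete_places_separate[OF Q(1) dR RQ])
  show ?case
  proof (cases "place_val R y < 0")
    case True then show ?thesis using y by (intro exI[of _ y]) auto
  next
    case False
    \<comment> \<open>The exponents at which the leading terms of \<open>z ^ r\<close> and
      \<open>y\<close> could cancel at \<open>Q'\<close>. Each place contributes at most one, so all
      but finitely many \<open>r\<close> are good. Excluding 0 as well makes \<open>z ^ r\<close> a
      genuine zero at \<open>Q\<close> and a genuine pole at \<open>R\<close>.\<close>
    define bad where "bad Q' = {r. int r * place_val Q' z = place_val Q' y}" for Q'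
    have "finite (bad Q')" if "Q' \<in> S" for Q'
    proof (cases "place_val Q' z = 0")
      case True then have "bad Q' = {}" using y(3)[OF that] by (auto simp: bad_def) then show ?thesis by simp
    next
      case False
      have "bad Q' \<subseteq> {nat (place_val Q' y div place_val Q' z)}"
      proof
        fix r assume "r \<in> bad Q'"
        then have "place_val Q' y div place_val Q' z = int r" using False by (simp add: bad_def flip: of_nat_mult)
          (metis nonzero_mult_div_cancel_right)
        then show "r \<in> {nat (place_val Q' y div place_val Q' z)}" by simp
      qed
      then show ?thesis using finite_subset by blast
    qed
    then have "finite (insert 0 (\<Union>(bad ` S)))" using insert.hyps by auto
    then obtain r where r: "r \<notin> insert 0 (\<Union>(bad ` S))" using ex_new_if_finite[OF infinite_UNIV_nat] by blast
    have zr: "z ^ r \<noteq> 0" using z by simp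
    let ?u = "z ^ r + y"
    have "place_val R (z ^ r) < place_val R y"
    proof -
      have "place_val R (z ^ r) = int r * place_val R z" by (rule place_val_power[OF dR z(1)])
      also have "\<dots> < 0" using r z(3) by (simp add: mult_pos_neg)
      finally show ?thesis using False by simp
    qed
    then have u: "?u \<noteq> 0" "place_val R ?u < 0"
      using place_val_add_eq[OF dR zr, of y] False r z(3) place_val_power[OF dR z(1), of r] mult_pos_neg[of "int r"]
      by auto
    have "z ^ r \<in> Q" "y \<in> Q"
      using place_val_pos[OF Q(1)] y(1,2) zr z r by (auto simp: place_val_power[OF Q(1)])
    then have "?u \<in> Q" by (rule place_add[OF discrete_place_place[OF Q(1)]])
    then have "place_val Q ?u > 0" using place_val_pos[OF Q(1) u(1)] by simp
    moreover have "place_val Q' ?u < 0" if Q': "Q' \<in> S" for Q'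
    proof -
      have ne: "place_val Q' (z ^ r) \<noteq> place_val Q' y"
        using r Q' by (auto simp: bad_def place_val_power[OF dS[OF Q'] z(1)])
      show ?thesis
      proof (cases "place_val Q' (z ^ r) < place_val Q' y")
        case True then show ?thesis using place_val_add_eq[OF dS[OF Q'] zr, of y] y(3)[OF Q'] by simp
      next
        case False
        then show ?thesis using ne place_val_add_eq[OF dS[OF Q'] y(1), of "z ^ r"] y(3)[OF Q'] by (simp add: add.commute)
      qed
    qed
    ultimately show ?thesis using u by (intro exI[of _ ?u]) auto
  qed
qed

text \<open>For \<open>v = u ^ Suc s\<close> the function \<open>1 / (1 + v)\<close> is close to 1
  where \<open>v\<close> is small and close to 0 where \<open>v\<close> is large.\<close>

lemma approximate_one:
  assumes S: "finite S" and dS: "\<And>Q'. Q' \<in> S \<Longrightarrow> discrete_place c Q'"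
    and Q: "discrete_place c Q" "Q \<notin> S"
  shows "\<exists>w. w - 1 \<in> val_ideal Q (int s) \<and> (\<forall>Q'\<in>S. w \<in> val_ideal Q' (int s))"
proof -
  obtain u where u: "u \<noteq> 0" "place_val Q u > 0" "\<And>Q'. Q' \<in> S \<Longrightarrow> place_val Q' u < 0"
    using exists_zero_with_poles[OF assms] by blast
  let ?v = "u ^ Suc s"
  have v0: "?v \<noteq> 0" using u by simp
  have vQ: "place_val Q ?v \<ge> int (Suc s)"
  proof -
    have "int (Suc s) * 1 \<le> int (Suc s) * place_val Q u" using u(2) by (intro mult_left_mono) auto
    then show ?thesis using place_val_power[OF Q(1) u(1), of "Suc s"] by simp
  qed
  have one: "1 + ?v \<noteq> 0" "place_val Q (1 + ?v) = 0"
    using place_val_add_eq[OF Q(1), of 1 ?v] vQ by (simp_all add: place_val_1[OF Q(1)])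
  have "1 / (1 + ?v) - 1 = (- ?v) / (1 + ?v)" using one by (simp add: field_simps)
  then have "1 / (1 + ?v) - 1 \<in> val_ideal Q (int s)"
    using vQ v0 one unfolding val_ideal_def
    by (simp add: place_val_divide[OF Q(1)] place_val_minus[OF Q(1)] del: power_Suc)
  moreover have "1 / (1 + ?v) \<in> val_ideal Q' (int s)" if Q': "Q' \<in> S" for Q'
  proof -
    note d = dS[OF Q']
    have "int (Suc s) * place_val Q' u \<le> int (Suc s) * (- 1)" using u(3)[OF Q'] by (intro mult_left_mono) auto
    then have vQ': "place_val Q' ?v \<le> - int (Suc s)" using place_val_power[OF d u(1), of "Suc s"] by simp
    then have "place_val Q' ?v < place_val Q' 1" by (simp add: place_val_1[OF d])
    then have "place_val Q' (?v + 1) = place_val Q' ?v" using place_val_add_eq[OF d v0, of 1] by simp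
    then show ?thesis using vQ' one(1) unfolding val_ideal_def
      by (simp add: place_val_divide[OF d] place_val_1[OF d] add.commute del: power_Suc)
  qed
  ultimately show ?thesis by blast
qed

lemma weak_approximation:
  assumes S: "finite S" and dS: "\<And>Q. Q \<in> S \<Longrightarrow> discrete_place c Q"
  shows "\<exists>x. \<forall>Q\<in>S. x - z Q \<in> val_ideal Q (k Q)"
proof -
  \<comment> \<open>One accuracy for all pairs of places; it also absorbs the poles that the target
    \<open>z Q'\<close> of one place may have at another.\<close>
  define s where "s = nat (\<Sum>Q\<in>S. \<Sum>Q'\<in>S. \<bar>k Q - place_val Q (z Q')\<bar>)"
  have s: "k Q \<le> int s + place_val Q (z Q')" if "Q \<in> S" "Q' \<in> S" for Q Q'
  proof -
    have "\<bar>k Q - place_val Q (z Q')\<bar> \<le> (\<Sum>Q'\<in>S. \<bar>k Q - place_val Q (z Q')\<bar>)"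
      by (rule member_le_sum) (use that S in auto)
    also have "\<dots> \<le> (\<Sum>Q\<in>S. \<Sum>Q'\<in>S. \<bar>k Q - place_val Q (z Q')\<bar>)"
      by (rule member_le_sum[where f = "\<lambda>Q. \<Sum>Q'\<in>S. \<bar>k Q - place_val Q (z Q')\<bar>"]) (use that S in \<open>auto intro: sum_nonneg\<close>)
    finally show ?thesis unfolding s_def by linarith
  qed
  have "\<exists>w. w - 1 \<in> val_ideal Q (int s) \<and> (\<forall>Q'\<in>S - {Q}. w \<in> val_ideal Q' (int s))" if "Q \<in> S" for Q
    by (rule approximate_one) (use S dS that in auto)
  then obtain w where w: "\<And>Q. Q \<in> S \<Longrightarrow> w Q - 1 \<in> val_ideal Q (int s)"
    "\<And>Q Q'. Q \<in> S \<Longrightarrow> Q' \<in> S \<Longrightarrow> Q' \<noteq> Q \<Longrightarrow> w Q \<in> val_ideal Q' (int s)" by (metis DiffI singletonD)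
  have "(\<Sum>Q'\<in>S. w Q' * z Q') - z Q \<in> val_ideal Q (k Q)" if Q: "Q \<in> S" for Q
  proof -
    note d = dS[OF Q]
    have *: "u * z Q' \<in> val_ideal Q (k Q)" if "u \<in> val_ideal Q (int s)" "Q' \<in> S" for u Q'
    proof -
      have "z Q' \<in> val_ideal Q (place_val Q (z Q'))" by (simp add: val_ideal_def)
      from val_ideal_mono[OF d s[OF Q that(2)] val_ideal_mult[OF d that(1) this]] show ?thesis .
    qed
    have "(\<Sum>Q'\<in>S. w Q' * z Q') - z Q = (w Q - 1) * z Q + (\<Sum>Q'\<in>S - {Q}. w Q' * z Q')"
      using Q S by (simp add: sum.remove[of S Q] algebra_simps)
    also have "\<dots> \<in> val_ideal Q (k Q)"
      by (intro val_ideal_add[OF d] val_ideal_sum[OF d] *) (use w Q in auto)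
    finally show ?thesis .
  qed
  then show ?thesis by blast
qed

text \<open>The digits of a truncated \<open>t\<close>-adic expansion: the lowest is determined by
  its residue class, and after removing it and dividing by \<open>t\<close> the precision drops by
  one.\<close>

lemma reps_digits_unique:
  assumes Q: "discrete_place c Q" and V: "residue_reps Q V" and t: "t \<noteq> 0" "place_val Q t = 1"
    and "\<And>j. j < n \<Longrightarrow> a j \<in> V" "\<And>j. j < n \<Longrightarrow> a' j \<in> V"
    and "(\<Sum>j<n. t ^ j * a j) - (\<Sum>j<n. t ^ j * a' j) \<in> val_ideal Q (int n)"
  shows "\<forall>j<n. a j = a' j"
  using assms(5-)
proof (induction n arbitrary: a a')
  case (Suc n)
  note pl = discrete_place_place[OF Q]
  let ?r = "\<lambda>a. \<Sum>j<n. t ^ j * a (Suc j)"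
  have sh: "(\<Sum>j<Suc n. t ^ j * a j) = a 0 + t * ?r a" for a
    by (subst sum.lessThan_Suc_shift) (simp add: sum_distrib_left mult.assoc)
  have tQ: "t \<in> Q" using place_val_pos[OF Q t(1)] t(2) by simp
  have VR: "V \<subseteq> place_ring Q" using V unfolding residue_reps_def by blast
  have rR: "?r a \<in> place_ring Q" if "\<And>j. j < Suc n \<Longrightarrow> a j \<in> V" for a
    using that VR tQ place_subset[OF pl] by (intro place_ring_sum[OF pl] place_ring_mult[OF pl] place_ring_power[OF pl]) auto
  have d: "(a 0 - a' 0) + t * (?r a - ?r a') \<in> val_ideal Q (int (Suc n))"
    using Suc.prems(3) unfolding sh by (simp add: algebra_simps)
  then have "(a 0 - a' 0) + t * (?r a - ?r a') \<in> Q"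
    using val_ideal_mono[OF Q, of 1 "int (Suc n)"] in_place_val[OF Q] by auto
  moreover have "t * (?r a - ?r a') \<in> Q"
    by (rule place_mult[OF pl tQ place_ring_diff[OF pl rR rR]]) (use Suc.prems in auto)
  ultimately have "a 0 - a' 0 \<in> Q" using place_diff[OF pl] by fastforce
  moreover have "a 0 \<in> V" "a' 0 \<in> V" "a 0 \<in> place_ring Q" using Suc.prems VR by auto
  ultimately have a0: "a 0 = a' 0" using V place_0[OF pl] unfolding residue_reps_def by (metis diff_self)
  have "inverse t \<in> val_ideal Q (- 1)" using t by (simp add: val_ideal_def place_val_inverse[OF Q])
  from val_ideal_mult[OF Q this d] have "?r a - ?r a' \<in> val_ideal Q (int n)"
    using a0 t by (simp add: mult.assoc[symmetric])
  then have "\<forall>j<n. a (Suc j) = a' (Suc j)" using Suc.prems by (intro Suc.IH) auto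
  then show ?case using a0 by (auto simp: less_Suc_eq_0_disj)
qed simp

end


section \<open>Zeros of functions and Riemann--Roch spaces\<close>

context function_field
begin

lemma place_degree_pos: "place c Q \<Longrightarrow> place_degree c Q > 0"
  using residue_reps_exist[OF c_hom _ finite_residue] by blast

text \<open>One half of the degree formula. Weak approximation realizes every choice of
  \<open>t\<close>-adic digits up to the zero order of \<open>\<pi>\<close> at each place of
  \<open>S\<close>. The resulting functions are integral on \<open>S\<close> and pairwise
  incongruent modulo \<open>\<pi>\<close>, so their number is bounded by the height.\<close>

lemma degree_zeros_le:
  assumes pi: "\<pi> \<noteq> 0" "has_height \<pi> \<delta>" and S: "finite S"
    and Sp: "\<And>Q. Q \<in> S \<Longrightarrow> place c Q \<and> place_val Q \<pi> \<ge> 0"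
  shows "(\<Sum>Q\<in>S. place_val Q \<pi> * int (place_degree c Q)) \<le> int (m * \<delta>)"
proof -
  have d: "discrete_place c Q" if "Q \<in> S" for Q using discrete Sp that by blast
  have "\<exists>V. residue_reps Q V \<and> finite V \<and> card V = CARD('k) ^ place_degree c Q" if "Q \<in> S" for Q
    using residue_reps_exist[OF c_hom _ finite_residue, of Q] Sp[OF that] by blast
  then obtain V where V: "\<And>Q. Q \<in> S \<Longrightarrow> residue_reps Q (V Q) \<and> finite (V Q) \<and> card (V Q) = CARD('k) ^ place_degree c Q"
    by metis
  have "\<exists>t. t \<noteq> 0 \<and> place_val Q t = 1" if "Q \<in> S" for Q using exists_place_val[OF d[OF that], of 1] by blast
  then obtain t where t: "\<And>Q. Q \<in> S \<Longrightarrow> t Q \<noteq> 0 \<and> place_val Q (t Q) = 1" by metis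
  define n where "n Q = nat (place_val Q \<pi>)" for Q
  have n: "int (n Q) = place_val Q \<pi>" if "Q \<in> S" for Q using Sp[OF that] by (simp add: n_def)
  \<comment> \<open>One digit for each place and each exponent below the zero order there; a digit
    at \<open>Q\<close> has \<open>CARD('k) ^ place_degree c Q\<close> values, which makes the zero
    degree the exponent of the count.\<close>
  define J where "J = (SIGMA Q:S. {..<n Q})"
  define I where "I = Pi\<^sub>E J (\<lambda>(Q, j). V Q)"
  define r where "r e Q = (\<Sum>j<n Q. t Q ^ j * e (Q, j))" for e :: "'f set \<times> nat \<Rightarrow> 'f" and Q
  have finJ: "finite J" using S by (auto simp: J_def)
  have finI: "finite I" unfolding I_def by (rule finite_PiE) (use finJ V in \<open>auto simp: J_def\<close>)
  have "\<exists>x. \<forall>Q\<in>S. x - r e Q \<in> val_ideal Q (int (n Q))" for e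
    by (rule weak_approximation[OF S d])
  then obtain x where x: "\<And>e Q. Q \<in> S \<Longrightarrow> x e - r e Q \<in> val_ideal Q (int (n Q))" by metis
  define A where "A = (\<Inter>Q\<in>S. place_ring Q)"
  have eV: "e (Q, j) \<in> V Q" if "e \<in> I" "Q \<in> S" "j < n Q" for e Q j
    using that unfolding I_def J_def by auto
  have rR: "r e Q \<in> place_ring Q" if "e \<in> I" "Q \<in> S" for e Q
    unfolding r_def
  proof (rule place_ring_sum)
    show pl: "place c Q" using Sp that by blast
    fix j assume "j \<in> {..<n Q}"
    then have "e (Q, j) \<in> place_ring Q" using eV[OF that] V[OF that(2)] unfolding residue_reps_def by blast
    moreover have "t Q \<in> place_ring Q" using t[OF that(2)] place_val_nonneg[OF d[OF that(2)]] by simp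
    ultimately show "t Q ^ j * e (Q, j) \<in> place_ring Q"
      by (intro place_ring_mult[OF pl] place_ring_power[OF pl])
  qed
  have xA: "x e \<in> A" if "e \<in> I" for e
    unfolding A_def
  proof
    fix Q assume Q: "Q \<in> S"
    have "x e - r e Q \<in> place_ring Q"
      using val_ideal_mono[OF d[OF Q], of 0 "int (n Q)"] x[OF Q] place_ring_val[OF d[OF Q]] by auto
    from place_ring_add[OF conjunct1[OF Sp[OF Q]] this rR[OF that Q]] show "x e \<in> place_ring Q" by simp
  qed
  have "card I \<le> CARD('k) ^ (m * \<delta>)"
  proof (rule card_le_height[where A = A and \<pi> = \<pi>])
    show "u - v \<in> A" if "u \<in> A" "v \<in> A" for u v
      unfolding A_def
    proof
      fix Q assume "Q \<in> S" then show "u - v \<in> place_ring Q" using that Sp by (intro place_ring_diff) (auto simp: A_def)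
    qed
    show "u * v \<in> A" if "u \<in> A" "v \<in> A" for u v
      unfolding A_def
    proof
      fix Q assume "Q \<in> S" then show "u * v \<in> place_ring Q" using that Sp by (intro place_ring_mult) (auto simp: A_def)
    qed
    show "\<pi> \<in> A" unfolding A_def using place_val_nonneg[OF d pi(1)] Sp by auto
    show "\<And>e. e \<in> I \<Longrightarrow> x e \<in> A" by (rule xA)
    show "\<pi> \<noteq> 0" "has_height \<pi> \<delta>" "finite I" by (fact pi finI)+
    fix e e' assume e: "e \<in> I" "e' \<in> I" "e \<noteq> e'"
    show "(x e - x e') / \<pi> \<notin> A"
    proof
      assume inA: "(x e - x e') / \<pi> \<in> A"
      have "e (Q, j) = e' (Q, j)" if Q: "Q \<in> S" and j: "j < n Q" for Q j
      proof -
        note dQ = d[OF Q]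
        have "(x e - x e') / \<pi> \<in> place_ring Q" using inA Q unfolding A_def by blast
        then have "x e - x e' \<in> val_ideal Q (int (n Q))" using in_val_ideal_iff[OF dQ pi(1)] n[OF Q] by simp
        from val_ideal_add[OF dQ val_ideal_diff[OF dQ this x[OF Q, of e]] x[OF Q, of e']]
        have "r e Q - r e' Q \<in> val_ideal Q (int (n Q))" by simp
        then have "\<forall>j<n Q. e (Q, j) = e' (Q, j)" unfolding r_def
          by (intro reps_digits_unique[OF dQ, of "V Q" "t Q"]) (use V[OF Q] t[OF Q] eV e Q in auto)
        then show ?thesis using j by blast
      qed
      then have "e = e'" using e unfolding I_def J_def by (intro PiE_ext[of e _ "\<lambda>(Q, j). V Q"]) auto
      then show False using e by blast
    qed
  qed
  moreover have "card I = CARD('k) ^ (\<Sum>Q\<in>S. n Q * place_degree c Q)"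
  proof -
    have "card I = (\<Prod>(Q, j)\<in>J. card (V Q))" unfolding I_def using finJ by (simp add: card_PiE case_prod_unfold)
    also have "\<dots> = (\<Prod>Q\<in>S. \<Prod>j<n Q. card (V Q))" unfolding J_def using S by (subst prod.Sigma) auto
    also have "\<dots> = (\<Prod>Q\<in>S. CARD('k) ^ (n Q * place_degree c Q))"
      by (rule prod.cong) (use V in \<open>auto simp: power_mult[symmetric] mult.commute\<close>)
    finally show ?thesis by (simp add: power_sum)
  qed
  ultimately have "(\<Sum>Q\<in>S. n Q * place_degree c Q) \<le> m * \<delta>"
    using card_constants_gt_1[where 'k = 'k] by simp
  then have "int (\<Sum>Q\<in>S. n Q * place_degree c Q) \<le> int (m * \<delta>)" by (rule of_nat_mono)
  moreover have "int (\<Sum>Q\<in>S. n Q * place_degree c Q) = (\<Sum>Q\<in>S. place_val Q \<pi> * int (place_degree c Q))"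
    using n by simp
  ultimately show ?thesis by simp
qed

lemma finite_zeros:
  assumes pi: "\<pi> \<noteq> 0"
  shows "finite {Q. place c Q \<and> place_val Q \<pi> > 0}"
proof (rule ccontr)
  assume inf: "infinite {Q. place c Q \<and> place_val Q \<pi> > 0}"
  obtain \<delta> where h: "has_height \<pi> \<delta>" using exists_height by blast
  obtain S where S: "finite S" "card S = Suc (m * \<delta>)" "S \<subseteq> {Q. place c Q \<and> place_val Q \<pi> > 0}"
    using infinite_arbitrarily_large[OF inf] by blast
  have "(\<Sum>Q\<in>S. 1) \<le> (\<Sum>Q\<in>S. place_val Q \<pi> * int (place_degree c Q))"
  proof (rule sum_mono)
    fix Q assume "Q \<in> S"
    then have "place_val Q \<pi> \<ge> 1" "int (place_degree c Q) \<ge> 1" using S(3) place_degree_pos[of Q] by auto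
    then show "1 \<le> place_val Q \<pi> * int (place_degree c Q)"
      using mult_mono[of 1 "place_val Q \<pi>" 1 "int (place_degree c Q)"] by simp
  qed
  also have "\<dots> \<le> int (m * \<delta>)" by (rule degree_zeros_le[OF pi h S(1)]) (use S in force)
  finally show False using S(2) by simp
qed

section \<open>Cardinality and growth of Riemann-Roch spaces\<close>

lemma riemann_roch_space_iff:
  "z \<in> riemann_roch_space c G \<longleftrightarrow> (\<forall>Q. place c Q \<longrightarrow> z \<in> val_ideal Q (- Poly_Mapping.lookup G Q))"
  unfolding riemann_roch_space_def val_ideal_def by auto

lemma riemann_roch_space_0: "0 \<in> riemann_roch_space c G"
  by (simp add: riemann_roch_space_def)

lemma riemann_roch_space_add:
  "u \<in> riemann_roch_space c G \<Longrightarrow> v \<in> riemann_roch_space c G \<Longrightarrow> u + v \<in> riemann_roch_space c G"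
  unfolding riemann_roch_space_iff using val_ideal_add[OF discrete] by blast

lemma riemann_roch_space_scale:
  assumes "u \<in> riemann_roch_space c G" shows "c a * u \<in> riemann_roch_space c G"
  unfolding riemann_roch_space_iff
proof (intro allI impI)
  fix Q assume Q: "place c Q"
  have "u \<in> val_ideal Q (- Poly_Mapping.lookup G Q)" using assms Q unfolding riemann_roch_space_iff by blast
  from val_ideal_mult[OF discrete[OF Q] val_ideal_const[OF discrete[OF Q]] this]
  show "c a * u \<in> val_ideal Q (- Poly_Mapping.lookup G Q)" by simp
qed

lemma card_riemann_roch_space:
  "finite (riemann_roch_space c G) \<Longrightarrow> card (riemann_roch_space c G) = CARD('k) ^ ell c G"
  unfolding ell_def using c_hom
  by (rule card_subspace) (simp_all only: riemann_roch_space_0 riemann_roch_space_add riemann_roch_space_scale)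

text \<open>Each further pole allowed at \<open>Q\<close> multiplies the size by at most the number
  of residue classes: multiplication by a suitable \<open>t\<close> makes the new functions integral
  at \<open>Q\<close>, and two with the same residue differ by an element of the smaller
  space.\<close>

lemma riemann_roch_space_single:
  assumes fin: "finite (riemann_roch_space c G)" and Q: "place c Q"
  shows "finite (riemann_roch_space c (G + Poly_Mapping.single Q (int k)))
    \<and> card (riemann_roch_space c (G + Poly_Mapping.single Q (int k)))
      \<le> card (riemann_roch_space c G) * CARD('k) ^ (k * place_degree c Q)"
  using fin
proof (induction k)
  case (Suc k)
  define G0 where "G0 = G + Poly_Mapping.single Q (int k)"
  let ?L = "riemann_roch_space c G0"
  let ?L' = "riemann_roch_space c (G + Poly_Mapping.single Q (int (Suc k)))"
  note d = discrete[OF Q]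
  have lk: "Poly_Mapping.lookup (G + Poly_Mapping.single Q (int (Suc k))) R
      = Poly_Mapping.lookup G0 R + (if R = Q then 1 else 0)" for R
    unfolding G0_def by (simp add: lookup_add lookup_single when_def)
  define s where "s = Poly_Mapping.lookup G0 Q"
  obtain t where t: "t \<noteq> 0" "place_val Q t = s + 1" by (rule exists_place_val[OF d])
  obtain V where V: "residue_reps Q V" "finite V" "card V = CARD('k) ^ place_degree c Q"
    using residue_reps_exist[OF c_hom Q finite_residue[OF Q]] by blast
  have tz: "z * t \<in> place_ring Q" if "z \<in> ?L'" for z
  proof -
    have "z \<in> val_ideal Q (- (s + 1))" using that Q lk[of Q] unfolding riemann_roch_space_iff s_def by auto
    moreover have "t \<in> val_ideal Q (s + 1)" using t by (simp add: val_ideal_def)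
    ultimately show ?thesis using val_ideal_mult[OF d] place_ring_val[OF d] by fastforce
  qed
  \<comment> \<open>For every residue that occurs, \<open>z0\<close> picks one function having it;
    about a residue that does not occur nothing is claimed.\<close>
  have "\<forall>v. \<exists>z0. \<forall>z. z \<in> ?L' \<longrightarrow> z * t - v \<in> Q \<longrightarrow> z0 \<in> ?L' \<and> z0 * t - v \<in> Q" by blast
  then obtain z0 where z0: "\<And>v z. z \<in> ?L' \<Longrightarrow> z * t - v \<in> Q \<Longrightarrow> z0 v \<in> ?L' \<and> z0 v * t - v \<in> Q" by metis
  have sub: "?L' \<subseteq> (\<lambda>(v, w). z0 v + w) ` (V \<times> ?L)"
  proof
    fix z assume z: "z \<in> ?L'"
    obtain v where v: "v \<in> V" "z * t - v \<in> Q" using V(1) tz[OF z] unfolding residue_reps_def by blast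
    note zv = z0[OF z v(2)]
    have "(z * t - v) - (z0 v * t - v) \<in> Q" using place_diff[OF Q v(2)] zv by blast
    then have "(z - z0 v) * t \<in> val_ideal Q 1" using in_place_val[OF d] by (simp add: algebra_simps)
    moreover have "inverse t \<in> val_ideal Q (- (s + 1))" using t by (simp add: val_ideal_def place_val_inverse[OF d])
    ultimately have "(z - z0 v) * t * inverse t \<in> val_ideal Q (- s)" using val_ideal_mult[OF d] by fastforce
    then have zQ: "z - z0 v \<in> val_ideal Q (- s)" using t by (simp add: mult.assoc)
    have "z - z0 v \<in> ?L" unfolding riemann_roch_space_iff
    proof (intro allI impI)
      fix R assume R: "place c R"
      show "z - z0 v \<in> val_ideal R (- Poly_Mapping.lookup G0 R)"
      proof (cases "R = Q")
        case True then show ?thesis using zQ s_def by simp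
      next
        case False
        have "z \<in> val_ideal R (- Poly_Mapping.lookup G0 R)" "z0 v \<in> val_ideal R (- Poly_Mapping.lookup G0 R)"
          using z zv R lk[of R] False unfolding riemann_roch_space_iff by auto
        then show ?thesis by (rule val_ideal_diff[OF discrete[OF R]])
      qed
    qed
    then show "z \<in> (\<lambda>(v, w). z0 v + w) ` (V \<times> ?L)" using v(1)
      by (intro image_eqI[where x = "(v, z - z0 v)"]) auto
  qed
  have IH: "finite ?L" "card ?L \<le> card (riemann_roch_space c G) * CARD('k) ^ (k * place_degree c Q)"
    using Suc.IH[OF Suc.prems] unfolding G0_def by (simp_all add: o_def)
  have fin: "finite (V \<times> ?L)" using V(2) IH(1) by simp
  have "card ?L' \<le> card (V \<times> ?L)" by (rule surj_card_le[OF fin sub])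
  also have "\<dots> = CARD('k) ^ place_degree c Q * card ?L" using V(3) by (simp add: card_cartesian_product)
  also have "\<dots> \<le> CARD('k) ^ place_degree c Q * (card (riemann_roch_space c G) * CARD('k) ^ (k * place_degree c Q))"
    using IH(2) by (rule mult_le_mono2)
  also have "\<dots> = card (riemann_roch_space c G) * CARD('k) ^ (Suc k * place_degree c Q)"
    by (simp add: power_add)
  finally show ?case using finite_subset[OF sub finite_imageI[OF fin]] by blast
qed simp

lemma div_degree_superset:
  assumes "finite S" "Poly_Mapping.keys G \<subseteq> S"
  shows "div_degree c G = (\<Sum>P\<in>S. Poly_Mapping.lookup G P * int (place_degree c P))"
  unfolding div_degree_def using assms
  by (intro sum.mono_neutral_left) (auto simp: in_keys_iff)

lemma div_degree_add: "div_degree c (A + B) = div_degree c A + div_degree c B"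
proof -
  let ?S = "Poly_Mapping.keys A \<union> Poly_Mapping.keys B"
  have fin: "finite ?S" by simp
  have "Poly_Mapping.keys (A + B) \<subseteq> ?S" by (rule keys_add)
  then show ?thesis
    using div_degree_superset[OF fin, of "A + B"] div_degree_superset[OF fin, of A] div_degree_superset[OF fin, of B]
    by (simp add: lookup_add distrib_right sum.distrib)
qed

lemma div_degree_single: "div_degree c (Poly_Mapping.single Q k) = k * int (place_degree c Q)"
  using div_degree_superset[of "{Q}" "Poly_Mapping.single Q k"] by simp

text \<open>Makes \<open>div_degree - ell\<close> monotone in the divisor, so a bound for it at a
  large divisor holds at every smaller one.\<close>

lemma riemann_roch_space_sum:
  assumes fin: "finite (riemann_roch_space c A)" and S: "finite S" "\<And>Q. Q \<in> S \<Longrightarrow> place c Q"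
  shows "finite (riemann_roch_space c (A + (\<Sum>Q\<in>S. Poly_Mapping.single Q (int (n Q))))) \<and>
    int (ell c (A + (\<Sum>Q\<in>S. Poly_Mapping.single Q (int (n Q))))) - div_degree c (A + (\<Sum>Q\<in>S. Poly_Mapping.single Q (int (n Q))))
      \<le> int (ell c A) - div_degree c A"
  using S
proof (induction S)
  case empty then show ?case using fin by (simp only: sum.empty add_0_right order_refl simp_thms)
next
  case (insert Q S)
  define B where "B = A + (\<Sum>Q\<in>S. Poly_Mapping.single Q (int (n Q)))"
  have e: "A + (\<Sum>Q\<in>insert Q S. Poly_Mapping.single Q (int (n Q))) = B + Poly_Mapping.single Q (int (n Q))"
    unfolding B_def using insert.hyps by (simp add: algebra_simps)
  have IH: "finite (riemann_roch_space c B)" "int (ell c B) - div_degree c B \<le> int (ell c A) - div_degree c A"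
    using insert.IH insert.prems unfolding B_def by (simp_all add: o_def)
  have Q: "place c Q" using insert.prems by (simp add: o_def)
  note s = riemann_roch_space_single[OF IH(1) Q, of "n Q"]
  have "CARD('k) ^ ell c (B + Poly_Mapping.single Q (int (n Q))) \<le> CARD('k) ^ (ell c B + n Q * place_degree c Q)"
    using conjunct2[OF s] unfolding card_riemann_roch_space[OF conjunct1[OF s]] card_riemann_roch_space[OF IH(1)]
    by (simp add: power_add)
  then have "ell c (B + Poly_Mapping.single Q (int (n Q))) \<le> ell c B + n Q * place_degree c Q"
    using card_constants_gt_1[where 'k = 'k] by simp
  then have "int (ell c (B + Poly_Mapping.single Q (int (n Q)))) \<le> int (ell c B) + int (n Q) * int (place_degree c Q)"
    by (metis of_nat_add of_nat_le_iff of_nat_mult)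
  then have "int (ell c (B + Poly_Mapping.single Q (int (n Q)))) - div_degree c (B + Poly_Mapping.single Q (int (n Q)))
      \<le> int (ell c A) - div_degree c A"
    using IH(2) by (simp add: div_degree_add div_degree_single)
  then show ?case unfolding e using s by (simp add: o_def)
qed

lemma riemann_roch_space_mono:
  assumes le: "\<And>Q. Poly_Mapping.lookup A Q \<le> Poly_Mapping.lookup B Q"
    and B: "is_divisor c A" "is_divisor c B"
  shows "finite (riemann_roch_space c A) \<Longrightarrow> finite (riemann_roch_space c B)"
    and "finite (riemann_roch_space c A) \<Longrightarrow> int (ell c B) - div_degree c B \<le> int (ell c A) - div_degree c A"
    and "finite (riemann_roch_space c B) \<Longrightarrow> finite (riemann_roch_space c A)"
proof -
  let ?S = "Poly_Mapping.keys A \<union> Poly_Mapping.keys B"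
  have e: "B = A + (\<Sum>Q\<in>?S. Poly_Mapping.single Q (int (nat (Poly_Mapping.lookup B Q - Poly_Mapping.lookup A Q))))"
  proof (rule poly_mapping_eqI)
    fix Q
    have "(\<Sum>R\<in>?S. (int (nat (Poly_Mapping.lookup B R - Poly_Mapping.lookup A R)) when R = Q))
      = (\<Sum>R\<in>?S. if R = Q then Poly_Mapping.lookup B Q - Poly_Mapping.lookup A Q else 0)"
      using le by (intro sum.cong) (auto simp: when_def)
    also have "\<dots> = Poly_Mapping.lookup B Q - Poly_Mapping.lookup A Q"
      by (auto simp: in_keys_iff)
    finally show "Poly_Mapping.lookup B Q = Poly_Mapping.lookup (A + (\<Sum>Q\<in>?S. Poly_Mapping.single Q
        (int (nat (Poly_Mapping.lookup B Q - Poly_Mapping.lookup A Q))))) Q"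
      by (simp add: lookup_add lookup_sum lookup_single)
  qed
  have S: "finite ?S" "\<And>Q. Q \<in> ?S \<Longrightarrow> place c Q" using B unfolding is_divisor_def by auto
  show "finite (riemann_roch_space c B)" if "finite (riemann_roch_space c A)"
    using riemann_roch_space_sum[OF that S, of "\<lambda>Q. nat (Poly_Mapping.lookup B Q - Poly_Mapping.lookup A Q)"]
    unfolding e[symmetric] by blast
  show "int (ell c B) - div_degree c B \<le> int (ell c A) - div_degree c A" if "finite (riemann_roch_space c A)"
    using riemann_roch_space_sum[OF that S, of "\<lambda>Q. nat (Poly_Mapping.lookup B Q - Poly_Mapping.lookup A Q)"]
    unfolding e[symmetric] by blast
  have "riemann_roch_space c A \<subseteq> riemann_roch_space c B"
    unfolding riemann_roch_space_def using le by (auto intro: order_trans[OF le_imp_neg_le])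
  then show "finite (riemann_roch_space c A)" if "finite (riemann_roch_space c B)" using that finite_subset by blast
qed

end

section \<open>The rational function field\<close>

lemma function_field_id: "function_field (id :: 'k::{field,finite} poly fract \<Rightarrow> _) (\<lambda>_. 1) 1"
proof
  show "\<exists>a. z = (\<Sum>i<(1::nat). id (a i) * 1)" for z :: "'k poly fract" by (intro exI[of _ "\<lambda>_. z"]) simp
qed simp_all

lemma discrete_rational: "place const_fract p \<Longrightarrow> discrete_place (const_fract :: 'k::{field,finite} \<Rightarrow> _) p"
  using function_field.discrete[OF function_field_id, of p] by simp

section \<open>Valuations of polynomials at the places of \<open>K(x)\<close>\<close>

abbreviation lin :: "'k::field \<Rightarrow> 'k poly fract" where "lin a \<equiv> to_fract [:- a, 1:]"

abbreviation var :: "'k::field poly fract" where "var \<equiv> to_fract [:0, 1:]"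

lemma to_fract_power: "to_fract (g ^ n) = to_fract g ^ n"
  by (induction n) (simp_all add: to_fract_mult)

lemma to_fract_pCons: "to_fract (pCons a g) = const_fract a + var * to_fract g"
proof -
  have "pCons a g = [:a:] + [:0, 1:] * g" by simp
  then show ?thesis unfolding const_fract_def by (metis to_fract_add to_fract_mult)
qed

lemma lin_eq: "lin a = var - const_fract a"
proof -
  have "[:- a, 1:] = [:0, 1:] - [:a:]" by simp
  then show ?thesis unfolding const_fract_def by (metis to_fract_diff)
qed

lemma var_not_const: "var \<noteq> const_fract a"
  unfolding const_fract_def by simp

lemma fract_cases:
  obtains g d where "u = to_fract g / to_fract d" "d \<noteq> 0"
proof -
  obtain g d where "u = Fract g d" "d \<noteq> 0" by (cases u) auto
  then show ?thesis using that[of g d] by (simp add: to_fract_def)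
qed

lemma to_fract_in_place_ring:
  assumes p: "place const_fract p" and X: "var \<in> place_ring p"
  shows "to_fract g \<in> place_ring p"
proof (induction g)
  case 0 then show ?case using place_ring_0[OF p] by simp
next
  case (pCons a g) then show ?case unfolding to_fract_pCons[of a g]
    by (intro place_ring_add[OF p] place_ring_mult[OF p] place_ring_const[OF p] X)
qed

lemma var_in_place_ring_iff: "place const_fract p \<Longrightarrow> var \<in> place_ring p \<longleftrightarrow> lin a \<in> place_ring p"
  unfolding lin_eq using place_ring_diff[of const_fract p var "const_fract a"]
    place_ring_add[of const_fract p "var - const_fract a" "const_fract a"] place_ring_const[of const_fract p a] by auto

lemma place_val_at:
  fixes a :: "'k::{field,finite}"
  assumes p: "place const_fract p" and a: "lin a \<in> p"
  shows "place_val p (lin a) = 1" and "g \<noteq> 0 \<Longrightarrow> place_val p (to_fract g) = int (order a g)"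
proof -
  note d = discrete_rational[OF p]
  have l0: "lin a \<noteq> 0" by simp
  have X: "var \<in> place_ring p" using a place_subset[OF p] var_in_place_ring_iff[OF p] by blast
  have v: "place_val p (to_fract g) = int (order a g) * place_val p (lin a)" if g: "g \<noteq> 0" for g
  proof -
    obtain q where q: "g = [:- a, 1:] ^ order a g * q" "\<not> [:- a, 1:] dvd q" using order_decomp[OF g] by blast
    have q0: "q \<noteq> 0" using q(2) by auto
    \<comment> \<open>Modulo \<open>x - a\<close> the cofactor is the constant
      \<open>poly q a\<close>, which is not 0 and therefore a unit.\<close>
    have "to_fract q \<notin> p"
    proof
      assume qp: "to_fract q \<in> p"
      have "q = [:- a, 1:] * synthetic_div q a + [:poly q a:]" by (rule synthetic_div_correct'[symmetric])
      then have "to_fract q = lin a * to_fract (synthetic_div q a) + const_fract (poly q a)"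
        unfolding const_fract_def by (metis to_fract_add to_fract_mult)
      moreover have "lin a * to_fract (synthetic_div q a) \<in> p"
        by (rule place_mult[OF p a to_fract_in_place_ring[OF p X]])
      ultimately have "const_fract (poly q a) \<in> p" using place_diff[OF p qp] by fastforce
      moreover have "poly q a \<noteq> 0" using q(2) by (simp add: poly_eq_0_iff_dvd)
      ultimately show False using place_const[OF p field_hom_const_fract] by blast
    qed
    then have "place_val p (to_fract q) = 0"
      using place_val_pos[OF d, of "to_fract q"] place_val_nonneg[OF d, of "to_fract q"] to_fract_in_place_ring[OF p X, of q] q0
      by fastforce
    moreover have "to_fract g = lin a ^ order a g * to_fract q"
      by (metis q(1) to_fract_mult to_fract_power)
    ultimately show ?thesis using q0 by (simp add: place_val_mult[OF d] place_val_power[OF d])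
  qed
  \<comment> \<open>All valuations are multiples of \<open>place_val p (lin a)\<close>. As the value
    1 occurs, this positive integer is 1.\<close>
  obtain t where t: "t \<noteq> 0" "place_val p t = 1" by (rule exists_place_val[OF d])
  obtain u e where ge: "t = to_fract u / to_fract e" "e \<noteq> 0" by (rule fract_cases)
  then have "u \<noteq> 0" using t by auto
  then have "1 = (int (order a u) - int (order a e)) * place_val p (lin a)"
    using place_val_divide[OF d, of "to_fract u" "to_fract e"] ge
    unfolding t(2)[symmetric] left_diff_distrib v[OF \<open>u \<noteq> 0\<close>, symmetric] v[OF ge(2), symmetric] by simp
  moreover have "place_val p (lin a) > 0" using place_val_pos[OF d l0] a by simp
  ultimately show one: "place_val p (lin a) = 1" by (metis pos_zmult_eq_1_iff mult.commute)
  show "g \<noteq> 0 \<Longrightarrow> place_val p (to_fract g) = int (order a g)" using v one by simp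
qed

text \<open>\<open>var\<close> has a pole, so the leading monomial outweighs all others and the
  degree alone decides. That the pole is simple follows, as at a finite point, from a function of
  valuation 1.\<close>

lemma place_val_inf:
  fixes p :: "'k::{field,finite} poly fract set"
  assumes p: "place const_fract p" and a: "inverse var \<in> p"
  shows "g \<noteq> 0 \<Longrightarrow> place_val p (to_fract g) = - int (Polynomial.degree g)"
proof -
  note d = discrete_rational[OF p]
  have neg: "place_val p var < 0" using place_val_pos[OF d, of "inverse var"] a by (simp add: place_val_inverse[OF d])
  have v: "place_val p (to_fract g) = int (Polynomial.degree g) * place_val p var" if "g \<noteq> 0" for g
    using that
  proof (induction g)
    case (pCons a g)
    show ?case
    proof (cases "g = 0")
      case True
      then have "a \<noteq> 0" using pCons by auto
      then show ?thesis using True place_val_const[OF d field_hom_const_fract, of a] by (simp add: const_fract_def)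
    next
      case False
      then have IH: "place_val p (to_fract g) = int (Polynomial.degree g) * place_val p var" using pCons by simp
      have "var * to_fract g \<noteq> 0" using False by simp
      moreover have vv: "place_val p (var * to_fract g) = (1 + int (Polynomial.degree g)) * place_val p var"
        using False IH by (simp add: place_val_mult[OF d] algebra_simps)
      moreover have "const_fract a = 0 \<or> place_val p (var * to_fract g) < place_val p (const_fract a)"
      proof (cases "a = 0")
        case False
        have "(1 + int (Polynomial.degree g)) * place_val p var < 0" using neg by (intro mult_pos_neg) auto
        then show ?thesis using False place_val_const[OF d field_hom_const_fract, of a] vv by simp
      qed (simp add: const_fract_0)
      ultimately have "place_val p (var * to_fract g + const_fract a) = (1 + int (Polynomial.degree g)) * place_val p var"
        using place_val_add_eq(2)[OF d] by metis
      then show ?thesis using False to_fract_pCons[of a g] by (simp add: add.commute)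
    qed
  qed simp
  obtain t where t: "t \<noteq> 0" "place_val p t = 1" by (rule exists_place_val[OF d])
  obtain u e where ge: "t = to_fract u / to_fract e" "e \<noteq> 0" by (rule fract_cases)
  then have "u \<noteq> 0" using t by auto
  have "place_val p t = place_val p (to_fract u) - place_val p (to_fract e)"
    unfolding ge(1) by (rule place_val_divide[OF d]) (use \<open>u \<noteq> 0\<close> ge(2) in auto)
  then have eq: "1 = int (Polynomial.degree u) * place_val p var - int (Polynomial.degree e) * place_val p var"
    unfolding t(2) v[OF \<open>u \<noteq> 0\<close>] v[OF ge(2)] .
  have "1 = x * v - w * v \<Longrightarrow> (- v) * (w - x) = 1" for x w v :: int by (simp add: algebra_simps)
  from this[OF eq] have "(- place_val p var) * (int (Polynomial.degree e) - int (Polynomial.degree u)) = 1" .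
  moreover have "0 < - place_val p var" using neg by linarith
  ultimately have "- place_val p var = 1" using pos_zmult_eq_1_iff by blast
  then have "place_val p var = - 1" by linarith
  then show "g \<noteq> 0 \<Longrightarrow> place_val p (to_fract g) = - int (Polynomial.degree g)"
    using v[of g] by simp
qed

lemma place_eqI_val:
  assumes p: "place const_fract p" "place const_fract (p' :: 'k::{field,finite} poly fract set)"
    and "\<And>g. g \<noteq> 0 \<Longrightarrow> place_val p (to_fract g) = place_val p' (to_fract g)"
  shows "p = p'"
proof -
  note d = discrete_rational[OF p(1)] discrete_rational[OF p(2)]
  have "z \<in> p \<longleftrightarrow> z \<in> p'" for z
  proof (cases "z = 0")
    case True then show ?thesis using place_0[OF p(1)] place_0[OF p(2)] by simp
  next
    case False
    obtain g e where ge: "z = to_fract g / to_fract e" "e \<noteq> 0" by (rule fract_cases)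
    have "g \<noteq> 0" using ge False by auto
    then have "place_val p z = place_val p' z"
      using ge assms(3) by (simp add: place_val_divide[OF d(1)] place_val_divide[OF d(2)])
    then show ?thesis using False place_val_pos[OF d(1)] place_val_pos[OF d(2)] by simp
  qed
  then show ?thesis by blast
qed

section \<open>Existence and uniqueness of the rational places\<close>

lemma exists_place_over_poly:
  fixes g :: "'k::{field,finite} poly"
  assumes "Polynomial.degree g > 0"
  obtains p where "place const_fract p" "var \<in> place_ring p" "to_fract g \<in> p"
proof -
  let ?B = "range (to_fract :: 'k poly \<Rightarrow> _)"
  have ni: "inverse (to_fract g) \<notin> ?B"
  proof
    assume "inverse (to_fract g) \<in> ?B"
    then obtain e where "inverse (to_fract g) = to_fract e" by blast
    moreover have g0: "g \<noteq> 0" using assms by auto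
    ultimately have "to_fract (e * g) = to_fract 1" by (simp flip: \<open>inverse (to_fract g) = to_fract e\<close>)
    then have "e * g = 1" by (simp only: to_fract_eq_iff)
    then have "e \<noteq> 0" "Polynomial.degree (e * g) = 0" by auto
    then show False using assms g0 by (simp add: degree_mult_eq)
  qed
  have Bd: "u - v \<in> ?B" and Bm: "u * v \<in> ?B" if "u \<in> ?B" "v \<in> ?B" for u v
    using that by (metis (no_types, lifting) imageE rangeI to_fract_diff to_fract_mult)+
  have B1: "(1 :: 'k poly fract) \<in> ?B" by (metis rangeI to_fract_1)
  have cB: "range const_fract \<subseteq> ?B" unfolding const_fract_def by blast
  obtain p where "place const_fract p" "?B \<subseteq> place_ring p" "to_fract g \<in> p"
    by (rule place_exists[OF field_hom_const_fract B1 Bd Bm cB rangeI ni])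
  then show ?thesis using that by blast
qed

lemma exists_place_inf:
  obtains p :: "'k::{field,finite} poly fract set" where "place const_fract p" "inverse var \<in> p"
proof -
  \<comment> \<open>The ring \<open>K[1/x]\<close>, its elements written as \<open>g / x ^ n\<close>
    with the degree of \<open>g\<close> at most \<open>n\<close>.\<close>
  let ?B = "{z :: 'k poly fract. \<exists>g n. Polynomial.degree g \<le> n \<and> z * var ^ n = to_fract g}"
  have deg: "Polynomial.degree ([:0, 1:] ^ n :: 'k poly) = n" for n by (simp add: degree_power_eq)
  have ni: "inverse (inverse var) \<notin> ?B"
  proof
    assume "inverse (inverse var) \<in> ?B"
    then obtain g :: "'k poly" and n where g: "Polynomial.degree g \<le> n" "var * var ^ n = to_fract g" by auto
    then have "to_fract ([:0, 1:] ^ Suc n) = to_fract g" by (metis power_Suc to_fract_mult to_fract_power)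
    then have "[:0, 1:] ^ Suc n = g" by (simp only: to_fract_eq_iff)
    then show False using g(1) deg[of "Suc n"] by simp
  qed
  have Bdm: "u - v \<in> ?B \<and> u * v \<in> ?B" if uv: "u \<in> ?B" "v \<in> ?B" for u v
  proof -
    obtain g n g' n' where g: "Polynomial.degree g \<le> n" "u * var ^ n = to_fract g"
      "Polynomial.degree g' \<le> n'" "v * var ^ n' = to_fract g'" using uv by blast
    have "(u - v) * var ^ (n + n') = (u * var ^ n) * var ^ n' - (v * var ^ n') * var ^ n"
      by (simp add: algebra_simps power_add)
    then have "(u - v) * var ^ (n + n') = to_fract (g * [:0, 1:] ^ n' - g' * [:0, 1:] ^ n)"
      by (simp add: g to_fract_power)
    moreover have "Polynomial.degree (g * [:0, 1:] ^ n' - g' * [:0, 1:] ^ n) \<le> n + n'"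
      using g(1,3) degree_mult_le[of g "[:0, 1:] ^ n'"] degree_mult_le[of g' "[:0, 1:] ^ n"] unfolding deg
      by (intro degree_diff_le) auto
    moreover have "(u * v) * var ^ (n + n') = to_fract (g * g')"
      using arg_cong2[OF g(2) g(4), of "(*)"] by (simp add: algebra_simps power_add)
    moreover have "Polynomial.degree (g * g') \<le> n + n'"
      using g(1,3) degree_mult_le[of g g'] by linarith
    ultimately show ?thesis by blast
  qed
  have B1: "(1 :: 'k poly fract) \<in> ?B"
    by (intro CollectI exI[of _ 1] exI[of _ 0]) simp
  have cB: "range const_fract \<subseteq> ?B"
  proof
    fix z :: "'k poly fract" assume "z \<in> range const_fract"
    then obtain a where "z = to_fract [:a:]" unfolding const_fract_def by blast
    then show "z \<in> ?B" by (intro CollectI exI[of _ "[:a:]"] exI[of _ 0]) simp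
  qed
  have iB: "(inverse var :: 'k poly fract) \<in> ?B"
    by (intro CollectI exI[of _ 1] exI[of _ 1]) simp
  obtain p :: "'k poly fract set" where "place const_fract p" "?B \<subseteq> place_ring p" "inverse var \<in> p"
    by (rule place_exists[OF field_hom_const_fract B1 conjunct1[OF Bdm] conjunct2[OF Bdm] cB iB ni])
  then show ?thesis using that by blast
qed

text \<open>The choice is harmless: membership of \<open>x - a\<close> fixes the valuation of every
  polynomial and thereby the place, see \<open>place_at_eq\<close>.\<close>

definition place_at :: "'k::{field,finite} \<Rightarrow> 'k poly fract set" where
  "place_at a = (SOME p. place const_fract p \<and> lin a \<in> p)"

definition place_inf :: "'k::{field,finite} poly fract set" where
  "place_inf = (SOME p. place const_fract p \<and> inverse var \<in> p)"

lemma place_at: "place const_fract (place_at a)" "lin a \<in> place_at a"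
proof -
  obtain p where "place const_fract p" "lin a \<in> p" using exists_place_over_poly[of "[:- a, 1:]"] by auto
  then show "place const_fract (place_at a)" "lin a \<in> place_at a"
    unfolding place_at_def by (metis (mono_tags, lifting) someI_ex)+
qed

lemma place_inf:
  "place const_fract (place_inf :: 'k::{field,finite} poly fract set)"
  "inverse var \<in> (place_inf :: 'k poly fract set)"
proof -
  obtain p :: "'k poly fract set" where "place const_fract p" "inverse var \<in> p" by (rule exists_place_inf)
  then show "place const_fract (place_inf :: 'k poly fract set)" "inverse var \<in> (place_inf :: 'k poly fract set)"
    unfolding place_inf_def by (metis (mono_tags, lifting) someI_ex)+
qed

lemma place_at_eq: "place const_fract p \<Longrightarrow> lin a \<in> p \<Longrightarrow> p = place_at a"
  by (rule place_eqI_val[OF _ place_at(1)]) (simp_all add: place_val_at(2)[of p a] place_val_at(2)[OF place_at])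

lemma place_inf_eq: "place const_fract p \<Longrightarrow> inverse var \<in> p \<Longrightarrow> p = place_inf"
  by (rule place_eqI_val[OF _ place_inf(1)]) (simp_all add: place_val_inf[of p] place_val_inf[OF place_inf])

lemma place_not_inf: "place const_fract p \<Longrightarrow> p \<noteq> place_inf \<Longrightarrow> var \<in> place_ring p"
  using place_inf_eq[of p] in_place_iff[of const_fract p "inverse var"] by auto

lemma var_in_place_at: "var \<in> place_ring (place_at a)"
  using place_at[of a] place_subset[OF place_at(1)] var_in_place_ring_iff[OF place_at(1)] by blast

lemma place_at_neq_inf: "place_at a \<noteq> place_inf"
proof
  assume "place_at a = place_inf"
  then have "inverse var \<in> place_at a" using place_inf(2) by metis
  then show False using var_in_place_at[of a] in_place_iff[OF place_at(1)[of a], of "inverse var"] by simp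
qed

lemma place_val_lin:
  fixes a :: "'k::{field,finite}"
  assumes p: "place const_fract p"
  shows "place_val p (lin a) = (if p = place_inf then - 1 else if p = place_at a then 1 else 0)"
proof -
  note d = discrete_rational[OF p]
  consider "p = place_inf" | "p = place_at a" | "p \<noteq> place_inf" "p \<noteq> place_at a" by blast
  then show ?thesis
  proof cases
    case 1 then show ?thesis using place_val_inf[OF place_inf, of "[:- a, 1:]"] by simp
  next
    case 2 then show ?thesis using place_val_at(1)[OF place_at] place_at_neq_inf[of a] by simp
  next
    case 3
    have "lin a \<in> place_ring p" using place_not_inf[OF p 3(1)] var_in_place_ring_iff[OF p] by blast
    moreover have "lin a \<notin> p" using place_at_eq[OF p] 3(2) by blast
    ultimately have "place_val p (lin a) = 0"
      using place_val_nonneg[OF d, of "lin a"] place_val_pos[OF d, of "lin a"] by simp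
    then show ?thesis using 3 by simp
  qed
qed

lemma inj_place_at: "inj (place_at :: 'k::{field,finite} \<Rightarrow> _)"
proof
  fix a b :: 'k assume "place_at a = place_at b"
  then have "place_val (place_at a) (lin b) = 1"
    using place_val_lin[OF place_at(1), of b b] place_at_neq_inf[of b] by simp
  moreover have "place_val (place_at a) (lin b) = int (order a [:- b, 1:])"
    by (rule place_val_at(2)[OF place_at]) simp
  ultimately have "order a [:- b, 1:] \<noteq> 0" by simp
  then have "poly [:- b, 1:] a = 0" using order_root[of "[:- b, 1:]" a] by simp
  then show "a = b" by simp
qed

text \<open>With a denominator \<open>e\<close> of least degree, numerator and denominator are
  coprime. If \<open>e\<close> were not constant, some finite place would contain \<open>e\<close>,
  hence \<open>g = e * u\<close>, hence the nonzero constant \<open>w\<close> obtained from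
  both.\<close>

lemma poly_of_integral:
  fixes u :: "'k::{field,finite} poly fract"
  assumes "\<And>p. place const_fract p \<Longrightarrow> p \<noteq> place_inf \<Longrightarrow> u \<in> place_ring p"
  shows "u \<in> range to_fract"
proof -
  define R where "R e \<longleftrightarrow> e \<noteq> 0 \<and> (\<exists>g. u = to_fract g / to_fract e)" for e
  obtain e0 where "R e0" using fract_cases[of u] unfolding R_def by metis
  then obtain e where e: "R e" and min: "\<And>e'. R e' \<Longrightarrow> Polynomial.degree e \<le> Polynomial.degree e'"
    using ex_has_least_nat[of R e0 Polynomial.degree] by blast
  obtain g where g: "e \<noteq> 0" "u = to_fract g / to_fract e" using e unfolding R_def by blast
  \<comment> \<open>The ideal generated by \<open>g\<close> and \<open>e\<close>; a nonzero element
    of least degree is a greatest common divisor and comes with its Bezout coefficients.\<close>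
  define I where "I = {s * g + t * e | s t. True}"
  have eI: "e \<in> I" unfolding I_def by (intro CollectI exI[of _ 0] exI[of _ 1]) simp
  have gI: "g \<in> I" unfolding I_def by (intro CollectI exI[of _ 1] exI[of _ 0]) simp
  obtain w where w: "w \<in> I" "w \<noteq> 0" and wmin: "\<And>w'. w' \<in> I \<Longrightarrow> w' \<noteq> 0 \<Longrightarrow> Polynomial.degree w \<le> Polynomial.degree w'"
    using ex_has_least_nat[of "\<lambda>w. w \<in> I \<and> w \<noteq> 0" e Polynomial.degree] eI g(1) by blast
  have dvd: "w dvd v" if v: "v \<in> I" for v
  proof -
    obtain s t where st: "w = s * g + t * e" using w(1) unfolding I_def by blast
    obtain s' t' where st': "v = s' * g + t' * e" using v unfolding I_def by blast
    have "v mod w = v - v div w * w" by (simp add: minus_div_mult_eq_mod)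
    also have "\<dots> = (s' - v div w * s) * g + (t' - v div w * t) * e"
      unfolding st st' by (simp add: algebra_simps)
    finally have "v mod w \<in> I" unfolding I_def by blast
    then have "v mod w = 0" using wmin[of "v mod w"] degree_mod_less[OF w(2), of v] by (meson leD)
    then show ?thesis by (simp add: mod_eq_0_iff_dvd)
  qed
  obtain e' g' where e': "e = w * e'" "g = w * g'" using dvd[OF eI] dvd[OF gI] by (meson dvdE)
  have "e' \<noteq> 0" using g(1) e' by auto
  then have "R e'" unfolding R_def using g(2) e' w(2) by auto
  then have "Polynomial.degree w = 0" using min[of e'] e' w(2) \<open>e' \<noteq> 0\<close> by (simp add: degree_mult_eq)
  obtain s t where st: "w = s * g + t * e" using w(1) unfolding I_def by blast
  have "Polynomial.degree e = 0"
  proof (rule ccontr)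
    assume "Polynomial.degree e \<noteq> 0"
    then obtain p where p: "place const_fract p" "var \<in> place_ring p" "to_fract e \<in> p"
      using exists_place_over_poly[of e] by auto
    have "p \<noteq> place_inf" using p(2) in_place_iff[OF p(1), of "inverse var"] place_inf(2) by auto
    then have "u \<in> place_ring p" using assms p(1) by blast
    then have "to_fract e * u \<in> p" by (rule place_mult[OF p(1,3)])
    then have "to_fract g \<in> p" using g by simp
    then have "to_fract g * to_fract s + to_fract e * to_fract t \<in> p"
      using p by (intro place_add[OF p(1)] place_mult[OF p(1)] to_fract_in_place_ring[OF p(1,2)]) auto
    then have wp: "to_fract w \<in> p" unfolding st by (simp add: mult.commute)
    obtain c0 where "w = [:c0:]" using \<open>Polynomial.degree w = 0\<close> by (meson degree_eq_zeroE)
    then have "const_fract c0 \<in> p" "c0 \<noteq> 0" using wp w(2) by (auto simp: const_fract_def)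
    then show False using place_const[OF p(1) field_hom_const_fract] by blast
  qed
  then obtain c0 where c0: "e = [:c0:]" by (meson degree_eq_zeroE)
  then have "c0 \<noteq> 0" using g(1) by simp
  then have "u = to_fract (Polynomial.smult (inverse c0) g)"
  proof -
    have "to_fract e * to_fract (Polynomial.smult (inverse c0) g) = to_fract (e * Polynomial.smult (inverse c0) g)"
      by (simp only: to_fract_mult)
    also have "e * Polynomial.smult (inverse c0) g = g" using c0 \<open>c0 \<noteq> 0\<close> by simp
    finally have E: "to_fract e * to_fract (Polynomial.smult (inverse c0) g) = to_fract g" .
    have "to_fract e \<noteq> 0" using g(1) by simp
    then show ?thesis unfolding g(2) E[symmetric] by (rule nonzero_mult_div_cancel_left)
  qed
  then show ?thesis by blast
qed

text \<open>On the projective line a divisor at rational points becomes a multiple of infinity: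
  multiplication by \<open>s\<close>, whose finite zeros and poles are given by
  \<open>\<epsilon>\<close>, turns \<open>L\<close> into the polynomials of degree at most
  \<open>\<Delta>\<close>.\<close>

lemma card_rational_riemann_roch:
  fixes \<epsilon> :: "'k::{field,finite} poly fract set \<Rightarrow> int"
  defines "L \<equiv> {u. \<forall>p. place const_fract p \<longrightarrow> u \<in> val_ideal p (- \<epsilon> p)}"
  assumes Z: "\<And>p. place const_fract p \<Longrightarrow> p \<noteq> place_inf \<Longrightarrow> p \<notin> place_at ` Z \<Longrightarrow> \<epsilon> p = 0"
  shows "finite L" "card L = CARD('k) ^ nat (\<epsilon> place_inf + (\<Sum>a\<in>Z. \<epsilon> (place_at a)) + 1)"
proof -
  define \<Delta> where "\<Delta> = \<epsilon> place_inf + (\<Sum>a\<in>Z. \<epsilon> (place_at a))"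
  define s where "s = (\<Prod>a\<in>Z. lin a powi \<epsilon> (place_at a))"
  have finZ: "finite Z" by simp
  have s0: "s \<noteq> 0" unfolding s_def by simp
  have vs: "place_val p s = (\<Sum>a\<in>Z. \<epsilon> (place_at a) * place_val p (lin a))" if p: "place const_fract p" for p
    unfolding s_def by (subst place_val_prod[OF discrete_rational[OF p]])
      (simp_all add: place_val_power_int[OF discrete_rational[OF p]])
  have vinf: "place_val place_inf s = - (\<Sum>a\<in>Z. \<epsilon> (place_at a))"
    unfolding vs[OF place_inf(1)] by (simp add: place_val_lin[OF place_inf(1)] sum_negf)
  have vfin: "place_val p s = \<epsilon> p" if p: "place const_fract p" "p \<noteq> place_inf" for p
  proof (cases "p \<in> place_at ` Z")
    case True
    then obtain b where b: "b \<in> Z" "p = place_at b" by blast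
    have "place_val p (lin a) = (if a = b then 1 else 0)" for a
      using place_val_lin[OF p(1), of a] p(2) b(2) inj_eq[OF inj_place_at, of b a] by auto
    then have "place_val p s = (\<Sum>a\<in>Z. if a = b then \<epsilon> (place_at b) else 0)"
      unfolding vs[OF p(1)] by (intro sum.cong) auto
    then show ?thesis using b finZ by simp
  next
    case False
    have "place_val p s = 0" unfolding vs[OF p(1)]
      by (rule sum.neutral) (use False p in \<open>auto simp: place_val_lin[OF p(1)]\<close>)
    then show ?thesis using Z[OF p False] by simp
  qed
  \<comment> \<open>A condition on coefficients instead of the degree: for negative
    \<open>\<Delta>\<close> it leaves only 0, in agreement with the truncation by
    \<open>nat\<close>.\<close>
  define G where "G = {g :: 'k poly. \<forall>i\<ge>nat (\<Delta> + 1). poly.coeff g i = 0}"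
  have G_iff: "g \<in> G \<longleftrightarrow> int (Polynomial.degree g) \<le> \<Delta>" if "g \<noteq> 0" for g
  proof
    assume "g \<in> G"
    moreover have "poly.coeff g (Polynomial.degree g) \<noteq> 0" using that by simp
    ultimately have "\<not> nat (\<Delta> + 1) \<le> Polynomial.degree g" unfolding G_def by blast
    then show "int (Polynomial.degree g) \<le> \<Delta>" by linarith
  next
    assume "int (Polynomial.degree g) \<le> \<Delta>"
    then show "g \<in> G" unfolding G_def by (auto intro!: coeff_eq_0)
  qed
  have "L = (\<lambda>g. to_fract g / s) ` G"
  proof
    show "L \<subseteq> (\<lambda>g. to_fract g / s) ` G"
    proof
      fix u assume u: "u \<in> L"
      show "u \<in> (\<lambda>g. to_fract g / s) ` G"
      proof (cases "u = 0")
        case True then show ?thesis by (intro image_eqI[where x = 0]) (auto simp: G_def)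
      next
        case u0: False
        have "u * s \<in> place_ring p" if p: "place const_fract p" "p \<noteq> place_inf" for p
        proof -
          note d = discrete_rational[OF p(1)]
          have "place_val p u \<ge> - \<epsilon> p" using u p(1) u0 unfolding L_def val_ideal_def by auto
          then have "place_val p (u * s) \<ge> 0" using u0 s0 by (simp add: place_val_mult[OF d] vfin[OF p])
          then show ?thesis using place_val_nonneg[OF d, of "u * s"] u0 s0 by simp
        qed
        then obtain g where g: "u * s = to_fract g" using poly_of_integral[of "u * s"] by blast
        have "g \<noteq> 0" using g u0 s0 by auto
        note d = discrete_rational[OF place_inf(1)]
        have "place_val place_inf u \<ge> - \<epsilon> place_inf" using u u0 place_inf(1) unfolding L_def val_ideal_def by auto
        moreover have "place_val place_inf (u * s) = - int (Polynomial.degree g)"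
          unfolding g by (rule place_val_inf[OF place_inf \<open>g \<noteq> 0\<close>])
        ultimately have "g \<in> G" unfolding G_iff[OF \<open>g \<noteq> 0\<close>] \<Delta>_def
          using u0 s0 by (simp add: place_val_mult[OF d] vinf)
        then show ?thesis using g s0 by (intro image_eqI[where x = g]) (simp_all add: field_simps)
      qed
    qed
    show "(\<lambda>g. to_fract g / s) ` G \<subseteq> L"
    proof
      fix u assume "u \<in> (\<lambda>g. to_fract g / s) ` G"
      then obtain g where g: "g \<in> G" "u = to_fract g / s" by blast
      show "u \<in> L" unfolding L_def
      proof (intro CollectI allI impI)
        fix p :: "'k poly fract set" assume p: "place const_fract p"
        note d = discrete_rational[OF p]
        show "u \<in> val_ideal p (- \<epsilon> p)"
        proof (cases "g = 0")
          case True then show ?thesis using g(2) by (simp add: val_ideal_def)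
        next
          case False
          have vu: "place_val p u = place_val p (to_fract g) - place_val p s"
            unfolding g(2) by (rule place_val_divide[OF d]) (use False s0 in auto)
          show ?thesis
          proof (cases "p = place_inf")
            case True
            have "place_val p (to_fract g) = - int (Polynomial.degree g)"
              unfolding True by (rule place_val_inf[OF place_inf False])
            then show ?thesis using vu G_iff[OF False] g(1) vinf True
              unfolding val_ideal_def \<Delta>_def by simp
          next
            case nf: False
            have "place_val p (to_fract g) \<ge> 0"
              using place_val_nonneg[OF d, of "to_fract g"] False
                to_fract_in_place_ring[OF p place_not_inf[OF p nf]] by simp
            then show ?thesis using vu vfin[OF p nf] unfolding val_ideal_def by simp
          qed
        qed
      qed
    qed
  qed
  moreover have "inj_on (\<lambda>g. to_fract g / s) G" using s0 by (auto simp: inj_on_def)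
  moreover have "finite G" "card G = CARD('k) ^ nat (\<Delta> + 1)" unfolding G_def by (rule card_poly_degree_less)+
  ultimately show "finite L" "card L = CARD('k) ^ nat (\<epsilon> place_inf + (\<Sum>a\<in>Z. \<epsilon> (place_at a)) + 1)"
    unfolding \<Delta>_def by (auto simp: card_image)
qed

section \<open>Splitting of \<open>f\<close> over the base field\<close>

lemma poly_to_ac_factorization:
  fixes f :: "'k::field poly"
  assumes "f \<noteq> 0" and "\<forall>z :: 'k alg_closure. poly (map_poly to_ac f) z = 0 \<longrightarrow> z \<in> range to_ac"
  shows "\<exists>A. f = Polynomial.smult (lead_coeff f) (\<Prod>a\<in>#A. [:- a, 1:])"
  using assms
proof (induction "Polynomial.degree f" arbitrary: f)
  case 0
  then obtain b where "f = [:b:]" by (metis degree_eq_zeroE)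
  then show ?case by (intro exI[of _ "{#}"]) auto
next
  case (Suc n)
  have mult: "map_poly to_ac (p * q) = map_poly to_ac p * map_poly to_ac q" for p q :: "'k poly"
    by (rule poly_eqI) (simp add: coeff_map_poly coeff_mult to_ac_sum)
  have ev: "poly (map_poly to_ac p) (to_ac a) = to_ac (poly p a)" for p :: "'k poly" and a
    by (induction p) (simp_all add: map_poly_pCons)
  have "Polynomial.degree (map_poly to_ac f) = Suc n" using Suc.hyps(2) by (subst degree_map_poly) auto
  then obtain z where "poly (map_poly to_ac f) z = 0" using alg_closed_imp_poly_has_root[of "map_poly to_ac f"] by auto
  then obtain a where "poly (map_poly to_ac f) (to_ac a) = 0" using Suc.prems(2) by blast
  then have "poly f a = 0" by (simp add: ev)
  then obtain g where g: "f = [:- a, 1:] * g" by (auto simp: poly_eq_0_iff_dvd dvd_def)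
  have g0: "g \<noteq> 0" using g Suc.prems(1) by auto
  have "Polynomial.degree g = n" using Suc.hyps(2) g0 unfolding g by (simp add: degree_mult_eq del: mult_pCons_left)
  moreover have "\<forall>z :: 'k alg_closure. poly (map_poly to_ac g) z = 0 \<longrightarrow> z \<in> range to_ac"
    using Suc.prems(2) unfolding g mult by simp
  ultimately obtain A where A: "g = Polynomial.smult (lead_coeff g) (\<Prod>a\<in>#A. [:- a, 1:])"
    using Suc.hyps(1)[of g] g0 by blast
  have "lead_coeff f = lead_coeff g" unfolding g by (simp add: lead_coeff_mult del: mult_pCons_left)
  moreover have "f = [:- a, 1:] * Polynomial.smult (lead_coeff g) (\<Prod>a\<in>#A. [:- a, 1:])"
    using g arg_cong[OF A, of "(*) [:- a, 1:]"] by (rule trans)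
  ultimately have "f = Polynomial.smult (lead_coeff f) (\<Prod>a\<in>#add_mset a A. [:- a, 1:])"
    by (simp only: image_mset_add_mset mult_smult_right prod_mset.add_mset)
  then show ?case by blast
qed

section \<open>Kummer extensions\<close>

locale kummer_extension =
  fixes h :: "'k::{field,finite} poly fract \<Rightarrow> 'f::field" and f :: "'k poly" and y :: 'f and m :: nat
  assumes h_hom: "field_hom h" and m_pos: "m > 0" and f_nz: "f \<noteq> 0"
    and curve: "y ^ m = h (to_fract f)"
    and generated: "is_subfield hull (range h \<union> {y}) = UNIV"
begin

text \<open>The span \<open>T\<close> of the powers of \<open>y\<close> is a ring by the equation of
  the curve, and it contains the generators of the field. It is closed under inverses because each
  of its elements is algebraic over \<open>K(x)\<close>.\<close>

lemma kummer_span: "\<exists>a. z = (\<Sum>i<m. h (a i) * y ^ i)"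
proof -
  interpret h: field_hom h by (rule h_hom)
  define T where "T = {z. \<exists>a. z = (\<Sum>i<m. h (a i) * y ^ i)}"
  have T0: "0 \<in> T" unfolding T_def by (intro CollectI exI[of _ "\<lambda>_. 0"]) simp
  have Ta: "u + v \<in> T" if uv: "u \<in> T" "v \<in> T" for u v
  proof -
    obtain a a' where "u = (\<Sum>i<m. h (a i) * y ^ i)" "v = (\<Sum>i<m. h (a' i) * y ^ i)" using uv unfolding T_def by blast
    then have "u + v = (\<Sum>i<m. h (a i + a' i) * y ^ i)" by (simp add: h.hom_add distrib_right sum.distrib)
    then show ?thesis unfolding T_def by (intro CollectI exI[of _ "\<lambda>i. a i + a' i"])
  qed
  have Th: "h b * u \<in> T" if uT: "u \<in> T" for b u
  proof -
    obtain a where "u = (\<Sum>i<m. h (a i) * y ^ i)" using uT unfolding T_def by blast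
    then have "h b * u = (\<Sum>i<m. h (b * a i) * y ^ i)" by (simp add: h.hom_mult sum_distrib_left mult.assoc)
    then show ?thesis unfolding T_def by (intro CollectI exI[of _ "\<lambda>i. b * a i"])
  qed
  have Ts: "sum g I \<in> T" if "\<And>i. i \<in> I \<Longrightarrow> g i \<in> T" for g :: "nat \<Rightarrow> 'f" and I
    using that by (induction I rule: infinite_finite_induct) (auto intro: T0 Ta)
  have Typ: "y ^ i \<in> T" if "i < m" for i
  proof -
    have "y ^ i = (\<Sum>j<m. h (if j = i then 1 else 0) * y ^ j)"
      using that by (simp add: if_distrib if_distribR cong: if_cong)
    then show ?thesis unfolding T_def by (intro CollectI exI[of _ "\<lambda>j. if j = i then 1 else 0"])
  qed
  have Typow: "y ^ i \<in> T" for i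
  proof -
    have "y ^ i = y ^ (m * (i div m) + i mod m)" by simp
    also have "\<dots> = h (to_fract f ^ (i div m)) * y ^ (i mod m)"
      by (simp only: power_add power_mult curve h.hom_power)
    finally show ?thesis using Th[OF Typ[of "i mod m"]] m_pos by simp
  qed
  have Ty: "u * y ^ j \<in> T" if u: "u \<in> T" for u j
  proof -
    obtain a where a: "u = (\<Sum>i<m. h (a i) * y ^ i)" using u unfolding T_def by blast
    have "u * y ^ j = (\<Sum>i<m. h (a i) * y ^ (i + j))"
      unfolding a by (simp add: sum_distrib_right mult.assoc power_add)
    then show ?thesis using Ts[of "{..<m}" "\<lambda>i. h (a i) * y ^ (i + j)"] Th Typow by simp
  qed
  have Tm: "u * v \<in> T" if u: "u \<in> T" and v: "v \<in> T" for u v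
  proof -
    obtain a where a: "v = (\<Sum>i<m. h (a i) * y ^ i)" using v unfolding T_def by blast
    have "u * v = (\<Sum>i<m. h (a i) * (u * y ^ i))"
      unfolding a by (simp add: sum_distrib_left mult_ac)
    then show ?thesis using Ts[of "{..<m}" "\<lambda>i. h (a i) * (u * y ^ i)"] Th Ty[OF u] by simp
  qed
  have hT: "h a \<in> T" for a using Th[OF Typow[of 0], of a] by simp
  have T1: "1 \<in> T" using hT[of 1] by simp
  have Tpoly: "poly (map_poly h p) w \<in> T" if "w \<in> T" for p w
    using that by (induction p) (auto simp: map_poly_pCons intro!: T0 Ta Tm hT)
  have inv: "inverse w \<in> T" if w: "w \<in> T" for w
  proof (cases "w = 0")
    case True then show ?thesis using T0 by simp
  next
    case w0: False
    interpret vs: vector_space "\<lambda>a v. h a * v" by (rule vector_space_hom[OF h_hom])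
    have wT: "w ^ i \<in> T" for i by (induction i) (auto intro: T1 Tm w)
    have Tspan: "T \<subseteq> vs.span ((\<lambda>i. y ^ i) ` {..<m})"
      unfolding T_def by (auto intro!: vs.span_sum vs.span_scale intro: vs.span_base)
    \<comment> \<open>The \<open>m + 1\<close> powers of \<open>w\<close> lie in the span of
      \<open>m\<close> elements. Coinciding powers are treated apart, because dependence is a
      property of the set of powers, which would then be too small.\<close>
    have "\<exists>p. p \<noteq> 0 \<and> poly (map_poly h p) w = 0"
    proof (cases "inj_on (\<lambda>i. w ^ i) {..m}")
      case False
      then obtain i j where ij: "i < j" "w ^ i = w ^ j" unfolding inj_on_def by (metis linorder_neqE_nat)
      define p :: "'k poly fract poly" where "p = Polynomial.monom 1 j - Polynomial.monom 1 i"
      have "map_poly h p = Polynomial.monom 1 j - Polynomial.monom 1 i"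
        by (rule poly_eqI) (auto simp: p_def coeff_map_poly h.hom_uminus)
      then have "poly (map_poly h p) w = 0" using ij by (simp add: poly_monom)
      moreover have "poly.coeff p j \<noteq> 0" using ij(1) by (simp add: p_def)
      then have "p \<noteq> 0" by auto
      ultimately show ?thesis by blast
    next
      case inj: True
      let ?W = "(\<lambda>i. w ^ i) ` {..m}"
      have "vs.dependent ?W"
      proof (rule ccontr)
        assume ind: "\<not> vs.dependent ?W"
        have "card ?W \<le> card ((\<lambda>i. y ^ i) ` {..<m})"
          using vs.independent_span_bound[OF _ ind, of "(\<lambda>i. y ^ i) ` {..<m}"] Tspan wT by blast
        also have "\<dots> \<le> m" using card_image_le[of "{..<m}" "\<lambda>i. y ^ i"] by simp
        finally show False using card_image[OF inj] by simp
      qed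
      then obtain u v where u: "v \<in> ?W" "u v \<noteq> 0" "(\<Sum>v\<in>?W. h (u v) * v) = 0"
        using vs.dependent_finite[of ?W] by auto
      define p where "p = (\<Sum>i\<le>m. Polynomial.monom (u (w ^ i)) i)"
      have cp: "poly.coeff p i = (if i \<le> m then u (w ^ i) else 0)" for i
        by (simp add: p_def coeff_sum)
      have "map_poly h p = (\<Sum>i\<le>m. Polynomial.monom (h (u (w ^ i))) i)"
        by (rule poly_eqI) (simp add: coeff_map_poly cp coeff_sum)
      then have "poly (map_poly h p) w = (\<Sum>i\<le>m. h (u (w ^ i)) * w ^ i)" by (simp add: poly_sum poly_monom)
      also have "\<dots> = (\<Sum>v\<in>?W. h (u v) * v)" using sum.reindex[OF inj, of "\<lambda>v. h (u v) * v"] by simp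
      finally have "poly (map_poly h p) w = 0" using u(3) by simp
      moreover have "p \<noteq> 0"
      proof
        assume "p = 0"
        then have "u (w ^ i) = 0" if "i \<le> m" for i using cp[of i] that by simp
        then show False using u(1,2) by auto
      qed
      ultimately show ?thesis by blast
    qed
    then obtain p where p: "p \<noteq> 0" "poly (map_poly h p) w = 0"
      and min: "\<And>q. q \<noteq> 0 \<Longrightarrow> poly (map_poly h q) w = 0 \<Longrightarrow> Polynomial.degree p \<le> Polynomial.degree q"
      using ex_has_least_nat[of "\<lambda>p. p \<noteq> 0 \<and> poly (map_poly h p) w = 0" _ Polynomial.degree] by metis
    obtain b q where bq: "p = pCons b q" by (rule pCons_cases)
    have e: "h b + w * poly (map_poly h q) w = 0" using p(2) unfolding bq by (simp add: map_poly_pCons)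
    \<comment> \<open>A vanishing constant term could be divided out, against the minimality of
      \<open>p\<close>. Solving for the constant term then exhibits the inverse of
      \<open>w\<close>.\<close>
    have "b \<noteq> 0"
    proof
      assume b: "b = 0"
      then have "q \<noteq> 0" using p(1) bq by auto
      moreover have "poly (map_poly h q) w = 0" using e b w0 by simp
      ultimately show False using min[of q] b unfolding bq by simp
    qed
    then have hb: "h b \<noteq> 0" by simp
    have "w * (h (inverse b) * (h (- 1) * poly (map_poly h q) w)) = h (inverse b) * (- (w * poly (map_poly h q) w))"
      by (simp add: h.hom_uminus)
    also have "- (w * poly (map_poly h q) w) = h b" using e by (simp add: neg_eq_iff_add_eq_0 add.commute)
    also have "h (inverse b) * h b = 1" using hb by (simp add: h.hom_inverse)
    finally have "inverse w = h (inverse b) * (h (- 1) * poly (map_poly h q) w)" by (rule inverse_unique)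
    show ?thesis unfolding \<open>inverse w = _\<close> by (rule Th[OF Th[OF Tpoly[OF w]]])
  qed
  have "is_subfield T" unfolding is_subfield_def
  proof (intro conjI ballI)
    fix u v assume "u \<in> T" "v \<in> T"
    then have "u + h (- 1) * v \<in> T" using Ta Th by blast
    then show "u - v \<in> T" by (simp add: h.hom_uminus)
  qed (auto intro: T1 Tm inv)
  moreover have "range h \<union> {y} \<subseteq> T" using hT Typow[of 1] by auto
  ultimately have "T = UNIV" using hull_minimal[of "range h \<union> {y}" T is_subfield] generated by blast
  then show ?thesis unfolding T_def by blast
qed

sublocale function_field h "\<lambda>i. y ^ i" m
  by (intro function_field.intro h_hom kummer_span)

lemma y_nz: "y \<noteq> 0"
proof
  assume "y = 0"
  then have "h (to_fract f) = 0" using curve m_pos by (simp add: zero_power)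
  then show False using f_nz by simp
qed

section \<open>Restriction of places to \<open>K(x)\<close> and their ramification\<close>

definition below :: "'f set \<Rightarrow> 'k poly fract set" where "below Q = h -` Q"

context
  fixes Q assumes Q: "place c Q"
begin

lemma valuation_ring_below: "valuation_ring const_fract (h -` place_ring Q)"
  unfolding valuation_ring_def
proof (intro conjI ballI allI)
  show "1 \<in> h -` place_ring Q" using place_ring_1[OF Q] by simp
  show "u - v \<in> h -` place_ring Q" if "u \<in> h -` place_ring Q" "v \<in> h -` place_ring Q" for u v
    using that place_ring_diff[OF Q] by (simp add: h.hom_minus)
  show "u * v \<in> h -` place_ring Q" if "u \<in> h -` place_ring Q" "v \<in> h -` place_ring Q" for u v
    using that place_ring_mult[OF Q] by (simp add: h.hom_mult)
  show tot: "z \<in> h -` place_ring Q \<or> inverse z \<in> h -` place_ring Q" for z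
    using place_ring_total[OF Q, of "h z"] by (auto simp: h.hom_inverse)
  have "const_fract a \<in> h -` place_ring Q" for a using place_ring_const[OF Q, of a] by simp
  \<comment> \<open>For the inclusion of the constants to be proper: one of \<open>x\<close> and
    \<open>1/x\<close> lies in the ring, and neither is constant.\<close>
  moreover have "(var :: 'k poly fract) \<notin> range const_fract" using var_not_const by blast
  moreover have "inverse (var :: 'k poly fract) \<notin> range const_fract"
  proof
    interpret cf: field_hom "const_fract :: 'k \<Rightarrow> _" by (rule field_hom_const_fract)
    assume "inverse (var :: 'k poly fract) \<in> range const_fract"
    then obtain a :: 'k where "inverse var = const_fract a" by blast
    then have "var = const_fract (inverse a)" by (metis cf.hom_inverse inverse_inverse_eq)
    then show False using var_not_const by blast
  qed
  ultimately show "range const_fract \<subset> h -` place_ring Q" using tot[of var] by blast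
  \<comment> \<open>If all of \<open>K(x)\<close> were integral at \<open>Q\<close>, then so would
    be \<open>y\<close>, whose \<open>m\<close>-th power lies in \<open>K(x)\<close>, and with it
    the whole field.\<close>
  have "h -` place_ring Q \<noteq> UNIV"
  proof
    assume "h -` place_ring Q = UNIV"
    then have hR: "h a \<in> place_ring Q" for a by blast
    have "y \<in> place_ring Q"
    proof (rule ccontr)
      assume "y \<notin> place_ring Q"
      then have "inverse y \<in> Q" using in_place_iff[OF Q, of "inverse y"] by simp
      moreover have "inverse y * (inverse y ^ (m - 1) * h (to_fract f)) = 1"
      proof -
        have "inverse y * inverse y ^ (m - 1) = inverse y ^ m" using m_pos by (simp add: power_eq_if)
        then show ?thesis using y_nz by (simp add: mult.assoc[symmetric] curve[symmetric] power_inverse)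
      qed
      ultimately have "1 \<in> Q"
        using place_mult[OF Q, of "inverse y" "inverse y ^ (m - 1) * h (to_fract f)"]
          place_ring_mult[OF Q place_ring_power[OF Q] hR] place_subset[OF Q] by auto
      then show False using place_not_1[OF Q] by blast
    qed
    have "z \<in> place_ring Q" for z
    proof -
      obtain a where "z = (\<Sum>i<m. h (a i) * y ^ i)" using kummer_span by blast
      then show ?thesis
        using hR \<open>y \<in> place_ring Q\<close> by (auto intro!: place_ring_sum[OF Q] place_ring_mult[OF Q] place_ring_power[OF Q])
    qed
    then show False using place_ring_neq_UNIV[OF Q] by blast
  qed
  then show "h -` place_ring Q \<subset> UNIV" by blast
qed

lemma below_eq: "below Q = {z \<in> h -` place_ring Q. z = 0 \<or> inverse z \<notin> h -` place_ring Q}"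
  using in_place_iff[OF Q] place_subset[OF Q] place_0[OF Q] unfolding below_def
  by (auto simp: h.hom_inverse)

lemma place_below: "place const_fract (below Q)"
  unfolding below_eq by (rule place_of_valuation_ring[OF valuation_ring_below])

lemma place_ring_below: "place_ring (below Q) = h -` place_ring Q"
  unfolding below_eq by (rule place_ring_of_place[OF valuation_ring_below])

lemma ramification:
  "\<exists>e>0. \<forall>z. z \<noteq> 0 \<longrightarrow> place_val Q (h z) = e * place_val (below Q) z"
proof -
  note d = discrete[OF Q] and db = discrete_rational[OF place_below]
  obtain t where t: "t \<in> below Q" "t \<noteq> 0"
    and f: "\<forall>z. z \<noteq> 0 \<longrightarrow> (\<exists>u. place_unit (below Q) u \<and> z = t powi place_val (below Q) z * u)"
    using place_val_form[OF db] by metis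
  have ht: "h t \<noteq> 0" "h t \<in> Q" using t by (auto simp: below_def)
  have "place_val Q (h z) = place_val Q (h t) * place_val (below Q) z" if z: "z \<noteq> 0" for z
  proof -
    obtain u where u: "place_unit (below Q) u" "z = t powi place_val (below Q) z * u" using f z by blast
    have u0: "u \<noteq> 0" using u(1) unfolding place_unit_def by blast
    have "h u \<in> place_ring Q" "inverse (h u) \<in> place_ring Q"
      using u(1) unfolding place_unit_def place_ring_below by (auto simp: h.hom_inverse)
    then have "place_val Q (h u) = 0"
      using place_val_nonneg[OF d, of "h u"] place_val_nonneg[OF d, of "inverse (h u)"] u0
      by (simp add: place_val_inverse[OF d])
    moreover have "h z = h t powi place_val (below Q) z * h u"
    proof -
      have "h (t powi n) = h t powi n" for n
        by (simp add: power_int_def h.hom_power h.hom_inverse)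
      then show ?thesis using arg_cong[OF u(2), of h] by (simp add: h.hom_mult)
    qed
    ultimately show ?thesis using ht(1) u0
      by (simp add: place_val_mult[OF d] place_val_power_int[OF d] mult.commute)
  qed
  moreover have "place_val Q (h t) > 0" using place_val_pos[OF d ht(1)] ht(2) by simp
  ultimately show ?thesis by blast
qed

text \<open>The inclusion asked for by \<open>lies_over\<close> is an equality already, because one
  discrete place cannot properly contain another.\<close>

lemma lies_over_iff: "lies_over const_fract h Q p \<longleftrightarrow> place const_fract p \<and> p = below Q"
proof
  assume "lies_over const_fract h Q p"
  then have p: "place const_fract p" "p \<subseteq> below Q" unfolding lies_over_def below_def by auto
  show "place const_fract p \<and> p = below Q"
    using discrete_place_subset_eq[OF discrete_rational[OF place_below] p] p(1) by simp
next
  assume "place const_fract p \<and> p = below Q"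
  then show "lies_over const_fract h Q p" using Q unfolding lies_over_def below_def by auto
qed

text \<open>Scaling by \<open>m\<close> avoids the fraction that \<open>y\<close> would have as
  valuation in units of the place below. Up to the positive factor \<open>e\<close>, a monomial is
  measured by the weight \<open>m * v(a) + i * v(f)\<close>, which depends only on that
  place.\<close>

lemma place_val_monomial:
  obtains e where "e > 0" "\<And>z. z \<noteq> 0 \<Longrightarrow> place_val Q (h z) = e * place_val (below Q) z"
    "int m * place_val Q y = e * place_val (below Q) (to_fract f)"
    "\<And>a i. a \<noteq> 0 \<Longrightarrow> int m * place_val Q (h a * y ^ i)
      = e * (int m * place_val (below Q) a + int i * place_val (below Q) (to_fract f))"
proof -
  note d = discrete[OF Q]
  obtain e where e: "e > 0" "\<And>z. z \<noteq> 0 \<Longrightarrow> place_val Q (h z) = e * place_val (below Q) z"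
    using ramification by blast
  have y: "int m * place_val Q y = e * place_val (below Q) (to_fract f)"
    using place_val_power[OF d y_nz, of m] e(2)[of "to_fract f"] f_nz unfolding curve by simp
  have "int m * place_val Q (h a * y ^ i) = e * (int m * place_val (below Q) a + int i * place_val (below Q) (to_fract f))"
    if a: "a \<noteq> 0" for a i
  proof -
    have "int m * place_val Q (h a * y ^ i) = int m * (e * place_val (below Q) a) + int i * (int m * place_val Q y)"
      using a y_nz by (simp add: place_val_mult[OF d] place_val_power[OF d] e(2) algebra_simps)
    then show ?thesis unfolding y by (simp add: algebra_simps)
  qed
  then show ?thesis using that[of e] e y by blast
qed

end

end

text \<open>A place of \<open>K(x)\<close> at which the valuation of \<open>f\<close> is prime to \<open>m\<close> forces \<open>[F : K(x)] = m\<close>.\<close>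

locale kummer_extension_ramified = kummer_extension +
  fixes Q0 :: "'b set"
  assumes Q0: "place (h \<circ> const_fract) Q0"
    and coprime: "Rings.coprime (place_val (below Q0) (to_fract f)) (int m)"
begin

text \<open>Modulo \<open>m\<close> the weight of a term is \<open>i * v(f)\<close>, and these
  residues are distinct for \<open>i < m\<close> when \<open>v(f)\<close> is prime to
  \<open>m\<close>.\<close>

lemma coprime_terms_distinct:
  assumes Q: "place c Q" and cop: "Rings.coprime (place_val (below Q) (to_fract f)) (int m)"
    and ij: "i < m" "j < m" "i \<noteq> j" "h (a i) * y ^ i \<noteq> 0" "h (a j) * y ^ j \<noteq> 0"
  shows "place_val Q (h (a i) * y ^ i) \<noteq> place_val Q (h (a j) * y ^ j)"
proof
  assume eq: "place_val Q (h (a i) * y ^ i) = place_val Q (h (a j) * y ^ j)"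
  let ?l = "place_val (below Q) (to_fract f)"
  obtain e where e: "e > 0" "\<And>a i. a \<noteq> 0 \<Longrightarrow> int m * place_val Q (h a * y ^ i)
      = e * (int m * place_val (below Q) a + int i * ?l)"
    by (rule place_val_monomial[OF Q]) blast
  have nz: "a i \<noteq> 0" "a j \<noteq> 0" using ij by auto
  have "e * (int m * place_val (below Q) (a i) + int i * ?l) = e * (int m * place_val (below Q) (a j) + int j * ?l)"
    using e(2)[OF nz(1), of i] e(2)[OF nz(2), of j] eq by metis
  then have "int m * place_val (below Q) (a i) + int i * ?l = int m * place_val (below Q) (a j) + int j * ?l"
    using e(1) by simp
  then have "(int i - int j) * ?l = int m * (place_val (below Q) (a j) - place_val (below Q) (a i))"
    by (simp add: algebra_simps)
  then have "int m dvd (int i - int j) * ?l" by simp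
  then have "int m dvd int i - int j" using cop by (simp add: coprime_dvd_mult_left_iff coprime_commute)
  moreover have "\<bar>int i - int j\<bar> < int m" "int i - int j \<noteq> 0" using ij by auto
  ultimately show False using dvd_imp_le_int[of "int i - int j" "int m"] by simp
qed

lemma independent:
  assumes "(\<Sum>i<m. h (a i) * y ^ i) = 0" "i < m"
  shows "a i = 0"
proof (rule ccontr)
  assume "a i \<noteq> 0"
  then have nz: "h (a i) * y ^ i \<noteq> 0" using y_nz by simp
  let ?g = "\<lambda>i. h (a i) * y ^ i"
  \<comment> \<open>The sum, being 0, lies in the ideal one level above the valuation of the
    \<open>i\<close>-th term, so that term would have to lie there as well.\<close>
  have "?g i \<in> val_ideal Q0 (place_val Q0 (?g i) + 1)"
  proof (rule val_ideal_sum_distinct[OF discrete[OF Q0], of "{..<m}" ?g])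
    show "(\<Sum>i<m. ?g i) \<in> val_ideal Q0 (place_val Q0 (?g i) + 1)"
      using assms(1) by (simp add: val_ideal_def)
    show "place_val Q0 (?g i) \<noteq> place_val Q0 (?g j)"
      if "i \<in> {..<m}" "j \<in> {..<m}" "i \<noteq> j" "?g i \<noteq> 0" "?g j \<noteq> 0" for i j
      by (rule coprime_terms_distinct[OF Q0 coprime]) (use that in auto)
  qed (use assms(2) in auto)
  then show False using nz by (simp add: val_ideal_def)
qed

lemma components_unique:
  assumes "(\<Sum>i<m. h (a i) * y ^ i) = (\<Sum>i<m. h (a' i) * y ^ i)" "i < m"
  shows "a i = a' i"
proof -
  have "(\<Sum>i<m. h (a i - a' i) * y ^ i) = 0"
    using assms(1) by (simp add: h.hom_minus left_diff_distrib sum_subtractf)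
  from independent[OF this assms(2)] show ?thesis by simp
qed

text \<open>A squeeze on the ramification index \<open>e\<close>: divisibility of
  \<open>e * v(f)\<close> by \<open>m\<close> gives \<open>e \<ge> m\<close>, while the zero degree
  of \<open>w\<close>, a function of height 1, gives
  \<open>e * place_degree c Q \<le> m\<close>.\<close>

lemma totally_ramified_at:
  assumes Q: "place c Q" and cop: "Rings.coprime (place_val (below Q) (to_fract f)) (int m)"
    and w: "w \<noteq> 0" "place_val (below Q) w = 1" "has_height (h w) 1"
  shows "place_degree c Q = 1" and "\<And>z. z \<noteq> 0 \<Longrightarrow> place_val Q (h z) = int m * place_val (below Q) z"
    and "place_val Q y = place_val (below Q) (to_fract f)"
proof -
  let ?l = "place_val (below Q) (to_fract f)"
  obtain e where e: "e > 0" "\<And>z. z \<noteq> 0 \<Longrightarrow> place_val Q (h z) = e * place_val (below Q) z"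
    "int m * place_val Q y = e * ?l"
    by (rule place_val_monomial[OF Q]) blast
  have "int m dvd e * ?l" using e(3) by (metis dvd_triv_left)
  then have "int m dvd e" using cop by (simp add: coprime_dvd_mult_left_iff coprime_commute)
  then have em: "e \<ge> int m" using e(1) zdvd_imp_le by blast
  have "(\<Sum>Q\<in>{Q}. place_val Q (h w) * int (place_degree c Q)) \<le> int (m * 1)"
    by (rule degree_zeros_le) (use w Q e in auto)
  then have le: "e * int (place_degree c Q) \<le> int m" using e(2)[OF w(1)] w(2) by simp
  have dp: "int (place_degree c Q) \<ge> 1" using place_degree_pos[OF Q] by simp
  have "e * 1 \<le> e * int (place_degree c Q)" using dp e(1) by (intro mult_left_mono) auto
  then have em': "e = int m" using le em by simp
  have "int m * int (place_degree c Q) \<le> int m * 1" using le em' by simp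
  then show "place_degree c Q = 1" using dp m_pos by simp
  show "\<And>z. z \<noteq> 0 \<Longrightarrow> place_val Q (h z) = int m * place_val (below Q) z" using e(2) em' by simp
  show "place_val Q y = ?l" using e(3) em' m_pos by simp
qed

end

lemma le_div_iff_mult_le_int: "(0::int) < k \<Longrightarrow> x \<le> n div k \<longleftrightarrow> x * k \<le> n"
proof
  assume k: "0 < k" and "x \<le> n div k"
  then have "x * k \<le> n div k * k" by (intro mult_right_mono) auto
  also have "\<dots> \<le> n" using k by (metis div_mult_mod_eq le_add_same_cancel1 pos_mod_sign)
  finally show "x * k \<le> n" .
next
  assume k: "0 < k" and "x * k \<le> n"
  then have "x * k div k \<le> n div k" by (intro zdiv_mono1)
  then show "x \<le> n div k" using k by simp
qed

section \<open>Integrality of the components above a place of \<open>K(x)\<close>\<close>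

context kummer_extension_ramified
begin

text \<open>The functions all of whose terms have nonnegative weight at \<open>p\<close>, with
  \<open>y\<close> counted as having valuation \<open>v(f) / m\<close>. By
  \<open>integral_components\<close> it contains everything that is integral at all places above
  \<open>p\<close>.\<close>

definition weight_ring :: "'a poly fract set \<Rightarrow> 'b set" where
  "weight_ring p = {z. \<exists>a. z = (\<Sum>i<m. h (a i) * y ^ i) \<and>
     (\<forall>i<m. a i = 0 \<or> int m * place_val p (a i) + int i * place_val p (to_fract f) \<ge> 0)}"

text \<open>The pieces of nonzero degree in the grading of the field by exponents of
  \<open>y\<close> modulo \<open>m\<close>.\<close>

definition no_constant_term :: "'b set" where
  "no_constant_term = {z. \<exists>a. z = (\<Sum>i<m. h (a i) * y ^ i) \<and> a 0 = 0}"

lemma y_power_reduce: "h a * y ^ j = (\<Sum>i<m. h (if i = j mod m then a * to_fract f ^ (j div m) else 0) * y ^ i)"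
proof -
  have "y ^ j = y ^ (m * (j div m) + j mod m)" by simp
  also have "\<dots> = h (to_fract f ^ (j div m)) * y ^ (j mod m)"
    by (simp only: power_add power_mult curve h.hom_power)
  finally have "h a * y ^ j = h (a * to_fract f ^ (j div m)) * y ^ (j mod m)" by (simp add: h.hom_mult)
  then show ?thesis using m_pos by (simp add: if_distrib if_distribR cong: if_cong)
qed

lemma no_constant_term_diff:
  "u \<in> no_constant_term \<Longrightarrow> v \<in> no_constant_term \<Longrightarrow> u - v \<in> no_constant_term"
proof -
  assume "u \<in> no_constant_term" "v \<in> no_constant_term"
  then obtain a a' where "u = (\<Sum>i<m. h (a i) * y ^ i)" "v = (\<Sum>i<m. h (a' i) * y ^ i)" "a 0 = 0" "a' 0 = 0"
    unfolding no_constant_term_def by blast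
  then show ?thesis unfolding no_constant_term_def
    by (intro CollectI exI[of _ "\<lambda>i. a i - a' i"]) (simp add: h.hom_minus left_diff_distrib sum_subtractf)
qed

lemma no_constant_term_0: "0 \<in> no_constant_term"
  unfolding no_constant_term_def by (intro CollectI exI[of _ "\<lambda>_. 0"]) simp

lemma no_constant_term_sum:
  fixes g :: "nat \<Rightarrow> 'b"
  shows "(\<And>i. i \<in> I \<Longrightarrow> g i \<in> no_constant_term) \<Longrightarrow> sum g I \<in> no_constant_term"
proof (induction I rule: infinite_finite_induct)
  case (insert i I)
  then have "g i - (0 - sum g I) \<in> no_constant_term" by (intro no_constant_term_diff no_constant_term_0) auto
  then show ?case using insert.hyps by simp
qed (auto intro: no_constant_term_0)

lemma no_constant_term_monomial: "\<not> m dvd j \<Longrightarrow> h a * y ^ j \<in> no_constant_term"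
  unfolding no_constant_term_def y_power_reduce[of a j] mod_eq_0_iff_dvd[symmetric]
  by (intro CollectI exI[of _ "\<lambda>i. if i = j mod m then a * to_fract f ^ (j div m) else 0"]) auto

lemma no_constant_term_remainder: "(\<Sum>i<m. h (a i) * y ^ i) - h (a 0) \<in> no_constant_term"
proof -
  have "(\<Sum>i<m. h (a i) * y ^ i) = h (a 0) * y ^ 0 + (\<Sum>i\<in>{..<m} - {0}. h (a i) * y ^ i)"
    using m_pos by (intro sum.remove) auto
  moreover have "(\<Sum>i\<in>{..<m} - {0}. h (a i) * y ^ i) \<in> no_constant_term"
    by (intro no_constant_term_sum no_constant_term_monomial) (auto dest: dvd_imp_le)
  ultimately show ?thesis by simp
qed

lemma constant_term_unique:
  assumes "h b - h b' \<in> no_constant_term" shows "b = b'"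
proof -
  obtain a where a: "h b - h b' = (\<Sum>i<m. h (a i) * y ^ i)" "a 0 = 0"
    using assms unfolding no_constant_term_def by blast
  have "(\<Sum>i<m. h (a i) * y ^ i) = (\<Sum>i<m. h (if i = 0 then b - b' else 0) * y ^ i)"
    unfolding a(1)[symmetric] using m_pos by (simp add: if_distrib if_distribR h.hom_minus cong: if_cong)
  from components_unique[OF this, of 0] show ?thesis using a(2) m_pos by simp
qed

lemma weight_ring_monomial:
  assumes p: "place const_fract p"
    and a: "a = 0 \<or> int m * place_val p a + int j * place_val p (to_fract f) \<ge> 0"
  shows "h a * y ^ j \<in> weight_ring p"
proof -
  note d = discrete_rational[OF p]
  let ?a = "\<lambda>i. if i = j mod m then a * to_fract f ^ (j div m) else 0"
  have "?a i = 0 \<or> int m * place_val p (?a i) + int i * place_val p (to_fract f) \<ge> 0" for i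
  proof (cases "i = j mod m \<and> a \<noteq> 0")
    case True
    then have "place_val p (?a i) = place_val p a + int (j div m) * place_val p (to_fract f)"
      using f_nz by (simp add: place_val_mult[OF d] place_val_power[OF d])
    then have "int m * place_val p (?a i) + int i * place_val p (to_fract f)
        = int m * place_val p a + (int m * int (j div m) + int (j mod m)) * place_val p (to_fract f)"
      using True by (simp add: algebra_simps)
    also have "int m * int (j div m) + int (j mod m) = int j" by (simp flip: of_nat_mult of_nat_add)
    finally show ?thesis using a True by simp
  qed auto
  then show ?thesis unfolding weight_ring_def y_power_reduce[of a j]
    by (intro CollectI exI[of _ ?a]) auto
qed

lemma weight_ring_0: "0 \<in> weight_ring p"
  unfolding weight_ring_def by (intro CollectI exI[of _ "\<lambda>_. 0"]) simp

lemma weight_ring_diff: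
  assumes p: "place const_fract p" and "u \<in> weight_ring p" "v \<in> weight_ring p"
  shows "u - v \<in> weight_ring p"
proof -
  note d = discrete_rational[OF p]
  obtain a a' where a: "u = (\<Sum>i<m. h (a i) * y ^ i)" "v = (\<Sum>i<m. h (a' i) * y ^ i)"
    "\<And>i. i < m \<Longrightarrow> a i = 0 \<or> int m * place_val p (a i) + int i * place_val p (to_fract f) \<ge> 0"
    "\<And>i. i < m \<Longrightarrow> a' i = 0 \<or> int m * place_val p (a' i) + int i * place_val p (to_fract f) \<ge> 0"
    using assms(2,3) unfolding weight_ring_def by blast
  \<comment> \<open>For a fixed exponent, nonnegative weight is membership in a fractional ideal of
    \<open>p\<close>, with the bound rounded by integer division; closure under differences is then
    known.\<close>
  have *: "(b = 0 \<or> int m * place_val p b + k \<ge> 0) \<longleftrightarrow> b \<in> val_ideal p (- (k div int m))" for b k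
    using le_div_iff_mult_le_int[of "int m" "- place_val p b" k] m_pos unfolding val_ideal_def
    by (auto simp: mult.commute)
  have "a i - a' i = 0 \<or> int m * place_val p (a i - a' i) + int i * place_val p (to_fract f) \<ge> 0" if "i < m" for i
    using a(3,4)[OF that] unfolding * by (rule val_ideal_diff[OF d])
  moreover have "u - v = (\<Sum>i<m. h (a i - a' i) * y ^ i)"
    unfolding a(1,2) by (simp add: h.hom_minus left_diff_distrib sum_subtractf)
  ultimately show ?thesis unfolding weight_ring_def by (intro CollectI exI[of _ "\<lambda>i. a i - a' i"]) auto
qed

lemma weight_ring_sum:
  fixes g :: "nat \<Rightarrow> 'b"
  assumes p: "place const_fract p" and "\<And>i. i \<in> I \<Longrightarrow> g i \<in> weight_ring p"
  shows "sum g I \<in> weight_ring p"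
  using assms(2)
proof (induction I rule: infinite_finite_induct)
  case (insert i I)
  then have "g i - (0 - sum g I) \<in> weight_ring p" by (intro weight_ring_diff[OF p] weight_ring_0) auto
  then show ?case using insert.hyps by simp
qed (auto intro: weight_ring_0)

lemma weight_ring_mult:
  assumes p: "place const_fract p" and "u \<in> weight_ring p" "v \<in> weight_ring p"
  shows "u * v \<in> weight_ring p"
proof -
  note d = discrete_rational[OF p]
  obtain a a' where a: "u = (\<Sum>i<m. h (a i) * y ^ i)" "v = (\<Sum>i<m. h (a' i) * y ^ i)"
    "\<And>i. i < m \<Longrightarrow> a i = 0 \<or> int m * place_val p (a i) + int i * place_val p (to_fract f) \<ge> 0"
    "\<And>i. i < m \<Longrightarrow> a' i = 0 \<or> int m * place_val p (a' i) + int i * place_val p (to_fract f) \<ge> 0"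
    using assms(2,3) unfolding weight_ring_def by blast
  have "u * v = (\<Sum>i<m. \<Sum>j<m. h (a i * a' j) * y ^ (i + j))"
    unfolding a(1,2) sum_product by (simp add: h.hom_mult power_add mult_ac)
  also have "\<dots> \<in> weight_ring p"
  proof (intro weight_ring_sum[OF p] weight_ring_monomial[OF p])
    fix i j assume ij: "i \<in> {..<m}" "j \<in> {..<m}"
    show "a i * a' j = 0 \<or> int m * place_val p (a i * a' j) + int (i + j) * place_val p (to_fract f) \<ge> 0"
    proof (cases "a i = 0 \<or> a' j = 0")
      case False
      then have "int m * place_val p (a i * a' j) + int (i + j) * place_val p (to_fract f)
        = (int m * place_val p (a i) + int i * place_val p (to_fract f))
          + (int m * place_val p (a' j) + int j * place_val p (to_fract f))"
        by (simp add: place_val_mult[OF d] algebra_simps)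
      then show ?thesis using a(3)[of i] a(4)[of j] ij False by simp
    qed auto
  qed
  finally show ?thesis .
qed

lemma weight_ring_hom:
  assumes p: "place const_fract p" and "a \<in> place_ring p" shows "h a \<in> weight_ring p"
proof -
  have "h a * y ^ 0 \<in> weight_ring p"
    by (rule weight_ring_monomial[OF p])
       (use assms(2) place_val_nonneg[OF discrete_rational[OF p], of a] in \<open>auto simp: zero_le_mult_iff\<close>)
  then show ?thesis by simp
qed

lemma weight_ring_power: "place const_fract p \<Longrightarrow> u \<in> weight_ring p \<Longrightarrow> u ^ n \<in> weight_ring p"
proof (induction n)
  case 0 then show ?case using weight_ring_hom[OF _ place_ring_1, of p] by simp
qed (simp add: weight_ring_mult)

lemma CHAR_eq: "CHAR('b) = CHAR('a)"
proof (rule CHAR_eqI)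
  have c: "c (of_nat n) = of_nat n" for n by (rule c.hom_of_nat)
  show "of_nat CHAR('a) = (0 :: 'b)" using c[of "CHAR('a)"] by (simp add: const_fract_0)
  fix n assume "of_nat n = (0 :: 'b)"
  then have "c (of_nat n) = 0" using c by simp
  then have "of_nat n = (0 :: 'a)" using c.hom_0 by blast
  then show "CHAR('a) dvd n" by (simp add: of_nat_eq_0_iff_char_dvd)
qed

text \<open>
  In characteristic \<open>l\<close> prime to \<open>m\<close>, raising to the power \<open>l\<^sup>s\<close> permutes the graded pieces
  \<open>K(x) y\<^sup>i\<close> and fixes the piece of degree \<open>0\<close>.
\<close>

lemma constant_term_frobenius:
  assumes char: "\<not> CHAR('a) dvd m"
    and "(\<Sum>i<m. h (a i) * y ^ i) ^ (CHAR('a) ^ s) = (\<Sum>i<m. h (a' i) * y ^ i)"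
  shows "a' 0 = a 0 ^ (CHAR('a) ^ s)"
proof -
  let ?N = "CHAR('a) ^ s"
  have pr: "Factorial_Ring.prime CHAR('a)" by (intro prime_CHAR_semidom finite_imp_CHAR_pos) simp
  have prF: "Factorial_Ring.prime CHAR('b)" using pr by (simp add: CHAR_eq)
  \<comment> \<open>Ensures that \<open>i * ?N\<close> is a multiple of \<open>m\<close> only if
    \<open>i\<close> is, so no other graded piece is carried into degree 0.\<close>
  have cop: "Rings.coprime m ?N"
    using prime_imp_coprime[OF pr char] by (simp add: coprime_commute)
  have "(\<Sum>i<m. h (a i) * y ^ i) ^ ?N = (\<Sum>i<m. (h (a i) * y ^ i) ^ ?N)"
    by (rule freshmans_dream_sum'[OF prF, of _ s]) (simp add: CHAR_eq)
  also have "\<dots> = (\<Sum>i<m. h (a i ^ ?N) * y ^ (i * ?N))"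
    by (simp add: power_mult_distrib h.hom_power power_mult)
  also have "\<dots> = h (a 0 ^ ?N) + (\<Sum>i\<in>{..<m} - {0}. h (a i ^ ?N) * y ^ (i * ?N))"
    using m_pos by (subst sum.remove[of "{..<m}" 0]) auto
  finally have "(\<Sum>i<m. h (a' i) * y ^ i) = h (a 0 ^ ?N) + (\<Sum>i\<in>{..<m} - {0}. h (a i ^ ?N) * y ^ (i * ?N))"
    using assms(2) by simp
  have A: "(\<Sum>i\<in>{..<m} - {0}. h (a i ^ ?N) * y ^ (i * ?N)) \<in> no_constant_term"
  proof (intro no_constant_term_sum no_constant_term_monomial)
    fix i assume "i \<in> {..<m} - {0}"
    then have "\<not> m dvd i" by (auto dest: dvd_imp_le)
    then show "\<not> m dvd i * ?N" using cop by (simp add: coprime_dvd_mult_left_iff)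
  qed
  have "(\<Sum>i\<in>{..<m} - {0}. h (a i ^ ?N) * y ^ (i * ?N))
      - ((\<Sum>i<m. h (a' i) * y ^ i) - h (a' 0)) \<in> no_constant_term"
    by (rule no_constant_term_diff[OF A no_constant_term_remainder[of a']])
  also have "(\<Sum>i\<in>{..<m} - {0}. h (a i ^ ?N) * y ^ (i * ?N)) - ((\<Sum>i<m. h (a' i) * y ^ i) - h (a' 0))
      = h (a' 0) - h (a 0 ^ ?N)"
    using \<open>(\<Sum>i<m. h (a' i) * y ^ i) = h (a 0 ^ ?N) + _\<close> by simp
  finally show ?thesis by (rule constant_term_unique)
qed

text \<open>
  An element integral at all places above \<open>p\<close> has integral components. Otherwise divide it by its
  component \<open>a\<^sub>i\<^sub>0 y\<^sup>i\<^sup>0\<close> of least weight: the quotient \<open>z'\<close> has constant term \<open>1\<close> but lies in every place above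
  \<open>p\<close>, so a power of it is divisible by a uniformizer of \<open>p\<close>, contradicting the Frobenius lemma.
\<close>

lemma integral_components:
  assumes char: "\<not> CHAR('a) dvd m" and p: "place const_fract p"
    and int: "\<And>Q. place c Q \<Longrightarrow> below Q = p \<Longrightarrow> (\<Sum>i<m. h (a i) * y ^ i) \<in> place_ring Q"
    and i: "i < m" "a i \<noteq> 0"
  shows "int m * place_val p (a i) + int i * place_val p (to_fract f) \<ge> 0"
proof (rule ccontr)
  assume neg: "\<not> ?thesis"
  note d = discrete_rational[OF p]
  define w where "w i = int m * place_val p (a i) + int i * place_val p (to_fract f)" for i
  let ?J = "{i. i < m \<and> a i \<noteq> 0}"
  have "w i \<in> w ` ?J" using i by blast
  then have "Min (w ` ?J) \<in> w ` ?J" by (intro Min_in) auto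
  then obtain j where j: "j \<in> ?J" "w j = Min (w ` ?J)" by auto
  have wmin: "w j \<le> w i" if "i \<in> ?J" for i unfolding j(2) using that by (intro Min_le) auto
  have "w j \<le> w i" using wmin i by blast
  then have wneg: "w j < 0" using neg by (simp add: w_def)
  have jm: "j < m" "a j \<noteq> 0" using j by auto
  let ?z = "\<Sum>i<m. h (a i) * y ^ i"
  let ?f = "to_fract f"
  \<comment> \<open>Division by \<open>a j * y ^ j\<close>, performed as multiplication by
    \<open>y ^ (m - j) / (a j * f)\<close> so that all exponents of \<open>y\<close> stay
    natural.\<close>
  define z' where "z' = (\<Sum>i<m. h (a i / (a j * ?f)) * y ^ (i + (m - j)))"
  have f0: "?f \<noteq> 0" using f_nz by simp
  have z'z: "z' * (h (a j) * y ^ j) = ?z"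
  proof -
    have "h (a i / (a j * ?f)) * y ^ (i + (m - j)) * (h (a j) * y ^ j) = h (a i) * y ^ i" for i
    proof -
      have "y ^ (m - j) * y ^ j = h ?f" using jm by (simp add: power_add[symmetric] curve)
      then have "h (a i / (a j * ?f)) * y ^ (i + (m - j)) * (h (a j) * y ^ j)
          = h (a i / (a j * ?f)) * h (a j) * h ?f * y ^ i" by (simp add: power_add mult_ac)
      also have "h (a i / (a j * ?f)) * h (a j) * h ?f = h (a i / (a j * ?f) * a j * ?f)" by (simp only: h.hom_mult)
      also have "a i / (a j * ?f) * a j * ?f = a i" using jm f0 by simp
      finally show ?thesis .
    qed
    then show ?thesis unfolding z'_def by (simp add: sum_distrib_right)
  qed
  have z'W: "z' \<in> weight_ring p" unfolding z'_def
  proof (intro weight_ring_sum[OF p] weight_ring_monomial[OF p])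
    fix i assume "i \<in> {..<m}"
    show "a i / (a j * ?f) = 0 \<or> int m * place_val p (a i / (a j * ?f)) + int (i + (m - j)) * place_val p ?f \<ge> 0"
    proof (cases "a i = 0")
      case False
      have "place_val p (a i / (a j * ?f)) = place_val p (a i) - (place_val p (a j) + place_val p ?f)"
        using False jm f0 by (simp add: place_val_divide[OF d] place_val_mult[OF d])
      then have "int m * place_val p (a i / (a j * ?f)) + int (i + (m - j)) * place_val p ?f
          = int m * (place_val p (a i) - (place_val p (a j) + place_val p ?f)) + int (i + (m - j)) * place_val p ?f"
        by (rule arg_cong)
      also have "\<dots> = w i - w j"
        using jm by (simp add: w_def of_nat_diff algebra_simps)
      finally have "int m * place_val p (a i / (a j * ?f)) + int (i + (m - j)) * place_val p ?f = w i - w j" .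
      then show ?thesis using wmin[of i] False \<open>i \<in> {..<m}\<close> by simp
    qed simp
  qed
  have z'1: "z' - h 1 \<in> no_constant_term"
  proof -
    have yf: "y ^ (j + (m - j)) = h ?f" using jm by (simp add: curve)
    have "z' = h (a j / (a j * ?f)) * y ^ (j + (m - j)) + (\<Sum>i\<in>{..<m} - {j}. h (a i / (a j * ?f)) * y ^ (i + (m - j)))"
      unfolding z'_def using jm by (intro sum.remove) auto
    also have "h (a j / (a j * ?f)) * y ^ (j + (m - j)) = h (a j / (a j * ?f) * ?f)"
      by (simp only: yf h.hom_mult)
    also have "a j / (a j * ?f) * ?f = 1" using jm f0 by simp
    finally have "z' - h 1 = (\<Sum>i\<in>{..<m} - {j}. h (a i / (a j * ?f)) * y ^ (i + (m - j)))" by simp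
    also have "\<dots> \<in> no_constant_term"
    proof (intro no_constant_term_sum no_constant_term_monomial notI)
      fix i assume i: "i \<in> {..<m} - {j}" and "m dvd i + (m - j)"
      then have "int m dvd int i + (int m - int j)" using jm
        by (metis int_dvd_int_iff of_nat_add of_nat_diff less_imp_le)
      then have "int m dvd int i + (int m - int j) - int m" by (rule dvd_diff) simp
      then have "int m dvd int i - int j" by (simp add: algebra_simps)
      moreover have "\<bar>int i - int j\<bar> < int m" "int i - int j \<noteq> 0" using i jm by auto
      ultimately show False using dvd_imp_le_int[of "int i - int j" "int m"] by simp
    qed
    finally show ?thesis .
  qed
  obtain b where b: "z' = (\<Sum>i<m. h (b i) * y ^ i)" using kummer_span by blast
  have "h (b 0) - h 1 \<in> no_constant_term"
    using no_constant_term_diff[OF z'1 no_constant_term_remainder[of b]] unfolding b by simp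
  then have b0: "b 0 = 1" by (rule constant_term_unique)
  have z'0: "z' \<noteq> 0"
  proof
    assume "z' = 0"
    then have "b 0 = 0" using independent[of b 0] b m_pos by simp
    then show False using b0 by simp
  qed
  obtain t where t: "t \<noteq> 0" "place_val p t = 1" by (rule exists_place_val[OF d])
  \<comment> \<open>The weight ring with \<open>inverse z'\<close> adjoined. Either the uniformizer
    \<open>t\<close> of \<open>p\<close> becomes a unit in it, so that \<open>t\<close> divides a
    power of \<open>z'\<close>, or some place contains \<open>t\<close> while \<open>z'\<close> is a
    unit there.\<close>
  define B where "B = {u. \<exists>n. u * z' ^ n \<in> weight_ring p}"
  have WB: "weight_ring p \<subseteq> B" unfolding B_def by (auto intro: exI[of _ 0])
  have Bdm: "u - v \<in> B \<and> u * v \<in> B" if uv: "u \<in> B" "v \<in> B" for u v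
  proof -
    obtain n n' where n: "u * z' ^ n \<in> weight_ring p" "v * z' ^ n' \<in> weight_ring p" using uv unfolding B_def by blast
    have "(u - v) * z' ^ (n + n') = (u * z' ^ n) * z' ^ n' - (v * z' ^ n') * z' ^ n"
      by (simp add: algebra_simps power_add)
    also have "\<dots> \<in> weight_ring p"
      by (intro weight_ring_diff[OF p] weight_ring_mult[OF p] weight_ring_power[OF p] n z'W)
    finally have 1: "(u - v) * z' ^ (n + n') \<in> weight_ring p" .
    have "(u * v) * z' ^ (n + n') = (u * z' ^ n) * (v * z' ^ n')" by (simp add: algebra_simps power_add)
    also have "\<dots> \<in> weight_ring p" by (intro weight_ring_mult[OF p] n)
    finally show ?thesis using 1 unfolding B_def by blast
  qed
  have B1: "1 \<in> B" using weight_ring_hom[OF p place_ring_1[OF p]] WB by auto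
  have cB: "range c \<subseteq> B" using weight_ring_hom[OF p place_ring_const[OF p]] WB by auto
  have "t \<in> place_ring p" using place_val_nonneg[OF d t(1)] t(2) by simp
  then have htB: "h t \<in> B" using weight_ring_hom[OF p] WB by blast
  show False
  proof (cases "inverse (h t) \<in> B")
    case True
    then obtain n where n: "inverse (h t) * z' ^ n \<in> weight_ring p" unfolding B_def by blast
    have pr: "Factorial_Ring.prime CHAR('a)" by (intro prime_CHAR_semidom finite_imp_CHAR_pos) simp
    then have "CHAR('a) > 1" by (rule prime_gt_1_nat)
    \<comment> \<open>The exponent \<open>n\<close> is raised to a power of the characteristic; the
      additional factors \<open>z'\<close> remain in the weight ring.\<close>
    then have "n < CHAR('a) ^ n" by (intro power_gt_expt) simp
    let ?N = "CHAR('a) ^ n"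
    have "inverse (h t) * z' ^ n * z' ^ (?N - n) \<in> weight_ring p"
      by (intro weight_ring_mult[OF p] weight_ring_power[OF p] n z'W)
    also have "inverse (h t) * z' ^ n * z' ^ (?N - n) = inverse (h t) * z' ^ ?N"
      using \<open>n < ?N\<close> by (simp add: mult.assoc power_add[symmetric])
    finally obtain e where e: "inverse (h t) * z' ^ ?N = (\<Sum>i<m. h (e i) * y ^ i)"
      "\<And>i. i < m \<Longrightarrow> e i = 0 \<or> int m * place_val p (e i) + int i * place_val p (to_fract f) \<ge> 0"
      unfolding weight_ring_def by blast
    have "z' ^ ?N = h t * (inverse (h t) * z' ^ ?N)" using t(1) by simp
    also have "\<dots> = (\<Sum>i<m. h (t * e i) * y ^ i)"
      unfolding e(1) by (simp add: sum_distrib_left h.hom_mult mult.assoc)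
    finally have "t * e 0 = b 0 ^ ?N"
      unfolding b by (rule constant_term_frobenius[OF char, where a' = "\<lambda>i. t * e i"])
    \<comment> \<open>The Frobenius power keeps the constant term 1, which would thus be divisible
      by \<open>t\<close> among the elements integral at \<open>p\<close>.\<close>
    then have te: "t * e 0 = 1" using b0 by simp
    then have e0: "e 0 \<noteq> 0" by auto
    then have "place_val p (e 0) \<ge> 0" using e(2)[of 0] m_pos by (simp add: zero_le_mult_iff)
    moreover have "place_val p t + place_val p (e 0) = 0"
      using place_val_mult[OF d t(1) e0] te place_val_1[OF d] by simp
    ultimately show False using t(2) by simp
  next
    case False
    \<comment> \<open>This place lies above \<open>p\<close>. There the original sum is integral and
      \<open>a j * y ^ j\<close> has negative valuation, so \<open>z'\<close> must vanish; but its
      inverse belongs to \<open>B\<close> and is integral.\<close>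
    obtain Q where Q: "place c Q" "B \<subseteq> place_ring Q" "h t \<in> Q"
      by (rule place_exists[OF c_hom B1 conjunct1[OF Bdm] conjunct2[OF Bdm] cB htB False])
    have "place_ring p \<subseteq> place_ring (below Q)"
      unfolding place_ring_below[OF Q(1)] using weight_ring_hom[OF p] WB Q(2) by blast
    then have "place_ring p = place_ring (below Q)" by (rule place_ring_maximal[OF d place_below[OF Q(1)]])
    then have bQ: "below Q = p" using place_ring_inj[OF p place_below[OF Q(1)]] by simp
    note dQ = discrete[OF Q(1)]
    have "1 \<in> weight_ring p" using weight_ring_hom[OF p place_ring_1[OF p]] by simp
    then have "inverse z' \<in> B" unfolding B_def using z'0 by (intro CollectI exI[of _ 1]) simp
    then have z'Q: "z' \<notin> Q" using Q(2) in_place_iff[OF Q(1)] z'0 by blast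
    obtain e where e: "e > 0" "\<And>a i. a \<noteq> 0 \<Longrightarrow> int m * place_val Q (h a * y ^ i)
      = e * (int m * place_val (below Q) a + int i * place_val (below Q) (to_fract f))"
      by (rule place_val_monomial[OF Q(1)]) blast
    have "int m * place_val Q (h (a j) * y ^ j) = e * w j" using e(2)[OF jm(2), of j] bQ by (simp add: w_def)
    also have "\<dots> < 0" using e(1) wneg by (rule mult_pos_neg)
    finally have vneg: "place_val Q (h (a j) * y ^ j) < 0" using m_pos by (simp add: mult_less_0_iff)
    have ay0: "h (a j) * y ^ j \<noteq> 0" using jm y_nz by simp
    have "?z \<in> place_ring Q" by (rule int[OF Q(1) bQ])
    moreover have "?z \<noteq> 0" using z'z z'0 ay0 by (metis mult_eq_0_iff)
    ultimately have "place_val Q ?z \<ge> 0" using place_val_nonneg[OF dQ] by simp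
    then have "place_val Q z' + place_val Q (h (a j) * y ^ j) \<ge> 0"
      using place_val_mult[OF dQ z'0 ay0] z'z by simp
    then have "place_val Q z' > 0" using vneg by simp
    then show False using place_val_pos[OF dQ z'0] z'Q by simp
  qed
qed

text \<open>A Riemann-Roch space of \<open>K(x)\<close>: the coefficient of \<open>y ^ i\<close> is
  subject to the weight condition, and the floor converts this into a divisor with integer
  coefficients.\<close>

definition component_space :: "('a poly fract set \<Rightarrow> int) \<Rightarrow> nat \<Rightarrow> 'a poly fract set" where
  "component_space dd i = {u. \<forall>p. place const_fract p \<longrightarrow>
     u \<in> val_ideal p (- ((int i * place_val p (to_fract f) + dd p) div int m))}"

lemma val_ideal_div_iff:
  "b \<in> val_ideal p (- (k div int m)) \<longleftrightarrow> b = 0 \<or> int m * place_val p b + k \<ge> 0"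
  using le_div_iff_mult_le_int[of "int m" "- place_val p b" k] m_pos unfolding val_ideal_def
  by (auto simp: mult.commute)

text \<open>The coefficients of \<open>D\<close> are read from a function \<open>dd\<close> of the
  place below. Where \<open>dd\<close> is nonzero, the exact valuation of each term is known and
  distinct valuations separate the terms; where it vanishes, the condition is integrality and
  \<open>integral_components\<close> applies.\<close>

lemma riemann_roch_space_components:
  assumes char: "\<not> CHAR('a) dvd m"
    and D: "\<And>Q. place c Q \<Longrightarrow> Poly_Mapping.lookup D Q = dd (below Q)"
    and dd: "\<And>p. dd p \<noteq> 0 \<Longrightarrow> Rings.coprime (place_val p (to_fract f)) (int m)
       \<and> (\<exists>w. w \<noteq> 0 \<and> place_val p w = 1 \<and> has_height (h w) 1) \<and> (\<exists>Q. place c Q \<and> below Q = p)"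
  shows "(\<Sum>i<m. h (a i) * y ^ i) \<in> riemann_roch_space c D \<longleftrightarrow> (\<forall>i<m. a i \<in> component_space dd i)"
proof -
  let ?z = "\<Sum>i<m. h (a i) * y ^ i"
  have tval: "place_val Q (h a * y ^ i) = int m * place_val (below Q) a + int i * place_val (below Q) (to_fract f)"
    if Q: "place c Q" and dp: "dd (below Q) \<noteq> 0" and a: "a \<noteq> 0" for Q a i
  proof -
    note d = discrete[OF Q]
    obtain w where w: "w \<noteq> 0" "place_val (below Q) w = 1" "has_height (h w) 1" using dd[OF dp] by blast
    note t = totally_ramified_at[OF Q conjunct1[OF dd[OF dp]] w]
    show ?thesis using t(2)[OF a] t(3) a y_nz by (simp add: place_val_mult[OF d] place_val_power[OF d])
  qed
  show ?thesis
  proof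
    assume z: "?z \<in> riemann_roch_space c D"
    show "\<forall>i<m. a i \<in> component_space dd i"
      unfolding component_space_def val_ideal_div_iff
    proof (intro allI impI CollectI)
      fix i and p :: "'a poly fract set" assume i: "i < m" and p: "place const_fract p"
      show "a i = 0 \<or> int m * place_val p (a i) + (int i * place_val p (to_fract f) + dd p) \<ge> 0"
      proof (cases "a i = 0")
        case ai: False
        show ?thesis
        proof (cases "dd p = 0")
          case True
          have "?z \<in> place_ring Q" if "place c Q" "below Q = p" for Q
            using z that D[of Q] True place_ring_val[OF discrete[OF that(1)]] unfolding riemann_roch_space_iff by auto
          from integral_components[OF char p this i ai] show ?thesis using True by simp
        next
          case False
          then obtain Q where Q: "place c Q" "below Q = p" using dd by blast
          have "h (a i) * y ^ i \<in> val_ideal Q (- dd p)"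
          proof (rule val_ideal_sum_distinct[OF discrete[OF Q(1)], of "{..<m}" "\<lambda>i. h (a i) * y ^ i"])
            show "?z \<in> val_ideal Q (- dd p)" using z Q D[OF Q(1)] unfolding riemann_roch_space_iff by auto
            show "place_val Q (h (a i) * y ^ i) \<noteq> place_val Q (h (a j) * y ^ j)"
              if "i \<in> {..<m}" "j \<in> {..<m}" "i \<noteq> j" "h (a i) * y ^ i \<noteq> 0" "h (a j) * y ^ j \<noteq> 0" for i j
              by (rule coprime_terms_distinct[OF Q(1)]) (use dd[OF False] Q(2) that in auto)
          qed (use i in auto)
          then have "place_val Q (h (a i) * y ^ i) \<ge> - dd p" using ai y_nz unfolding val_ideal_def by simp
          then show ?thesis using tval[OF Q(1) _ ai, of i] Q(2) False by simp
        qed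
      qed simp
    qed
  next
    assume a: "\<forall>i<m. a i \<in> component_space dd i"
    show "?z \<in> riemann_roch_space c D" unfolding riemann_roch_space_iff
    proof (intro allI impI val_ideal_sum[OF discrete])
      fix Q i assume Q: "place c Q" and i: "i \<in> {..<m}"
      show "h (a i) * y ^ i \<in> val_ideal Q (- Poly_Mapping.lookup D Q)"
      proof (cases "a i = 0")
        case ai: False
        have w: "int m * place_val (below Q) (a i) + (int i * place_val (below Q) (to_fract f) + dd (below Q)) \<ge> 0"
          using a i ai place_below[OF Q] unfolding component_space_def val_ideal_div_iff by blast
        show ?thesis
        proof (cases "dd (below Q) = 0")
          case True
          obtain e where e: "e > 0" "\<And>a i. a \<noteq> 0 \<Longrightarrow> int m * place_val Q (h a * y ^ i)
            = e * (int m * place_val (below Q) a + int i * place_val (below Q) (to_fract f))"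
            by (rule place_val_monomial[OF Q]) blast
          have "int m * place_val Q (h (a i) * y ^ i) \<ge> 0" using e(2)[OF ai, of i] e(1) w True by simp
          then have "place_val Q (h (a i) * y ^ i) \<ge> 0" using m_pos by (simp add: zero_le_mult_iff)
          then show ?thesis using D[OF Q] True unfolding val_ideal_def by simp
        next
          case False
          show ?thesis using tval[OF Q False ai, of i] w D[OF Q] unfolding val_ideal_def by simp
        qed
      qed (simp add: val_ideal_def)
    qed
  qed
qed

text \<open>The component map is a bijection with a product of rational Riemann-Roch spaces, and
  logarithms of cardinalities turn the product into a sum. A space of negative degree contributes 0
  through \<open>nat\<close>.\<close>

theorem ell_eq:
  assumes char: "\<not> CHAR('a) dvd m"
    and D: "\<And>Q. place c Q \<Longrightarrow> Poly_Mapping.lookup D Q = dd (below Q)"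
    and dd: "\<And>p. dd p \<noteq> 0 \<Longrightarrow> Rings.coprime (place_val p (to_fract f)) (int m)
       \<and> (\<exists>w. w \<noteq> 0 \<and> place_val p w = 1 \<and> has_height (h w) 1) \<and> (\<exists>Q. place c Q \<and> below Q = p)"
    and Z: "\<And>p. place const_fract p \<Longrightarrow> p \<noteq> place_inf \<Longrightarrow> p \<notin> place_at ` Z \<Longrightarrow> place_val p (to_fract f) = 0 \<and> dd p = 0"
  shows "finite (riemann_roch_space c D)"
    and "ell c D = (\<Sum>i<m. nat ((int i * place_val place_inf (to_fract f) + dd place_inf) div int m
      + (\<Sum>a\<in>Z. (int i * place_val (place_at a) (to_fract f) + dd (place_at a)) div int m) + 1))"
proof -
  let ?n = "\<lambda>i. nat ((int i * place_val place_inf (to_fract f) + dd place_inf) div int m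
      + (\<Sum>a\<in>Z. (int i * place_val (place_at a) (to_fract f) + dd (place_at a)) div int m) + 1)"
  let ?C = "component_space dd"
  have C: "finite (?C i) \<and> card (?C i) = CARD('a) ^ ?n i" for i
    unfolding component_space_def
    using card_rational_riemann_roch[of Z "\<lambda>p. (int i * place_val p (to_fract f) + dd p) div int m"] Z by auto
  let ?A = "Pi\<^sub>E {..<m} ?C"
  let ?s = "\<lambda>a. \<Sum>i<m. h (a i) * y ^ i"
  have finA: "finite ?A" using C by (intro finite_PiE) auto
  have "bij_betw ?s ?A (riemann_roch_space c D)" unfolding bij_betw_def
  proof
    show "inj_on ?s ?A"
    proof
      fix a a' assume a: "a \<in> ?A" "a' \<in> ?A" "?s a = ?s a'"
      then show "a = a'" using components_unique[of a a'] by (intro PiE_ext[OF a(1,2)]) auto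
    qed
    show "?s ` ?A = riemann_roch_space c D"
    proof
      show "?s ` ?A \<subseteq> riemann_roch_space c D"
        using riemann_roch_space_components[OF char D dd] by auto
      show "riemann_roch_space c D \<subseteq> ?s ` ?A"
      proof
        fix z assume z: "z \<in> riemann_roch_space c D"
        obtain a where a: "z = ?s a" using kummer_span by blast
        then have "\<forall>i<m. a i \<in> ?C i" using z riemann_roch_space_components[OF char D dd] by auto
        moreover have "z = ?s (restrict a {..<m})" unfolding a by simp
        ultimately show "z \<in> ?s ` ?A" by (intro image_eqI[where x = "restrict a {..<m}"]) auto
      qed
    qed
  qed
  then have fin: "finite (riemann_roch_space c D)" and card: "card (riemann_roch_space c D) = card ?A"
    using finA by (simp_all add: bij_betw_finite bij_betw_same_card)
  show "finite (riemann_roch_space c D)" by (rule fin)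
  have "CARD('a) ^ ell c D = (\<Prod>i<m. CARD('a) ^ ?n i)"
    using card_riemann_roch_space[OF fin] card C by (simp add: card_PiE)
  also have "\<dots> = CARD('a) ^ (\<Sum>i<m. ?n i)" by (simp add: power_sum)
  finally show "ell c D = (\<Sum>i<m. ?n i)" using card_constants_gt_1[where 'k = 'a] by simp
qed

end

section \<open>Combinatorics of the tuple \<open>\<alpha>\<close>\<close>

lemma exists_sorting_permutation:
  fixes a :: "nat \<Rightarrow> nat"
  shows "\<exists>\<alpha> \<sigma>. \<sigma> permutes {1..n} \<and> mono_on {1..n} \<alpha> \<and> (\<forall>k\<in>{1..n}. a k = \<alpha> (\<sigma> k))"
proof -
  define xs where "xs = map (\<lambda>i. a (Suc i)) [0..<n]"
  define ys where "ys = sort xs"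
  have len: "length xs = n" "length ys = n" by (simp_all add: xs_def ys_def)
  have "mset xs = mset ys" by (simp add: ys_def)
  then obtain \<pi> where pi: "\<pi> permutes {..<n}" "permute_list \<pi> ys = xs"
    using mset_eq_permutation len by metis
  have nth: "a (Suc i) = ys ! \<pi> i" if "i < n" for i
    using permute_list_nth[of \<pi> ys i] pi len that by (simp add: xs_def)
  \<comment> \<open>The permutation of list positions, which start at 0, conjugated by the shift to
    indices starting at 1 and extended by the identity.\<close>
  define \<sigma> where "\<sigma> k = (if k \<in> {1..n} then Suc (\<pi> (k - 1)) else k)" for k
  have "bij_betw (\<lambda>k. k - 1) {1..n} {..<n}"
    by (rule bij_betw_byWitness[where f' = Suc]) auto
  moreover have "bij_betw \<pi> {..<n} {..<n}" by (rule permutes_imp_bij[OF pi(1)])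
  moreover have "bij_betw Suc {..<n} {1..n}"
    by (rule bij_betw_byWitness[where f' = "\<lambda>k. k - 1"]) auto
  ultimately have "bij_betw (Suc \<circ> (\<pi> \<circ> (\<lambda>k. k - 1))) {1..n} {1..n}" by (blast intro: bij_betw_trans)
  moreover have "bij_betw (Suc \<circ> (\<pi> \<circ> (\<lambda>k. k - 1))) {1..n} {1..n} \<longleftrightarrow> bij_betw \<sigma> {1..n} {1..n}"
    by (rule bij_betw_cong) (simp add: \<sigma>_def)
  ultimately have "\<sigma> permutes {1..n}" by (intro bij_imp_permutes) (auto simp: \<sigma>_def)
  moreover have "mono_on {1..n} (\<lambda>k. ys ! (k - 1))"
    by (rule mono_onI) (auto simp: ys_def len(1) intro!: sorted_nth_mono)
  moreover have "\<forall>k\<in>{1..n}. a k = ys ! (\<sigma> k - 1)"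
  proof
    fix k assume k: "k \<in> {1..n}"
    then have "k - 1 < n" "Suc (k - 1) = k" by auto
    then show "a k = ys ! (\<sigma> k - 1)" using nth[of "k - 1"] k by (simp add: \<sigma>_def)
  qed
  ultimately show ?thesis by (intro exI[of _ "\<lambda>k. ys ! (k - 1)"] exI[of _ \<sigma>]) auto
qed

text \<open>Adding \<open>i\<close> carries past a multiple of \<open>m\<close> exactly when the
  remainder of \<open>d\<close> is at least \<open>m - i\<close>.\<close>

lemma add_div_eq_of_less:
  fixes d :: int and i m :: nat
  assumes "0 < i" "i < m"
  shows "(int i + d) div int m = d div int m + (if m - i \<le> nat (d mod int m) then 1 else 0)"
proof -
  have m: "int m > 0" using assms by simp
  have r: "0 \<le> d mod int m" "d mod int m < int m" using m by simp_all
  have "int i + d = (int i + d mod int m) + int m * (d div int m)" by simp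
  then have "(int i + d) div int m = ((int i + d mod int m) + int m * (d div int m)) div int m" by (rule arg_cong)
  also have "\<dots> = d div int m + (int i + d mod int m) div int m" using m by (intro div_mult_self2) simp
  also have "(int i + d mod int m) div int m = (if m - i \<le> nat (d mod int m) then 1 else 0)"
  proof (cases "m - i \<le> nat (d mod int m)")
    case True
    then have "int m \<le> int i + d mod int m" using assms r by linarith
    then have "(int i + d mod int m) div int m = (int i + d mod int m - int m) div int m + 1"
      using m by (simp add: div_pos_geq)
    also have "(int i + d mod int m - int m) div int m = 0"
      using r assms True by (intro div_pos_pos_trivial) linarith+
    finally show ?thesis using True by simp
  next
    case False
    then have "int i + d mod int m < int m" using assms r by linarith
    then show ?thesis using False r by (simp add: div_pos_pos_trivial)
  qed
  finally show ?thesis .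
qed

text \<open>Double counting of the pairs \<open>(k, t)\<close> with
  \<open>1 \<le> t \<le> a k\<close>.\<close>

lemma sum_eq_sum_card_ge:
  fixes a :: "nat \<Rightarrow> nat"
  assumes "finite S" "\<And>k. k \<in> S \<Longrightarrow> a k < m"
  shows "(\<Sum>k\<in>S. a k) = (\<Sum>t=1..m-1. card {k\<in>S. t \<le> a k})"
proof -
  have "a k = card {t\<in>{1..m-1}. t \<le> a k}" if "k \<in> S" for k
  proof -
    have "{t\<in>{1..m-1}. t \<le> a k} = {1..a k}" using assms(2)[OF that] by auto
    then show ?thesis by simp
  qed
  then have "(\<Sum>k\<in>S. a k) = (\<Sum>k\<in>S. card {t\<in>{1..m-1}. t \<le> a k})" by (rule sum.cong[OF refl])
  also have "\<dots> = (\<Sum>t\<in>{1..m-1}. card {k\<in>S. t \<le> a k})"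
    by (rule sum_multicount_gen[symmetric]) (use assms(1) in auto)
  finally show ?thesis by simp
qed

lemma card_ge_Suc:
  fixes a :: "nat \<Rightarrow> nat"
  assumes "finite S"
  shows "card {k\<in>S. t \<le> a k} = card {k\<in>S. a k = t} + card {k\<in>S. Suc t \<le> a k}"
proof -
  have "{k\<in>S. t \<le> a k} = {k\<in>S. a k = t} \<union> {k\<in>S. Suc t \<le> a k}" by auto
  then show ?thesis using assms by (simp add: card_Un_disjoint disjoint_iff)
qed

lemma card_permuted_filter:
  assumes \<sigma>: "\<sigma> permutes S" and a: "\<And>k. k \<in> S \<Longrightarrow> a k = \<alpha> (\<sigma> k)"
  shows "card {k\<in>S. t \<le> \<alpha> k} = card {k\<in>S. t \<le> a k}"
proof -
  have "{k\<in>S. t \<le> \<alpha> k} = \<sigma> ` {k\<in>S. t \<le> a k}"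
  proof
    show "{k\<in>S. t \<le> \<alpha> k} \<subseteq> \<sigma> ` {k\<in>S. t \<le> a k}"
    proof
      fix x assume x: "x \<in> {k\<in>S. t \<le> \<alpha> k}"
      then obtain k where k: "k \<in> S" "x = \<sigma> k" using permutes_image[OF \<sigma>] by blast
      then show "x \<in> \<sigma> ` {k\<in>S. t \<le> a k}" using x a[OF k(1)] by simp
    qed
    show "\<sigma> ` {k\<in>S. t \<le> a k} \<subseteq> {k\<in>S. t \<le> \<alpha> k}"
      using a permutes_in_image[OF \<sigma>] by auto
  qed
  moreover have "inj_on \<sigma> {k\<in>S. t \<le> a k}" by (rule inj_on_subset[OF permutes_inj[OF \<sigma>]]) simp
  ultimately show ?thesis by (simp add: card_image)
qed

text \<open>The prescribed multiplicities are consecutive differences of the tail counts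
  \<open>\<beta> t + 1\<close>. The top value has nothing above it, which starts a downward
  induction; the multiplicity of 0 is what remains of \<open>n\<close>.\<close>

lemma alpha_tuple_iff_card_ge:
  assumes m: "m \<ge> 2"
  shows "alpha_tuple m n \<beta> \<alpha> \<longleftrightarrow> mono_on {1..n} \<alpha> \<and> \<alpha> ` {1..n} \<subseteq> {0..m - 1} \<and>
    (\<forall>t\<in>{1..m-1}. int (card {k\<in>{1..n}. t \<le> \<alpha> k}) = \<beta> t + 1)"
proof -
  define N where "N t = card {k\<in>{1..n}. t \<le> \<alpha> k}" for t
  define C where "C t = card {k\<in>{1..n}. \<alpha> k = t}" for t
  have NC: "N t = C t + N (Suc t)" for t unfolding N_def C_def by (rule card_ge_Suc) simp
  have "{k\<in>{1..n}. 0 \<le> \<alpha> k} = {1..n}" by auto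
  then have N0: "N 0 = n" unfolding N_def by simp
  have "int (C 0) = int n - 1 - \<beta> 1 \<and> (\<forall>i\<in>{1..m - 2}. int (C i) = \<beta> i - \<beta> (i + 1)) \<and> int (C (m - 1)) = \<beta> (m - 1) + 1
    \<longleftrightarrow> (\<forall>t\<in>{1..m-1}. int (N t) = \<beta> t + 1)" if r: "\<alpha> ` {1..n} \<subseteq> {0..m - 1}"
  proof -
    have "{k\<in>{1..n}. m \<le> \<alpha> k} = {}" using r m by force
    then have "N (Suc (m - 1)) = 0" using m unfolding N_def by simp
    then have top: "N (m - 1) = C (m - 1)" using NC[of "m - 1"] by simp
    show ?thesis
    proof
      assume *: "int (C 0) = int n - 1 - \<beta> 1 \<and> (\<forall>i\<in>{1..m - 2}. int (C i) = \<beta> i - \<beta> (i + 1)) \<and> int (C (m - 1)) = \<beta> (m - 1) + 1"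
      have "int (N (m - 1 - s)) = \<beta> (m - 1 - s) + 1" if "s \<le> m - 2" for s
        using that
      proof (induction s)
        case 0 then show ?case using * top by simp
      next
        case (Suc s)
        then have IH: "int (N (m - 1 - s)) = \<beta> (m - 1 - s) + 1" by simp
        have e: "Suc (m - 1 - Suc s) = m - 1 - s" using Suc.prems by simp
        have "m - 1 - Suc s \<in> {1..m - 2}" using Suc.prems by auto
        then have "int (C (m - 1 - Suc s)) = \<beta> (m - 1 - Suc s) - \<beta> (m - 1 - s)" using * e by (metis Suc_eq_plus1)
        then show ?case using IH NC[of "m - 1 - Suc s"] unfolding e by simp
      qed
      then have "int (N t) = \<beta> t + 1" if "t \<in> {1..m-1}" for t
        using that by (metis (no_types, lifting) atLeastAtMost_iff diff_diff_cancel diff_le_mono2 diff_diff_left one_add_one)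
      then show "\<forall>t\<in>{1..m-1}. int (N t) = \<beta> t + 1" by blast
    next
      assume *: "\<forall>t\<in>{1..m-1}. int (N t) = \<beta> t + 1"
      have "int (C 0) = int n - 1 - \<beta> 1"
      proof -
        have "1 \<in> {1..m-1}" using m by auto
        then show ?thesis using * NC[of 0] N0 by force
      qed
      moreover have "int (C i) = \<beta> i - \<beta> (i + 1)" if "i \<in> {1..m - 2}" for i
      proof -
        have "i \<in> {1..m-1}" "i + 1 \<in> {1..m-1}" using that by auto
        then have "int (N i) = \<beta> i + 1" "int (N (i + 1)) = \<beta> (i + 1) + 1" using * by blast+
        then show ?thesis using NC[of i] by simp
      qed
      moreover have "int (C (m - 1)) = \<beta> (m - 1) + 1"
      proof -
        have "m - 1 \<in> {1..m-1}" using m by auto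
        then show ?thesis using * top by metis
      qed
      ultimately show "int (C 0) = int n - 1 - \<beta> 1 \<and> (\<forall>i\<in>{1..m - 2}. int (C i) = \<beta> i - \<beta> (i + 1)) \<and> int (C (m - 1)) = \<beta> (m - 1) + 1"
        by blast
    qed
  qed
  then show ?thesis unfolding alpha_tuple_def N_def C_def by blast
qed

lemma nonspecial_combinatorics:
  fixes d :: "nat \<Rightarrow> int" and \<beta> :: "nat \<Rightarrow> int"
  assumes m: "m \<ge> 2"
  shows "(\<Sum>k=1..n. d k) = (\<Sum>t=1..m-1. \<beta> t) - 1 \<and> (\<Sum>k=1..n. d k div int m) \<le> - 1 \<and>
      (\<forall>i\<in>{1..m-1}. (\<Sum>k=1..n. (int i + d k) div int m) \<le> \<beta> (m - i))
    \<longleftrightarrow> ((\<forall>i\<in>{1..m - 2}. \<beta> (i + 1) \<le> \<beta> i) \<and> \<beta> 1 \<le> int n - 1) \<and>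
      (\<exists>\<alpha> j \<sigma>. alpha_tuple m n \<beta> \<alpha> \<and> (\<Sum>k=1..n. j k) = - 1 \<and> \<sigma> permutes {1..n} \<and>
        (\<forall>k\<in>{1..n}. d k = int m * j k + int (\<alpha> (\<sigma> k))))" (is "?L \<longleftrightarrow> ?R")
proof -
  define a where "a k = nat (d k mod int m)" for k
  define J where "J = (\<Sum>k=1..n. d k div int m)"
  define N where "N t = card {k\<in>{1..n}. t \<le> a k}" for t
  have am: "a k < m" for k using m by (simp add: a_def nat_less_iff)
  have d: "d k = int m * (d k div int m) + int (a k)" for k using m by (simp add: a_def)
  have "(\<Sum>k=1..n. d k) = int m * J + int (\<Sum>k=1..n. a k)"
    unfolding J_def sum_distrib_left by (simp only: d[symmetric] of_nat_sum sum.distrib[symmetric])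
  also have "(\<Sum>k=1..n. a k) = (\<Sum>t=1..m-1. N t)" unfolding N_def by (rule sum_eq_sum_card_ge) (simp_all add: am)
  finally have sd: "(\<Sum>k=1..n. d k) = int m * J + (\<Sum>t=1..m-1. int (N t))" by simp
  have sdiv: "(\<Sum>k=1..n. (int i + d k) div int m) = J + int (N (m - i))" if i: "i \<in> {1..m-1}" for i
  proof -
    have "(\<Sum>k=1..n. (int i + d k) div int m) = (\<Sum>k=1..n. d k div int m + (if m - i \<le> a k then 1 else 0))"
      unfolding a_def by (intro sum.cong refl add_div_eq_of_less) (use i in auto)
    also have "\<dots> = J + (\<Sum>k=1..n. if m - i \<le> a k then 1 else 0)" unfolding J_def by (rule sum.distrib)
    also have "(\<Sum>k=1..n. if m - i \<le> a k then 1 else 0) = int (N (m - i))"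
      unfolding N_def by (subst sum.inter_filter[symmetric]) auto
    finally show ?thesis .
  qed
  \<comment> \<open>The exponent \<open>i\<close> of \<open>y\<close> meets the tail count at
    \<open>t = m - i\<close>; this passes between the two indexings.\<close>
  have refl_idx: "(\<forall>i\<in>{1..m-1}. \<Phi> (m - i)) \<longleftrightarrow> (\<forall>t\<in>{1..m-1}. \<Phi> t)" for \<Phi>
  proof
    assume *: "\<forall>i\<in>{1..m-1}. \<Phi> (m - i)"
    show "\<forall>t\<in>{1..m-1}. \<Phi> t"
    proof
      fix t assume t: "t \<in> {1..m-1}"
      then have "m - t \<in> {1..m-1}" "m - (m - t) = t" by auto
      then show "\<Phi> t" using * by metis
    qed
  next
    assume *: "\<forall>t\<in>{1..m-1}. \<Phi> t"
    show "\<forall>i\<in>{1..m-1}. \<Phi> (m - i)"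
    proof
      fix i assume "i \<in> {1..m-1}"
      then have "m - i \<in> {1..m-1}" by auto
      then show "\<Phi> (m - i)" using * by blast
    qed
  qed
  have L: "?L \<longleftrightarrow> J = - 1 \<and> (\<forall>t\<in>{1..m-1}. int (N t) = \<beta> t + 1)"
  proof
    assume ?L
    then have s: "int m * J + (\<Sum>t=1..m-1. int (N t)) = (\<Sum>t=1..m-1. \<beta> t) - 1" and J: "J \<le> - 1"
      and "\<forall>i\<in>{1..m-1}. J + int (N (m - i)) \<le> \<beta> (m - i)"
      using sd sdiv by (auto simp: J_def)
    then have le: "\<forall>t\<in>{1..m-1}. J + int (N t) \<le> \<beta> t" using refl_idx[of "\<lambda>t. J + int (N t) \<le> \<beta> t"] by blast
    \<comment> \<open>The degree condition makes the total slack of all inequalities equal to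
      \<open>1 + J\<close>. It is nonnegative and \<open>J \<le> - 1\<close>, so
      \<open>J = - 1\<close> and every single slack vanishes.\<close>
    have "(\<Sum>t=1..m-1. \<beta> t - (J + int (N t))) = (\<Sum>t=1..m-1. \<beta> t) - (\<Sum>t=1..m-1. int (N t)) - int (m - 1) * J"
      by (simp add: sum_subtractf sum.distrib)
    also have "\<dots> = 1 + J" using s m by (simp add: of_nat_diff algebra_simps)
    finally have e: "(\<Sum>t=1..m-1. \<beta> t - (J + int (N t))) = 1 + J" .
    moreover have nn: "(\<Sum>t=1..m-1. \<beta> t - (J + int (N t))) \<ge> 0" by (rule sum_nonneg) (use le in auto)
    ultimately have J1: "J = - 1" using J by linarith
    then have "(\<Sum>t=1..m-1. \<beta> t - (J + int (N t))) = 0" using e by simp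
    then have "\<forall>t\<in>{1..m-1}. \<beta> t - (J + int (N t)) = 0"
      using sum_nonneg_eq_0_iff[of "{1..m-1}" "\<lambda>t. \<beta> t - (J + int (N t))"] le by simp
    then show "J = - 1 \<and> (\<forall>t\<in>{1..m-1}. int (N t) = \<beta> t + 1)" using J1 by force
  next
    assume *: "J = - 1 \<and> (\<forall>t\<in>{1..m-1}. int (N t) = \<beta> t + 1)"
    then have "(\<Sum>t=1..m-1. int (N t)) = (\<Sum>t=1..m-1. \<beta> t) + int (m - 1)" by (simp add: sum.distrib)
    then have "(\<Sum>k=1..n. d k) = (\<Sum>t=1..m-1. \<beta> t) - 1" using sd * m by (simp add: of_nat_diff)
    moreover have "\<forall>i\<in>{1..m-1}. J + int (N (m - i)) \<le> \<beta> (m - i)"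
      using * refl_idx[of "\<lambda>t. J + int (N t) \<le> \<beta> t"] by auto
    ultimately show ?L using * sdiv by (auto simp: J_def)
  qed
  show ?thesis unfolding L
  proof
    assume *: "J = - 1 \<and> (\<forall>t\<in>{1..m-1}. int (N t) = \<beta> t + 1)"
    obtain \<alpha> \<sigma> where \<alpha>: "\<sigma> permutes {1..n}" "mono_on {1..n} \<alpha>" "\<forall>k\<in>{1..n}. a k = \<alpha> (\<sigma> k)"
      using exists_sorting_permutation[of n a] by blast
    have im: "\<sigma> ` {1..n} = {1..n}" using permutes_image[OF \<alpha>(1)] .
    have "\<alpha> ` {1..n} \<subseteq> {0..m-1}"
    proof
      fix x assume "x \<in> \<alpha> ` {1..n}"
      then obtain k where "k \<in> {1..n}" "x = \<alpha> (\<sigma> k)" using im by (metis (no_types, lifting) imageE)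
      then have "x < m" using \<alpha>(3) am[of k] by simp
      then show "x \<in> {0..m-1}" by simp
    qed
    moreover have "card {k\<in>{1..n}. t \<le> \<alpha> k} = N t" for t
      unfolding N_def by (rule card_permuted_filter[OF \<alpha>(1)]) (use \<alpha>(3) in auto)
    ultimately have "alpha_tuple m n \<beta> \<alpha>" unfolding alpha_tuple_iff_card_ge[OF m] using \<alpha>(2) * by simp
    moreover have "\<forall>k\<in>{1..n}. d k = int m * (d k div int m) + int (\<alpha> (\<sigma> k))" using \<alpha>(3) d by metis
    \<comment> \<open>The monotonicity of \<open>\<beta>\<close> is that of the tail counts, and the
      bound on \<open>\<beta> 1\<close> says that no count exceeds \<open>n\<close>.\<close>
    moreover have "\<beta> (i + 1) \<le> \<beta> i" if "i \<in> {1..m - 2}" for i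
    proof -
      have "N (i + 1) \<le> N i" unfolding N_def by (intro card_mono) auto
      moreover have "i \<in> {1..m-1}" "i + 1 \<in> {1..m-1}" using that by auto
      then have "int (N i) = \<beta> i + 1" "int (N (i + 1)) = \<beta> (i + 1) + 1" using * by blast+
      ultimately show ?thesis by simp
    qed
    moreover have "\<beta> 1 \<le> int n - 1"
    proof -
      have "N 1 \<le> card {1..n}" unfolding N_def by (intro card_mono) auto
      moreover have "1 \<in> {1..m-1}" using m by auto
      then have "int (N 1) = \<beta> 1 + 1" using * by blast
      ultimately show ?thesis by simp
    qed
    ultimately show ?R using * \<alpha>(1) unfolding J_def
      by (intro conjI ballI exI[of _ \<alpha>] exI[of _ "\<lambda>k. d k div int m"] exI[of _ \<sigma>]) auto
  next
    assume ?R
    then obtain \<alpha> j \<sigma> where \<alpha>: "alpha_tuple m n \<beta> \<alpha>" "(\<Sum>k=1..n. j k) = - 1" "\<sigma> permutes {1..n}"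
      "\<And>k. k \<in> {1..n} \<Longrightarrow> d k = int m * j k + int (\<alpha> (\<sigma> k))" by blast
    have im: "\<sigma> ` {1..n} = {1..n}" using permutes_image[OF \<alpha>(3)] .
    have r: "\<alpha> ` {1..n} \<subseteq> {0..m-1}" and N\<alpha>: "\<forall>t\<in>{1..m-1}. int (card {k\<in>{1..n}. t \<le> \<alpha> k}) = \<beta> t + 1"
      using \<alpha>(1) unfolding alpha_tuple_iff_card_ge[OF m] by auto
    have dk: "d k div int m = j k \<and> a k = \<alpha> (\<sigma> k)" if k: "k \<in> {1..n}" for k
    proof -
      have "\<sigma> k \<in> {1..n}" using im k by blast
      then have "\<alpha> (\<sigma> k) < m" using r m by fastforce
      then show ?thesis using \<alpha>(4)[OF k] by (simp add: a_def)
    qed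
    have "J = - 1" unfolding J_def using dk \<alpha>(2) by simp
    moreover have "N t = card {k\<in>{1..n}. t \<le> \<alpha> k}" for t
      unfolding N_def by (rule card_permuted_filter[OF \<alpha>(3), symmetric]) (use dk in auto)
    ultimately show "J = - 1 \<and> (\<forall>t\<in>{1..m-1}. int (N t) = \<beta> t + 1)" using N\<alpha> by simp
  qed
qed

section \<open>The genus of a split Kummer extension\<close>

lemma place_val_split_poly:
  fixes b :: "'k::{field,finite}"
  assumes p: "place const_fract p" and b: "b \<noteq> 0"
  shows "place_val p (to_fract (Polynomial.smult b (\<Prod>a\<in>#A. [:- a, 1:]))) = (\<Sum>a\<in>#A. place_val p (lin a))"
proof (induction A)
  case empty
  have "to_fract [:b:] = const_fract b" by (simp add: const_fract_def)
  then show ?case using place_val_const[OF discrete_rational[OF p] field_hom_const_fract b] by simp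
next
  case (add x A)
  note d = discrete_rational[OF p]
  have "Polynomial.smult b (\<Prod>a\<in>#add_mset x A. [:- a, 1:]) = [:- x, 1:] * Polynomial.smult b (\<Prod>a\<in>#A. [:- a, 1:])"
    by (simp only: image_mset_add_mset prod_mset.add_mset mult_smult_right)
  then have "to_fract (Polynomial.smult b (\<Prod>a\<in>#add_mset x A. [:- a, 1:]))
      = lin x * to_fract (Polynomial.smult b (\<Prod>a\<in>#A. [:- a, 1:]))"
    by (simp only: to_fract_mult)
  moreover have "to_fract (Polynomial.smult b (\<Prod>a\<in>#A. [:- a, 1:])) \<noteq> 0"
    using b by (auto simp: prod_mset_zero_iff)
  ultimately show ?case using add.IH by (simp add: place_val_mult[OF d])
qed

text \<open>As \<open>f\<close> splits, its divisor is assembled from those of the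
  \<open>x - a\<close>, each a simple zero at a rational point and a simple pole at
  infinity.\<close>

lemma split_poly_divisor:
  fixes f :: "'k::{field,finite} poly"
  assumes f0: "f \<noteq> 0" and A: "f = Polynomial.smult (lead_coeff f) (\<Prod>a\<in>#A. [:- a, 1:])"
  defines "Z \<equiv> {a. poly f a = 0}"
  shows "\<And>p. place const_fract p \<Longrightarrow> p \<noteq> place_inf \<Longrightarrow> p \<notin> place_at ` Z \<Longrightarrow> place_val p (to_fract f) = 0"
    and "place_val place_inf (to_fract f) + (\<Sum>a\<in>Z. place_val (place_at a) (to_fract f)) = 0"
    and "\<And>a. a \<in> Z \<Longrightarrow> place_val (place_at a) (to_fract f) > 0"
proof -
  have v: "place_val p (to_fract f) = (\<Sum>a\<in>#A. place_val p (lin a))" if p: "place const_fract p" for p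
    using place_val_split_poly[OF p, of "lead_coeff f" A] f0 unfolding A[symmetric] by simp
  have AZ: "a \<in> Z" if "a \<in># A" for a
  proof -
    have "[:- a, 1:] dvd (\<Prod>a\<in>#A. [:- a, 1:])" using that by (intro dvd_prod_mset) auto
    then have "[:- a, 1:] dvd f" by (subst A) (rule dvd_smult)
    then show ?thesis unfolding Z_def by (simp add: poly_eq_0_iff_dvd)
  qed
  show "place_val p (to_fract f) = 0" if p: "place const_fract p" "p \<noteq> place_inf" "p \<notin> place_at ` Z" for p
    unfolding v[OF p(1)]
  proof (rule sum_mset.neutral, rule ballI)
    fix x assume "x \<in># image_mset (\<lambda>a. place_val p (lin a)) A"
    then obtain a where a: "a \<in># A" "x = place_val p (lin a)" by auto
    have "p \<noteq> place_at a" using AZ[OF a(1)] p(3) by blast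
    then show "x = 0" using a(2) p(2) place_val_lin[OF p(1), of a] by simp
  qed
  have at: "place_val (place_at b) (to_fract f) = (\<Sum>a\<in>#A. if a = b then 1 else 0)" for b
  proof -
    have "(\<lambda>a. place_val (place_at b) (lin a)) = (\<lambda>a. if a = b then 1 else 0)"
    proof
      fix a show "place_val (place_at b) (lin a) = (if a = b then 1 else 0)"
        using place_val_lin[OF place_at(1)[of b], of a] place_at_neq_inf[of b] inj_eq[OF inj_place_at, of b a] by auto
    qed
    then show ?thesis using v[OF place_at(1)[of b]] by simp
  qed
  have inf: "place_val place_inf (to_fract f) = (\<Sum>a\<in>#A. - 1)"
    unfolding v[OF place_inf(1)] by (simp add: place_val_lin[OF place_inf(1)])
  have "(\<Sum>a\<in>#B. - 1) + (\<Sum>b\<in>Z. (\<Sum>a\<in>#B. if a = b then 1 else 0)) = (0::int)" if "set_mset B \<subseteq> Z" for B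
    using that
  proof (induction B)
    case (add x B)
    have "(\<Sum>b\<in>Z. (\<Sum>a\<in>#add_mset x B. if a = b then 1 else 0))
        = (\<Sum>b\<in>Z. (if x = b then 1 else 0)) + (\<Sum>b\<in>Z. (\<Sum>a\<in>#B. if a = b then 1 else (0::int)))"
      by (simp add: sum.distrib)
    also have "(\<Sum>b\<in>Z. (if x = b then 1 else 0)) = (1::int)" using add.prems by simp
    finally show ?case using add by simp
  qed simp
  from this[of A] show "place_val place_inf (to_fract f) + (\<Sum>a\<in>Z. place_val (place_at a) (to_fract f)) = 0"
    unfolding inf at using AZ by blast
  show "place_val (place_at a) (to_fract f) > 0" if "a \<in> Z" for a
  proof -
    have "order a f \<noteq> 0" using that f0 order_root[of f a] unfolding Z_def by simp
    then show ?thesis using place_val_at(2)[OF place_at f0, of a] by simp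
  qed
qed

section \<open>Rational functions with a single pole and controlled height\<close>

definition frac_height :: "'k::field poly fract \<Rightarrow> nat \<Rightarrow> bool" where
  "frac_height w N \<longleftrightarrow> (\<exists>a b. b \<noteq> 0 \<and> to_fract b * w = to_fract a \<and> Polynomial.degree a \<le> N \<and> Polynomial.degree b \<le> N)"

lemma frac_height_mult:
  assumes "frac_height w N" "frac_height w' N'" shows "frac_height (w * w') (N + N')"
proof -
  obtain a b a' b' where *: "b \<noteq> 0" "to_fract b * w = to_fract a" "Polynomial.degree a \<le> N" "Polynomial.degree b \<le> N"
    "b' \<noteq> 0" "to_fract b' * w' = to_fract a'" "Polynomial.degree a' \<le> N'" "Polynomial.degree b' \<le> N'"
    using assms unfolding frac_height_def by blast
  have "to_fract (b * b') * (w * w') = (to_fract b * w) * (to_fract b' * w')" by (simp add: mult_ac)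
  also have "\<dots> = to_fract (a * a')" using * by simp
  finally show ?thesis unfolding frac_height_def
    using * degree_mult_le[of a a'] degree_mult_le[of b b']
    by (intro exI[of _ "a * a'"] exI[of _ "b * b'"]) auto
qed

text \<open>A coordinate of the projective line with its only pole, a simple one, at
  \<open>p\<close>: \<open>x\<close> itself at infinity and \<open>1 / (x - a)\<close> at a finite
  point.\<close>

definition polar_parameter :: "'k::field poly fract set \<Rightarrow> 'k poly fract \<Rightarrow> bool" where
  "polar_parameter p t \<longleftrightarrow> t \<noteq> 0 \<and> place_val p t = - 1 \<and>
     (\<exists>n d. n \<noteq> 0 \<and> d \<noteq> 0 \<and> Polynomial.degree n \<le> 1 \<and> Polynomial.degree d \<le> 1 \<and> t = to_fract n / to_fract d) \<and>
     (\<forall>p'. place const_fract p' \<longrightarrow> p' \<noteq> p \<longrightarrow> t \<in> place_ring p')"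

lemma polar_parameter_exists:
  assumes "p = place_inf \<or> p \<in> range place_at"
  shows "\<exists>t. polar_parameter (p :: 'k::{field,finite} poly fract set) t"
  using assms
proof (elim disjE rangeE)
  assume p: "p = place_inf"
  have "place_val p var = - 1" unfolding p using place_val_inf[OF place_inf, of "[:0, 1:]"] by simp
  moreover have "(var :: 'k poly fract) = to_fract [:0, 1:] / to_fract 1" by simp
  ultimately have "polar_parameter p var" unfolding polar_parameter_def using p place_not_inf
    by (intro conjI exI[of _ "[:0, 1:]"] exI[of _ 1]) auto
  then show ?thesis by blast
next
  fix a assume p: "p = place_at a"
  have "place_val p (inverse (lin a)) = - 1" unfolding p
    using place_val_at(1)[OF place_at, of a] by (simp add: place_val_inverse[OF discrete_rational[OF place_at(1)]])
  moreover have "inverse (lin a) = to_fract 1 / to_fract [:- a, 1:]" by (simp add: divide_inverse)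
  moreover have "inverse (lin a) \<in> place_ring p'" if "place const_fract p'" "p' \<noteq> p" for p'
    using place_at_eq[OF that(1), of a] that(2) p in_place_iff[OF that(1), of "lin a"] by blast
  ultimately have "polar_parameter p (inverse (lin a))" unfolding polar_parameter_def
    by (intro conjI exI[of _ 1] exI[of _ "[:- a, 1:]"]) auto
  then show ?thesis by blast
qed

lemma polar_parameter_inverse:
  fixes p :: "'k::{field,finite} poly fract set"
  assumes "polar_parameter p t" "place const_fract p"
  shows "place_val p (inverse t) = 1" "frac_height (inverse t) 1"
proof -
  note d = discrete_rational[OF assms(2)]
  show "place_val p (inverse t) = 1" using assms(1) by (simp add: polar_parameter_def place_val_inverse[OF d])
  obtain n d where "n \<noteq> 0" "d \<noteq> 0" "Polynomial.degree n \<le> 1" "Polynomial.degree d \<le> 1" "t = to_fract n / to_fract d"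
    using assms(1) unfolding polar_parameter_def by blast
  then show "frac_height (inverse t) 1" unfolding frac_height_def
    by (intro exI[of _ d] exI[of _ n]) simp
qed

text \<open>The height bound equals the pole order \<open>j\<close>. This coincidence is what makes
  the bound on zero degrees sharp enough for Riemann's inequality.\<close>

lemma polar_parameter_power_diff:
  fixes p :: "'k::{field,finite} poly fract set"
  assumes t: "polar_parameter p t" and p: "place const_fract p" and ij: "i < j"
  shows "t ^ j - t ^ i \<noteq> 0" "place_val p (t ^ j - t ^ i) = - int j" "frac_height (t ^ j - t ^ i) j"
proof -
  note d = discrete_rational[OF p]
  have t0: "t \<noteq> 0" "place_val p t = - 1" using t unfolding polar_parameter_def by auto
  have "place_val p (t ^ j) < place_val p (- (t ^ i))"
    unfolding place_val_minus[OF d] place_val_power[OF d t0(1)] t0(2) using ij by simp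
  then have "t ^ j + (- (t ^ i)) \<noteq> 0" "place_val p (t ^ j + (- (t ^ i))) = place_val p (t ^ j)"
    using place_val_add_eq[OF d, of "t ^ j" "- (t ^ i)"] t0(1) by auto
  then show "t ^ j - t ^ i \<noteq> 0" "place_val p (t ^ j - t ^ i) = - int j"
    by (simp_all add: place_val_power[OF d t0(1)] t0(2))
  obtain n e where n: "n \<noteq> 0" "e \<noteq> 0" "Polynomial.degree n \<le> 1" "Polynomial.degree e \<le> 1" "t = to_fract n / to_fract e"
    using t unfolding polar_parameter_def by blast
  have te: "to_fract e * t = to_fract n" using n by simp
  have "to_fract (e ^ j) * t ^ i = to_fract (e ^ (j - i) * n ^ i)" if "i \<le> j" for i
  proof -
    have "to_fract (e ^ j) * t ^ i = to_fract e ^ (j - i) * (to_fract e * t) ^ i"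
      using that by (simp add: to_fract_power power_mult_distrib mult.assoc[symmetric] power_add[symmetric])
    then show ?thesis by (simp add: te to_fract_power)
  qed
  from this[of i] this[of j] have "to_fract (e ^ j) * (t ^ j - t ^ i) = to_fract (n ^ j - e ^ (j - i) * n ^ i)"
    using ij by (simp add: right_diff_distrib)
  moreover have "Polynomial.degree (g ^ l) \<le> l" if "Polynomial.degree g \<le> 1" for g :: "'k poly" and l
    using order_trans[OF degree_power_le mult_le_mono1[OF that]] by simp
  note pw = this[OF n(3)] this[OF n(4)]
  have "Polynomial.degree (e ^ (j - i) * n ^ i) \<le> j"
    using order_trans[OF degree_mult_le add_mono[OF pw(2)[of "j - i"] pw(1)[of i]]] ij by simp
  then have "Polynomial.degree (n ^ j - e ^ (j - i) * n ^ i) \<le> j" using pw(1)[of j] by (intro degree_diff_le)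
  ultimately show "frac_height (t ^ j - t ^ i) j" unfolding frac_height_def
    using n(2) pw(2)[of j] by (intro exI[of _ "n ^ j - e ^ (j - i) * n ^ i"] exI[of _ "e ^ j"]) auto
qed

section \<open>Riemann's inequality\<close>

context kummer_extension
begin

lemma has_height_frac: "frac_height w N \<Longrightarrow> has_height (h w) N"
proof -
  assume "frac_height w N"
  then obtain a b where *: "b \<noteq> 0" "to_fract b * w = to_fract a" "Polynomial.degree a \<le> N" "Polynomial.degree b \<le> N"
    unfolding frac_height_def by blast
  have "hp b * h w = hp a" using arg_cong[OF *(2), of h] by (simp add: h.hom_mult)
  then show ?thesis using * by (intro has_height_hom)
qed

text \<open>The residue field is finite, so among the powers of \<open>x\<close> two are congruent
  modulo \<open>Q\<close>.\<close>

lemma exists_zero_of_power_diff: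
  assumes Q: "place c Q" and x: "x \<in> place_ring Q"
  obtains i j :: nat where "i < j" "x ^ j - x ^ i \<in> Q"
proof -
  obtain V where V: "residue_reps Q V" "finite V"
    using residue_reps_exist[OF c_hom Q finite_residue[OF Q]] by blast
  have "\<exists>v. v \<in> V \<and> x ^ j - v \<in> Q" for j
    using V(1) place_ring_power[OF Q x, of j] unfolding residue_reps_def by blast
  then obtain v where v: "\<And>j. v j \<in> V \<and> x ^ j - v j \<in> Q" by metis
  have "\<not> inj_on v (UNIV :: nat set)"
  proof
    assume "inj_on v (UNIV :: nat set)"
    moreover have "v ` UNIV \<subseteq> V" using v by blast
    ultimately show False using V(2) by (metis finite_imageD finite_subset infinite_UNIV_nat)
  qed
  then obtain i j where ij: "i < j" "v i = v j" unfolding inj_on_def by (metis linorder_neqE_nat)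
  have "(x ^ j - v j) - (x ^ i - v i) \<in> Q" using v place_diff[OF Q] by blast
  then show ?thesis using that[OF ij(1)] ij(2) by simp
qed

text \<open>A product of powers of differences \<open>t ^ j - t ^ i\<close>, each chosen to vanish
  at one place of \<open>S\<close>. Products keep all the required properties, in particular that
  the height bound and the pole order at \<open>p1\<close> are the same \<open>N\<close>.\<close>

lemma exists_function_dominating:
  assumes p1: "place const_fract p1" and t: "polar_parameter p1 t"
    and S: "finite S" "\<And>Q. Q \<in> S \<Longrightarrow> place c Q \<and> below Q \<noteq> p1"
  shows "\<exists>w N. w \<noteq> 0 \<and> frac_height w N \<and> place_val p1 w = - int N \<and>
    (\<forall>p'. place const_fract p' \<longrightarrow> p' \<noteq> p1 \<longrightarrow> w \<in> place_ring p') \<and> (\<forall>Q\<in>S. place_val Q (h w) \<ge> int (n Q))"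
proof -
  define good where "good w N \<longleftrightarrow> w \<noteq> 0 \<and> frac_height w N \<and> place_val p1 w = - int N \<and>
    (\<forall>p'. place const_fract p' \<longrightarrow> p' \<noteq> p1 \<longrightarrow> w \<in> place_ring p')" for w N
  note d1 = discrete_rational[OF p1]
  have good1: "good 1 0"
    unfolding good_def frac_height_def using place_val_1[OF d1] place_ring_1
    by (auto intro!: exI[of _ 1])
  have good_mult: "good (w * w') (N + N')" if g: "good w N" "good w' N'" for w w' N N'
    unfolding good_def
  proof (intro conjI allI impI)
    show "w * w' \<noteq> 0" "frac_height (w * w') (N + N')" "place_val p1 (w * w') = - int (N + N')"
      using g frac_height_mult[of w N w' N'] unfolding good_def by (auto simp: place_val_mult[OF d1])
    fix p' assume p': "place const_fract p'" "p' \<noteq> p1"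
    then have "w \<in> place_ring p'" "w' \<in> place_ring p'" using g unfolding good_def by blast+
    then show "w * w' \<in> place_ring p'" by (rule place_ring_mult[OF p'(1)])
  qed
  have good_power: "good (w ^ l) (l * N)" if "good w N" for w N l
  proof (induction l)
    case 0 then show ?case using good1 by simp
  next
    case (Suc l) then show ?case using good_mult[OF that, of "w ^ l" "l * N"] by simp
  qed
  have nonneg: "place_val Q (h w) \<ge> 0" if g: "good w N" and Q: "Q \<in> S" for w N Q
  proof -
    have Q': "place c Q" "below Q \<noteq> p1" using S(2)[OF Q] by auto
    then have "h w \<in> place_ring Q" using g place_below[OF Q'(1)] place_ring_below[OF Q'(1)] unfolding good_def by blast
    then show ?thesis using g place_val_nonneg[OF discrete[OF Q'(1)], of "h w"] unfolding good_def by simp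
  qed
  have "\<exists>w N. good w N \<and> (\<forall>Q\<in>R. place_val Q (h w) \<ge> int (n Q))" if "R \<subseteq> S" for R
    using finite_subset[OF that S(1)] that
  proof (induction R)
    case empty then show ?case using good1 by blast
  next
    case (insert Q R)
    then obtain w N where w: "good w N" "\<And>Q. Q \<in> R \<Longrightarrow> place_val Q (h w) \<ge> int (n Q)" by blast
    have QS: "Q \<in> S" using insert.prems by blast
    have Q: "place c Q" "below Q \<noteq> p1" using S(2)[OF QS] by auto
    have "t \<in> place_ring (below Q)" using t place_below[OF Q(1)] Q(2) unfolding polar_parameter_def by blast
    then have "h t \<in> place_ring Q" unfolding place_ring_below[OF Q(1)] by blast
    then obtain i j where ij: "i < j" "h t ^ j - h t ^ i \<in> Q" by (rule exists_zero_of_power_diff[OF Q(1)])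
    let ?u = "t ^ j - t ^ i"
    have "t ^ j - t ^ i \<in> place_ring p'" if "place const_fract p'" "p' \<noteq> p1" for p'
      using t that unfolding polar_parameter_def by (intro place_ring_diff[OF that(1)] place_ring_power[OF that(1)]) auto
    then have gu: "good ?u j" unfolding good_def using polar_parameter_power_diff[OF t p1 ij(1)] by blast
    have "h ?u \<in> Q" using ij(2) by (simp add: h.hom_minus h.hom_power)
    moreover have hu0: "h ?u \<noteq> 0" using gu unfolding good_def by simp
    ultimately have uQ: "place_val Q (h ?u) \<ge> 1" using place_val_pos[OF discrete[OF Q(1)], of "h ?u"] by simp
    have val: "place_val Q' (h (?u ^ n Q * w)) = int (n Q) * place_val Q' (h ?u) + place_val Q' (h w)" if "Q' \<in> S" for Q'
    proof -
      have d': "discrete_place c Q'" using discrete S(2)[OF that] by blast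
      have "h w \<noteq> 0" using w(1) unfolding good_def by simp
      then have "place_val Q' (h ?u ^ n Q * h w) = int (n Q) * place_val Q' (h ?u) + place_val Q' (h w)"
        using hu0 place_val_mult[OF d', of "h ?u ^ n Q" "h w"] place_val_power[OF d' hu0, of "n Q"] by simp
      then show ?thesis by (simp only: h.hom_mult h.hom_power)
    qed
    have "place_val Q' (h (?u ^ n Q * w)) \<ge> int (n Q')" if "Q' \<in> insert Q R" for Q'
    proof -
      have Q'S: "Q' \<in> S" using that insert.prems by blast
      show ?thesis
      proof (cases "Q' = Q")
        case True
        have "int (n Q) * 1 \<le> int (n Q) * place_val Q (h ?u)" using uQ by (intro mult_left_mono) auto
        then show ?thesis using val[OF QS] nonneg[OF w(1) QS] True by simp
      next
        case False
        then have "place_val Q' (h w) \<ge> int (n Q')" using w(2) that by blast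
        moreover have "int (n Q) * place_val Q' (h ?u) \<ge> 0" using nonneg[OF gu Q'S] by simp
        ultimately show ?thesis using val[OF Q'S] by simp
      qed
    qed
    then show ?case using good_mult[OF good_power[OF gu] w(1)] by blast
  qed
  from this[of S] show ?thesis unfolding good_def by blast
qed

text \<open>\<open>G\<close> is dominated by \<open>G'\<close>, a multiple of \<open>Q1\<close> plus
  the zero divisor of \<open>w\<close>. Division by \<open>w\<close> embeds the space of a larger
  multiple of \<open>Q1\<close> into that of \<open>G'\<close>, whose degree the height of
  \<open>w\<close> keeps equally small. Monotonicity carries the bound from \<open>G'\<close> back
  to \<open>G\<close>.\<close>

theorem riemann_inequality:
  assumes Q1: "place c Q1" "place_degree c Q1 = 1"
    and ram: "\<And>z. z \<noteq> 0 \<Longrightarrow> place_val Q1 (h z) = int m * place_val (below Q1) z"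
    and uniq: "\<And>Q. place c Q \<Longrightarrow> below Q = below Q1 \<Longrightarrow> Q = Q1"
    and t: "polar_parameter (below Q1) t"
    and big: "\<And>M :: nat. M \<ge> M0 \<Longrightarrow> finite (riemann_roch_space c (Poly_Mapping.single Q1 (int (m * M)))) \<and>
       int (ell c (Poly_Mapping.single Q1 (int (m * M)))) = int (m * M) + 1 - g"
    and G: "is_divisor c G"
  shows "div_degree c G - int (ell c G) + 1 \<le> g"
proof -
  let ?S = "Poly_Mapping.keys G - {Q1}"
  have S: "finite ?S" "\<And>Q. Q \<in> ?S \<Longrightarrow> place c Q \<and> below Q \<noteq> below Q1"
    using G uniq unfolding is_divisor_def by auto
  have "\<exists>w N. w \<noteq> 0 \<and> frac_height w N \<and> place_val (below Q1) w = - int N \<and>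
    (\<forall>p'. place const_fract p' \<longrightarrow> p' \<noteq> below Q1 \<longrightarrow> w \<in> place_ring p') \<and>
    (\<forall>Q\<in>?S. place_val Q (h w) \<ge> int (nat (Poly_Mapping.lookup G Q)))"
    by (rule exists_function_dominating[OF place_below[OF Q1(1)] t S])
  then obtain w where "\<exists>N. w \<noteq> 0 \<and> frac_height w N \<and> place_val (below Q1) w = - int N \<and>
    (\<forall>p'. place const_fract p' \<longrightarrow> p' \<noteq> below Q1 \<longrightarrow> w \<in> place_ring p') \<and>
    (\<forall>Q\<in>?S. place_val Q (h w) \<ge> int (nat (Poly_Mapping.lookup G Q)))"
    ..
  then obtain N where W: "w \<noteq> 0 \<and> frac_height w N \<and> place_val (below Q1) w = - int N \<and>
    (\<forall>p'. place const_fract p' \<longrightarrow> p' \<noteq> below Q1 \<longrightarrow> w \<in> place_ring p') \<and>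
    (\<forall>Q\<in>?S. place_val Q (h w) \<ge> int (nat (Poly_Mapping.lookup G Q)))"
    ..
  then have w: "w \<noteq> 0" "frac_height w N" "place_val (below Q1) w = - int N"
    "\<And>p'. place const_fract p' \<Longrightarrow> p' \<noteq> below Q1 \<Longrightarrow> w \<in> place_ring p'"
    "\<And>Q. Q \<in> ?S \<Longrightarrow> place_val Q (h w) \<ge> int (nat (Poly_Mapping.lookup G Q))"
    by simp_all
  have hw0: "h w \<noteq> 0" using w(1) by simp
  define S' where "S' = {Q. place c Q \<and> place_val Q (h w) > 0}"
  have finS': "finite S'" unfolding S'_def by (rule finite_zeros[OF hw0])
  have v1: "place_val Q1 (h w) = - int (m * N)" using ram[OF w(1)] w(3) by simp
  then have Q1S': "Q1 \<notin> S'" unfolding S'_def by (auto simp: mult_less_0_iff)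
  have nn: "place_val Q (h w) \<ge> 0" if Q: "place c Q" "Q \<noteq> Q1" for Q
  proof -
    have "below Q \<noteq> below Q1" using uniq Q by blast
    then have "h w \<in> place_ring Q" using w(4) place_below[OF Q(1)] place_ring_below[OF Q(1)] by blast
    then show ?thesis using place_val_nonneg[OF discrete[OF Q(1)] hw0] by simp
  qed
  define M where "M = max M0 (nat (Poly_Mapping.lookup G Q1))"
  let ?D = "\<lambda>M. Poly_Mapping.single Q1 (int (m * M))"
  let ?W = "\<Sum>Q\<in>S'. Poly_Mapping.single Q (int (nat (place_val Q (h w))))"
  define G' where "G' = ?D M + ?W"
  have S'pl: "\<And>Q. Q \<in> S' \<Longrightarrow> place c Q" unfolding S'_def by blast
  have lW: "Poly_Mapping.lookup ?W Q = (if Q \<in> S' then place_val Q (h w) else 0)" for Q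
  proof -
    have "Poly_Mapping.lookup ?W Q = (\<Sum>R\<in>S'. if R = Q then int (nat (place_val R (h w))) else 0)"
      unfolding lookup_sum lookup_single when_def ..
    also have "\<dots> = (if Q \<in> S' then int (nat (place_val Q (h w))) else 0)" using finS' by simp
    also have "\<dots> = (if Q \<in> S' then place_val Q (h w) else 0)" unfolding S'_def by simp
    finally show ?thesis .
  qed
  have lG': "Poly_Mapping.lookup G' Q = (if Q = Q1 then int (m * M) else 0) + (if Q \<in> S' then place_val Q (h w) else 0)" for Q
    unfolding G'_def lookup_add lW by (simp add: lookup_single when_def)
  have "M * 1 \<le> m * M" using m_pos by simp
  then have mM: "int (m * M) \<ge> Poly_Mapping.lookup G Q1" unfolding M_def by linarith
  have le: "Poly_Mapping.lookup G Q \<le> Poly_Mapping.lookup G' Q" for Q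
  proof -
    consider "Q = Q1" | "Q \<noteq> Q1" "Q \<notin> Poly_Mapping.keys G" | "Q \<in> ?S" by blast
    then show ?thesis
    proof cases
      case 1 then show ?thesis using mM lG'[of Q] Q1S' by simp
    next
      case 2
      then have "Poly_Mapping.lookup G Q = 0" by (simp add: in_keys_iff)
      then show ?thesis using lG'[of Q] 2(1) unfolding S'_def by auto
    next
      case 3
      then have "place_val Q (h w) \<ge> Poly_Mapping.lookup G Q" using w(5)[OF 3] by linarith
      then show ?thesis using lG'[of Q] 3 S(2)[OF 3] unfolding S'_def by auto
    qed
  qed
  have keysG': "is_divisor c G'"
    unfolding is_divisor_def
  proof
    fix q assume "q \<in> Poly_Mapping.keys G'"
    then have "Poly_Mapping.lookup G' q \<noteq> 0" by (simp add: in_keys_iff)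
    then have "q = Q1 \<or> q \<in> S'" unfolding lG' by (auto split: if_splits)
    then show "place c q" using S'pl Q1(1) by blast
  qed
  have DG': "Poly_Mapping.lookup (?D M) Q \<le> Poly_Mapping.lookup G' Q" for Q
    unfolding lG' S'_def by (auto simp: lookup_single when_def)
  have isD: "is_divisor c (?D M)" unfolding is_divisor_def using Q1(1) by simp
  have finG': "finite (riemann_roch_space c G')"
    by (rule riemann_roch_space_mono(1)[OF DG' isD keysG']) (use big[of M] in \<open>simp add: M_def\<close>)
  have finG: "finite (riemann_roch_space c G)" by (rule riemann_roch_space_mono(3)[OF le G keysG' finG'])
  have mono: "int (ell c G') - div_degree c G' \<le> int (ell c G) - div_degree c G"
    by (rule riemann_roch_space_mono(2)[OF le G keysG' finG])
  \<comment> \<open>The pole of \<open>w\<close> at \<open>Q1\<close> has order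
    \<open>m * N\<close>, and the height bounds the degree of its zeros by the same number, so
    nothing is lost against the multiple \<open>m * (M + N)\<close> used next.\<close>
  have degG': "div_degree c G' \<le> int (m * M) + int (m * N)"
  proof -
    have "div_degree c G' = int (m * M) + div_degree c ?W"
      unfolding G'_def div_degree_add div_degree_single using Q1(2) by simp
    also have "div_degree c ?W = (\<Sum>Q\<in>S'. Poly_Mapping.lookup ?W Q * int (place_degree c Q))"
    proof (rule div_degree_superset[OF finS'], rule subsetI)
      fix q assume "q \<in> Poly_Mapping.keys ?W"
      then have "Poly_Mapping.lookup ?W q \<noteq> 0" by (rule in_keys_iff[THEN iffD1])
      then show "q \<in> S'" unfolding lW by (simp split: if_splits)
    qed
    also have "\<dots> = (\<Sum>Q\<in>S'. place_val Q (h w) * int (place_degree c Q))" unfolding lW by simp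
    also have "\<dots> \<le> int (m * N)"
      by (rule degree_zeros_le[OF hw0 has_height_frac[OF w(2)] finS']) (auto simp: S'_def)
    finally show ?thesis by (simp add: o_def)
  qed
  have "(\<lambda>z. z / h w) ` riemann_roch_space c (?D (M + N)) \<subseteq> riemann_roch_space c G'"
  proof
    fix x assume "x \<in> (\<lambda>z. z / h w) ` riemann_roch_space c (?D (M + N))"
    then obtain z where z: "z \<in> riemann_roch_space c (?D (M + N))" "x = z / h w" by blast
    show "x \<in> riemann_roch_space c G'" unfolding riemann_roch_space_iff
    proof (intro allI impI)
      fix Q assume Q: "place c Q"
      note d = discrete[OF Q]
      have "z \<in> val_ideal Q (- Poly_Mapping.lookup (?D (M + N)) Q)" using z(1) Q unfolding riemann_roch_space_iff by blast
      moreover have "inverse (h w) \<in> val_ideal Q (- place_val Q (h w))"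
        using hw0 by (simp add: val_ideal_def place_val_inverse[OF d])
      ultimately have "x \<in> val_ideal Q (- Poly_Mapping.lookup (?D (M + N)) Q + - place_val Q (h w))"
        unfolding z(2) divide_inverse by (rule val_ideal_mult[OF d])
      moreover have "- Poly_Mapping.lookup G' Q \<le> - Poly_Mapping.lookup (?D (M + N)) Q + - place_val Q (h w)"
      proof (cases "Q = Q1")
        case True
        have "int (m * (M + N)) = int (m * M) + int (m * N)" by (simp add: distrib_left)
        then show ?thesis using True lG'[of Q] Q1S' v1 by (simp add: lookup_single)
      next
        case False
        have "(if Q \<in> S' then place_val Q (h w) else 0) = place_val Q (h w)"
          using nn[OF Q False] Q unfolding S'_def by auto
        then show ?thesis using False lG'[of Q] by (simp add: lookup_single)
      qed
      ultimately show "x \<in> val_ideal Q (- Poly_Mapping.lookup G' Q)" by (rule val_ideal_mono[OF d, rotated])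
    qed
  qed
  moreover have "inj_on (\<lambda>z. z / h w) (riemann_roch_space c (?D (M + N)))" using hw0 by (simp add: inj_on_def)
  ultimately have "card (riemann_roch_space c (?D (M + N))) \<le> card (riemann_roch_space c G')"
    using finG' by (metis card_inj_on_le)
  moreover have bMN: "finite (riemann_roch_space c (?D (M + N)))"
    "int (ell c (?D (M + N))) = int (m * (M + N)) + 1 - g"
    using big[of "M + N"] unfolding M_def by auto
  ultimately have "CARD('k) ^ ell c (?D (M + N)) \<le> CARD('k) ^ ell c G'"
    using card_riemann_roch_space[OF finG'] card_riemann_roch_space[OF bMN(1)] by simp
  then have "ell c (?D (M + N)) \<le> ell c G'" using card_constants_gt_1[where 'k = 'k] by simp
  then have "int (m * (M + N)) + 1 - g \<le> int (ell c G')" using bMN(2) by simp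
  moreover have "int (m * (M + N)) = int (m * M) + int (m * N)" by (simp add: distrib_left)
  ultimately show ?thesis using degG' mono by linarith
qed

end

section \<open>Floors, ceilings and coefficients of formal sums\<close>

lemma ceiling_div_eq:
  assumes "(0::nat) < m"
  shows "\<lceil>real_of_int a / real m\<rceil> = - ((- a) div int m)"
proof -
  have "real_of_int a / real m = - (real_of_int (- a) / real_of_int (int m))" by simp
  then have "\<lceil>real_of_int a / real m\<rceil> = - \<lfloor>real_of_int (- a) / real_of_int (int m)\<rfloor>"
    by (simp only: ceiling_minus)
  then show ?thesis by (simp only: floor_divide_of_int_eq)
qed

text \<open>Replacing \<open>i\<close> by \<open>m - i\<close> turns the ceilings into
  \<open>lam k\<close> minus floors, and the \<open>lam k\<close> add up to 0.\<close>

lemma kummer_beta_eq: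
  assumes lam: "(\<Sum>k=1..r. lam k) = 0" and i: "i \<in> {1..m - 1}"
  shows "kummer_beta m r lam (m - i) = - (\<Sum>k=1..r. (int i * lam k) div int m) - 1"
proof -
  have m: "0 < m" using i by auto
  have "\<lceil>real_of_int (int (m - i) * lam k) / real m\<rceil> = lam k - (int i * lam k) div int m" for k
  proof -
    have "- (int (m - i) * lam k) = int i * lam k + int m * (- lam k)"
    proof -
      have "int (m - i) = int m - int i" using i by (intro of_nat_diff) auto
      then show ?thesis by (simp add: algebra_simps)
    qed
    then have "- (int (m - i) * lam k) div int m = (int i * lam k + int m * (- lam k)) div int m" by (rule arg_cong)
    also have "\<dots> = - lam k + (int i * lam k) div int m" using m by (intro div_mult_self2) simp
    finally have "- (int (m - i) * lam k) div int m = - lam k + (int i * lam k) div int m" .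
    then show ?thesis unfolding ceiling_div_eq[OF m] by (simp only: minus_add minus_minus diff_conv_add_uminus)
  qed
  then show ?thesis unfolding kummer_beta_def using lam by (simp add: sum_subtractf)
qed

text \<open>With \<open>l = 1 + m * q\<close> both sides contain \<open>i * q\<close> whole
  multiples of \<open>m\<close>, and \<open>i\<close> alone contributes none. This splits the
  contribution of \<open>f\<close> from that of the divisor.\<close>

lemma div_add_cong_one:
  fixes l d :: int
  assumes l: "[l = 1] (mod int m)" and i: "i < m"
  shows "(int i * l + d) div int m = (int i * l) div int m + (int i + d) div int m"
proof -
  have m: "int m > 0" using i by simp
  from l have "int m dvd l - 1" by (simp add: cong_iff_dvd_diff)
  then obtain q where q: "l = 1 + int m * q" by (metis add.commute diff_add_cancel dvdE)
  have "int i * l + d = (int i + d) + int m * (int i * q)" unfolding q by (simp add: algebra_simps)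
  then have 1: "(int i * l + d) div int m = (int i + d + int m * (int i * q)) div int m" by (rule arg_cong)
  have "int i * l = int i + int m * (int i * q)" unfolding q by (simp add: algebra_simps)
  then have 2: "(int i * l) div int m = (int i + int m * (int i * q)) div int m" by (rule arg_cong)
  have "(int i + d + int m * (int i * q)) div int m = int i * q + (int i + d) div int m"
    "(int i + int m * (int i * q)) div int m = int i * q + int i div int m"
    using m by (intro div_mult_self2; simp)+
  moreover have "int i div int m = 0" using i by (simp add: div_pos_pos_trivial)
  ultimately show ?thesis using 1 2 by simp
qed

lemma lookup_sum_frag_of:
  assumes "inj_on Q S" "finite S" "i \<in> S"
  shows "Poly_Mapping.lookup (\<Sum>k\<in>S. frag_cmul (j k) (frag_of (Q k))) (Q i) = j i"
proof -
  have "Poly_Mapping.lookup (\<Sum>k\<in>S. frag_cmul (j k) (frag_of (Q k))) (Q i)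
      = (\<Sum>k\<in>S. if k = i then j k else 0)"
    unfolding lookup_sum lookup_frag_cmul
    by (intro sum.cong) (use assms in \<open>auto simp: lookup_single when_def inj_on_eq_iff\<close>)
  then show ?thesis using assms by simp
qed

lemma lookup_sum_frag_of_other:
  assumes "finite S" "R \<notin> Q ` S"
  shows "Poly_Mapping.lookup (\<Sum>k\<in>S. frag_cmul (j k) (frag_of (Q k))) R = 0"
  unfolding lookup_sum lookup_frag_cmul
  by (intro sum.neutral) (use assms in \<open>auto simp: lookup_single when_def\<close>)

lemma sum_nat_eq_0_iff_le:
  fixes x :: "'i \<Rightarrow> int"
  assumes "finite S" shows "(\<Sum>i\<in>S. nat (x i + 1)) = 0 \<longleftrightarrow> (\<forall>i\<in>S. x i \<le> - 1)"
  using assms by (auto simp: sum_eq_0_iff)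

theorem theorem4p4:
  fixes f :: "'k::{field,finite} poly"
    and h :: "'k poly fract \<Rightarrow> 'F::field"
    and y :: 'F
    and m n r :: nat
    and P :: "nat \<Rightarrow> 'k poly fract set"
    and Q :: "nat \<Rightarrow> 'F set"
    and lam :: "nat \<Rightarrow> int"
    and \<beta> :: "nat \<Rightarrow> int"
    and D :: "'F divisor"
  assumes m: "m \<ge> 2" "\<not> CHAR('k) dvd m"
    and deg_f: "Polynomial.degree f \<ge> 2"
    and roots_f: "\<forall>z :: 'k alg_closure. poly (map_poly to_ac f) z = 0 \<longrightarrow> z \<in> range to_ac"
    and not_power: "\<forall>d \<ge> 2. d dvd m \<longrightarrow> \<not> (\<exists>u :: 'k poly fract. to_fract f = u ^ d)"
    and extension: "field_hom h"
    and curve: "y ^ m = h (to_fract f)"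
    and generated: "is_subfield hull (range h \<union> {y}) = UNIV"
    and genus: "genus (h \<circ> const_fract) \<ge> 1"
    and P: "bij_betw P {1..r} {p. place const_fract p \<and>
              (place_val p (to_fract f) > 0 \<or> place_val p (to_fract f) < 0)}"
    and lam: "\<forall>k\<in>{1..r}. lam k = place_val (P k) (to_fract f)"
    and n: "n \<le> r" "2 \<le> n" "n \<le> CARD('k)"
    and tot_ram: "\<forall>k\<in>{1..n}. totally_ramified const_fract h (P k)"
    and Q: "inj_on Q {1..n}" "\<forall>k\<in>{1..n}. {q. lies_over const_fract h q (P k)} = {Q k}"
    and \<beta>: "\<forall>i\<in>{1..m - 1}. \<beta> i = kummer_beta m r lam i"
    and lam_cong: "\<forall>s\<in>{1..n}. [lam s = 1] (mod int m)"
    and D: "Poly_Mapping.keys D \<subseteq> Q ` {1..n}"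
  shows "non_special (h \<circ> const_fract) D \<and>
           div_degree (h \<circ> const_fract) D = genus (h \<circ> const_fract) - 1
         \<longleftrightarrow>
         ((\<forall>i\<in>{1..m - 2}. \<beta> (i + 1) \<le> \<beta> i) \<and> \<beta> 1 \<le> int n - 1) \<and>
         (\<exists>\<alpha> (j :: nat \<Rightarrow> int) \<sigma>.
            alpha_tuple m n \<beta> \<alpha> \<and>
            (\<Sum>k=1..n. j k) = -1 \<and>
            \<sigma> permutes {1..n} \<and>
            D = frag_cmul (int m) (\<Sum>k=1..n. frag_cmul (j k) (frag_of (Q k)))
                + (\<Sum>k=1..n. frag_cmul (int (\<alpha> (\<sigma> k))) (frag_of (Q k))))"
proof -
  have f0: "f \<noteq> 0" using deg_f by auto
  interpret K: kummer_extension h f y m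
    by (intro kummer_extension.intro extension f0 curve generated) (use m(1) in simp)
  let ?c = "h \<circ> const_fract"
  define Z where "Z = {a. poly f a = 0}"
  obtain A where A: "f = Polynomial.smult (lead_coeff f) (\<Prod>a\<in>#A. [:- a, 1:])"
    using poly_to_ac_factorization[OF f0 roots_f] by blast
  note div_f = split_poly_divisor[OF f0 A, folded Z_def]
  let ?T = "{p. place const_fract p \<and> (place_val p (to_fract f) > 0 \<or> place_val p (to_fract f) < 0)}"
  have vinf: "place_val place_inf (to_fract f) < 0" using place_val_inf[OF place_inf f0] deg_f by simp
  have T: "?T = insert place_inf (place_at ` Z)"
  proof
    show "?T \<subseteq> insert place_inf (place_at ` Z)" using div_f(1) by fastforce
    show "insert place_inf (place_at ` Z) \<subseteq> ?T" using vinf div_f(3) place_inf(1) place_at(1) by auto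
  qed
  \<comment> \<open>The places are listed by \<open>P\<close> in the statement but by infinity and
    the roots of \<open>f\<close> in \<open>ell_eq\<close>; sums are transferred between the
    two.\<close>
  have sumP: "(\<Sum>k=1..r. \<phi> (P k)) = \<phi> place_inf + (\<Sum>a\<in>Z. \<phi> (place_at a))" for \<phi> :: "_ \<Rightarrow> int"
  proof -
    have "(\<Sum>k=1..r. \<phi> (P k)) = sum \<phi> (insert place_inf (place_at ` Z))"
      using sum.reindex_bij_betw[OF P, of \<phi>] unfolding T .
    also have "\<dots> = \<phi> place_inf + sum \<phi> (place_at ` Z)"
    proof (rule sum.insert)
      show "place_inf \<notin> place_at ` Z" using place_at_neq_inf by fastforce
    qed simp
    also have "sum \<phi> (place_at ` Z) = (\<Sum>a\<in>Z. \<phi> (place_at a))"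
      by (subst sum.reindex) (auto intro: inj_on_subset[OF inj_place_at])
    finally show ?thesis .
  qed
  have PT: "P k \<in> insert place_inf (place_at ` Z)" if "k \<in> {1..r}" for k
    using bij_betwE[OF P] that unfolding T by blast
  have Ppl: "place const_fract (P k)" if "k \<in> {1..r}" for k using bij_betwE[OF P] that by blast
  have Ppar: "\<exists>t. polar_parameter (P k) t" if "k \<in> {1..r}" for k
    by (rule polar_parameter_exists) (use PT[OF that] in blast)
  have nr: "{1..n} \<subseteq> {1..r}" using n(1) by auto
  have injP: "inj_on P {1..n}" using P nr unfolding bij_betw_def by (blast intro: inj_on_subset)
  have Qpl: "place ?c (Q k)" and bQ: "K.below (Q k) = P k" if "k \<in> {1..n}" for k
  proof -
    have "lies_over const_fract h (Q k) (P k)" using Q(2) that by blast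
    then show "place ?c (Q k)" unfolding lies_over_def by blast
    from K.lies_over_iff[OF this] show "K.below (Q k) = P k" using \<open>lies_over const_fract h (Q k) (P k)\<close> by simp
  qed
  have uniq: "q = Q k" if "k \<in> {1..n}" "place ?c q" "K.below q = P k" for k q
  proof -
    have "lies_over const_fract h q (P k)" using K.lies_over_iff[OF that(2)] that Ppl nr by blast
    then show ?thesis using Q(2) that(1) by blast
  qed
  have cop: "Rings.coprime (place_val (P k) (to_fract f)) (int m)" if k: "k \<in> {1..n}" for k
  proof -
    have "[1 = lam k] (mod int m)" using lam_cong k by (simp add: cong_sym)
    then have "Rings.coprime (lam k) (int m)" by (rule cong_imp_coprime) simp
    then show ?thesis using lam nr k by auto
  qed
  have one: "1 \<in> {1..n}" using n by auto
  interpret R: kummer_extension_ramified h f y m "Q 1"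
    by unfold_locales (use Qpl[OF one] bQ[OF one] cop[OF one] in auto)
  have par: "\<exists>w. w \<noteq> 0 \<and> place_val (P k) w = 1 \<and> K.has_height (h w) 1" if k: "k \<in> {1..n}" for k
  proof -
    have k': "k \<in> {1..r}" using k nr by blast
    obtain t where t: "polar_parameter (P k) t" using Ppar[OF k'] by blast
    then have "t \<noteq> 0" unfolding polar_parameter_def by blast
    then show ?thesis using polar_parameter_inverse[OF t Ppl[OF k']] K.has_height_frac by (intro exI[of _ "inverse t"]) simp
  qed
  have deg1: "place_degree ?c (Q k) = 1"
    and ram: "\<And>z. z \<noteq> 0 \<Longrightarrow> place_val (Q k) (h z) = int m * place_val (K.below (Q k)) z" if k: "k \<in> {1..n}" for k
  proof -
    obtain w where w: "w \<noteq> 0" "place_val (K.below (Q k)) w = 1" "K.has_height (h w) 1"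
      using par[OF k] bQ[OF k] by auto
    have cp: "Rings.coprime (place_val (K.below (Q k)) (to_fract f)) (int m)" using cop[OF k] bQ[OF k] by simp
    show "place_degree ?c (Q k) = 1"
      "\<And>z. z \<noteq> 0 \<Longrightarrow> place_val (Q k) (h z) = int m * place_val (K.below (Q k)) z"
      using R.totally_ramified_at[OF Qpl[OF k] cp w] by blast+
  qed
  define S where "S i = (\<Sum>k=1..r. (int i * lam k) div int m)" for i
  have lam0: "(\<Sum>k=1..r. lam k) = 0"
  proof -
    have "(\<Sum>k=1..r. lam k) = (\<Sum>k=1..r. place_val (P k) (to_fract f))" using lam by (intro sum.cong) auto
    then show ?thesis using sumP[of "\<lambda>p. place_val p (to_fract f)"] div_f(2) by simp
  qed
  have S\<beta>: "S i = - \<beta> (m - i) - 1" if i: "i \<in> {1..m - 1}" for i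
  proof -
    have "m - i \<in> {1..m - 1}" using i by auto
    then show ?thesis using \<beta> kummer_beta_eq[OF lam0 i] unfolding S_def by simp
  qed
  have ell: "finite (riemann_roch_space ?c G)"
    "ell ?c G = (\<Sum>i<m. nat (S i + (\<Sum>k=1..n. (int i + Poly_Mapping.lookup G (Q k)) div int m) + 1))"
    if G: "Poly_Mapping.keys G \<subseteq> Q ` {1..n}" for G
  proof -
    \<comment> \<open>The coefficients of \<open>G\<close> moved to the places below, with 0
      wherever no \<open>Q k\<close> lies above.\<close>
    define dd where "dd p = (if p \<in> P ` {1..n} then Poly_Mapping.lookup G (Q (inv_into {1..n} P p)) else 0)" for p
    have ddP: "dd (P k) = Poly_Mapping.lookup G (Q k)" if "k \<in> {1..n}" for k
      unfolding dd_def using that inv_into_f_f[OF injP that] by simp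
    have GQ: "Poly_Mapping.lookup G q = dd (K.below q)" if q: "place ?c q" for q
    proof (cases "K.below q \<in> P ` {1..n}")
      case True
      then obtain k where k: "k \<in> {1..n}" "K.below q = P k" by blast
      then show ?thesis using uniq[OF k(1) q k(2)] ddP[OF k(1)] by simp
    next
      case False
      then have "q \<notin> Q ` {1..n}" using bQ by auto
      then have "q \<notin> Poly_Mapping.keys G" using G by blast
      then show ?thesis using False by (simp add: dd_def in_keys_iff)
    qed
    have dd: "Rings.coprime (place_val p (to_fract f)) (int m)
       \<and> (\<exists>w. w \<noteq> 0 \<and> place_val p w = 1 \<and> K.has_height (h w) 1) \<and> (\<exists>q. place ?c q \<and> K.below q = p)" if p: "dd p \<noteq> 0" for p
    proof -
      obtain k where k: "k \<in> {1..n}" "p = P k" using p unfolding dd_def by (auto split: if_splits)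
      then show ?thesis unfolding k(2)
        by (intro conjI cop par exI[of _ "Q k"] Qpl bQ)
    qed
    have Z0: "place_val p (to_fract f) = 0 \<and> dd p = 0"
      if p: "place const_fract p" "p \<noteq> place_inf" "p \<notin> place_at ` Z" for p
    proof -
      have "p \<notin> P ` {1..n}" using PT nr p by blast
      then show ?thesis using div_f(1)[OF p] by (simp add: dd_def)
    qed
    show "finite (riemann_roch_space ?c G)" by (rule R.ell_eq(1)[OF m(2) GQ dd Z0])
    have e: "ell ?c G = (\<Sum>i<m. nat ((int i * place_val place_inf (to_fract f) + dd place_inf) div int m
      + (\<Sum>a\<in>Z. (int i * place_val (place_at a) (to_fract f) + dd (place_at a)) div int m) + 1))"
      by (rule R.ell_eq(2)[OF m(2) GQ dd Z0])
    have eq: "(int i * place_val place_inf (to_fract f) + dd place_inf) div int m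
        + (\<Sum>a\<in>Z. (int i * place_val (place_at a) (to_fract f) + dd (place_at a)) div int m)
      = S i + (\<Sum>k=1..n. (int i + Poly_Mapping.lookup G (Q k)) div int m)" if i: "i < m" for i
    proof -
      \<comment> \<open>The divisor contributes only for \<open>k \<le> n\<close>, while
        \<open>S i\<close> collects the terms of \<open>f\<close> over all \<open>r\<close>
        places.\<close>
      let ?g = "\<lambda>k. if k \<in> {1..n} then (int i + Poly_Mapping.lookup G (Q k)) div int m else 0"
      have eq: "(int i * place_val place_inf (to_fract f) + dd place_inf) div int m
        + (\<Sum>a\<in>Z. (int i * place_val (place_at a) (to_fract f) + dd (place_at a)) div int m)
        = (\<Sum>k=1..r. (int i * place_val (P k) (to_fract f) + dd (P k)) div int m)"
        by (rule sumP[symmetric])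
      also have "\<dots> = (\<Sum>k=1..r. (int i * lam k) div int m + ?g k)"
      proof (rule sum.cong)
        fix k assume k: "k \<in> {1..r}"
        then have l: "lam k = place_val (P k) (to_fract f)" using lam by blast
        show "(int i * place_val (P k) (to_fract f) + dd (P k)) div int m = (int i * lam k) div int m + ?g k"
        proof (cases "k \<in> {1..n}")
          case True
          have "[lam k = 1] (mod int m)" using lam_cong True by blast
          from div_add_cong_one[OF this i, of "dd (P k)"] show ?thesis using True ddP[OF True] l by simp
        next
          case False
          have "P k \<notin> P ` {1..n}"
            using inj_on_image_mem_iff[OF bij_betw_imp_inj_on[OF P] k nr] False by blast
          then have "dd (P k) = 0" unfolding dd_def by (simp only: if_False)
          then show ?thesis using False l by auto
        qed
      qed simp
      also have "\<dots> = S i + (\<Sum>k=1..r. ?g k)" unfolding S_def by (rule sum.distrib)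
      also have "(\<Sum>k=1..r. ?g k) = (\<Sum>k=1..n. (int i + Poly_Mapping.lookup G (Q k)) div int m)"
        using nr by (intro sum.mono_neutral_cong_right) auto
      finally show ?thesis .
    qed
    show "ell ?c G = (\<Sum>i<m. nat (S i + (\<Sum>k=1..n. (int i + Poly_Mapping.lookup G (Q k)) div int m) + 1))"
    proof (rule trans[OF e], rule sum.cong[OF refl])
      fix i assume "i \<in> {..<m}"
      then have "i < m" by simp
      then show "nat ((int i * place_val place_inf (to_fract f) + dd place_inf) div int m
          + (\<Sum>a\<in>Z. (int i * place_val (place_at a) (to_fract f) + dd (place_at a)) div int m) + 1)
        = nat (S i + (\<Sum>k=1..n. (int i + Poly_Mapping.lookup G (Q k)) div int m) + 1)"
        by (simp only: eq)
    qed
  qed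
  define g where "g = (\<Sum>t=1..m-1. \<beta> t)"
  have sumS: "(\<Sum>i<m. S i) = - g - int (m - 1)"
  proof -
    have "(\<Sum>i<m. S i) = S 0 + (\<Sum>i\<in>{1..m-1}. S i)"
    proof -
      have "{..<m} = insert 0 {1..m-1}" using m(1) by auto
      then show ?thesis by simp
    qed
    also have "S 0 = 0" unfolding S_def by simp
    also have "(\<Sum>i\<in>{1..m-1}. S i) = (\<Sum>i\<in>{1..m-1}. - \<beta> (m - i) - 1)" using S\<beta> by (intro sum.cong) auto
    also have "\<dots> = (\<Sum>i\<in>{1..m-1}. - \<beta> (m - i)) - int (m - 1)" by (simp add: sum_subtractf)
    also have "(\<Sum>i\<in>{1..m-1}. - \<beta> (m - i)) = (\<Sum>t\<in>{1..m-1}. - \<beta> t)"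
      by (rule sum.reindex_bij_witness[of _ "\<lambda>i. m - i" "\<lambda>i. m - i"]) auto
    finally show ?thesis unfolding g_def by (simp add: sum_negf)
  qed
  \<comment> \<open>Beyond this bound every \<open>S i + M\<close> is nonnegative, so
    \<open>nat\<close> truncates nothing and \<open>ell\<close> is linear in
    \<open>M\<close>.\<close>
  define M0 where "M0 = nat (\<Sum>i<m. \<bar>S i\<bar>)"
  have big: "finite (riemann_roch_space ?c (Poly_Mapping.single (Q 1) (int (m * M)))) \<and>
     int (ell ?c (Poly_Mapping.single (Q 1) (int (m * M)))) = int (m * M) + 1 - g" if M: "M \<ge> M0" for M
  proof -
    let ?G = "Poly_Mapping.single (Q 1) (int (m * M))"
    have kG: "Poly_Mapping.keys ?G \<subseteq> Q ` {1..n}" using one by auto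
    have lk: "Poly_Mapping.lookup ?G (Q k) = (if k = 1 then int (m * M) else 0)" if "k \<in> {1..n}" for k
      using that one Q(1) by (auto simp: lookup_single when_def inj_on_eq_iff)
    have "(\<Sum>k=1..n. (int i + Poly_Mapping.lookup ?G (Q k)) div int m) = int M" if i: "i < m" for i
    proof -
      have "(int i + Poly_Mapping.lookup ?G (Q k)) div int m = (if k = 1 then int M else 0)" if "k \<in> {1..n}" for k
        unfolding lk[OF that] using i m(1) by (simp add: div_pos_pos_trivial)
      then have "(\<Sum>k=1..n. (int i + Poly_Mapping.lookup ?G (Q k)) div int m) = (\<Sum>k=1..n. if k = 1 then int M else 0)"
        by (intro sum.cong) auto
      then show ?thesis using one by simp
    qed
    then have "ell ?c ?G = (\<Sum>i<m. nat (S i + int M + 1))" unfolding ell(2)[OF kG] by (intro sum.cong) auto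
    then have "int (ell ?c ?G) = (\<Sum>i<m. int (nat (S i + int M + 1)))" by simp
    also have "\<dots> = (\<Sum>i<m. S i + int M + 1)"
    proof (rule sum.cong)
      fix i assume "i \<in> {..<m}"
      then have "\<bar>S i\<bar> \<le> (\<Sum>i<m. \<bar>S i\<bar>)" by (intro member_le_sum) auto
      then have "S i + int M \<ge> 0" using M unfolding M0_def by linarith
      then show "int (nat (S i + int M + 1)) = S i + int M + 1" by simp
    qed simp
    also have "\<dots> = int (m * M) + 1 - g" using sumS m(1) by (simp add: sum.distrib of_nat_diff)
    finally show ?thesis using ell(1)[OF kG] by simp
  qed
  have genus_eq: "genus ?c = g"
    unfolding genus_def
  proof (rule Greatest_equality)
    let ?G = "Poly_Mapping.single (Q 1) (int (m * M0))"
    have "is_divisor ?c ?G" unfolding is_divisor_def using Qpl[OF one] by simp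
    moreover have "div_degree ?c ?G = int (m * M0)" unfolding K.div_degree_single deg1[OF one] by simp
    ultimately show "\<exists>G. is_divisor ?c G \<and> g = div_degree ?c G - int (ell ?c G) + 1"
      using big[of M0] by (intro exI[of _ ?G]) auto
  next
    obtain t where t: "polar_parameter (P 1) t" using Ppar[of 1] one nr by blast
    fix x assume "\<exists>G. is_divisor ?c G \<and> x = div_degree ?c G - int (ell ?c G) + 1"
    then obtain G where G: "is_divisor ?c G" "x = div_degree ?c G - int (ell ?c G) + 1" by blast
    have "div_degree ?c G - int (ell ?c G) + 1 \<le> g"
    proof (rule K.riemann_inequality[OF Qpl[OF one] deg1[OF one] ram[OF one]])
      show "q = Q 1" if "place ?c q" "K.below q = K.below (Q 1)" for q
        using uniq[OF one that(1)] that(2) bQ[OF one] by simp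
      show "polar_parameter (K.below (Q 1)) t" using t bQ[OF one] by simp
    qed (use big G(1) in auto)
    then show "x \<le> g" using G(2) by simp
  qed
  let ?d = "\<lambda>k. Poly_Mapping.lookup D (Q k)"
  have degD: "div_degree ?c D = (\<Sum>k=1..n. ?d k)"
  proof -
    have "div_degree ?c D = (\<Sum>q\<in>Q ` {1..n}. Poly_Mapping.lookup D q * int (place_degree ?c q))"
      by (rule K.div_degree_superset) (use D in auto)
    also have "\<dots> = (\<Sum>k=1..n. ?d k * int (place_degree ?c (Q k)))" by (subst sum.reindex[OF Q(1)]) simp
    also have "\<dots> = (\<Sum>k=1..n. ?d k)" using deg1 by (intro sum.cong) auto
    finally show ?thesis .
  qed
  \<comment> \<open>In degree \<open>g - 1\<close> the value required of \<open>ell\<close> by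
    non-speciality is 0, so all component spaces must vanish.\<close>
  have "non_special ?c D \<and> div_degree ?c D = genus ?c - 1 \<longleftrightarrow> div_degree ?c D = g - 1 \<and> ell ?c D = 0"
    unfolding non_special_def genus_eq by auto
  also have "ell ?c D = 0 \<longleftrightarrow> (\<forall>i\<in>{..<m}. S i + (\<Sum>k=1..n. (int i + ?d k) div int m) \<le> - 1)"
    unfolding ell(2)[OF D] by (rule sum_nat_eq_0_iff_le) simp
  \<comment> \<open>The exponent 0, where \<open>S 0 = 0\<close>, gives the separate first
    condition; for the others \<open>S i = - \<beta> (m - i) - 1\<close>.\<close>
  also have "\<dots> \<longleftrightarrow> (\<Sum>k=1..n. ?d k div int m) \<le> - 1 \<and>
      (\<forall>i\<in>{1..m-1}. (\<Sum>k=1..n. (int i + ?d k) div int m) \<le> \<beta> (m - i))"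
  proof -
    have "{..<m} = insert 0 {1..m-1}" using m(1) by auto
    moreover have "S 0 = 0" unfolding S_def by simp
    ultimately show ?thesis using S\<beta> by auto
  qed
  also have "div_degree ?c D = g - 1 \<and> (\<Sum>k=1..n. ?d k div int m) \<le> - 1 \<and>
      (\<forall>i\<in>{1..m-1}. (\<Sum>k=1..n. (int i + ?d k) div int m) \<le> \<beta> (m - i)) \<longleftrightarrow>
      ((\<forall>i\<in>{1..m - 2}. \<beta> (i + 1) \<le> \<beta> i) \<and> \<beta> 1 \<le> int n - 1) \<and>
      (\<exists>\<alpha> j \<sigma>. alpha_tuple m n \<beta> \<alpha> \<and> (\<Sum>k=1..n. j k) = - 1 \<and> \<sigma> permutes {1..n} \<and>
        (\<forall>k\<in>{1..n}. ?d k = int m * j k + int (\<alpha> (\<sigma> k))))"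
    unfolding degD g_def by (rule nonspecial_combinatorics[OF m(1)])
  finally have main: "non_special ?c D \<and> div_degree ?c D = genus ?c - 1 \<longleftrightarrow>
      ((\<forall>i\<in>{1..m - 2}. \<beta> (i + 1) \<le> \<beta> i) \<and> \<beta> 1 \<le> int n - 1) \<and>
      (\<exists>\<alpha> j \<sigma>. alpha_tuple m n \<beta> \<alpha> \<and> (\<Sum>k=1..n. j k) = - 1 \<and> \<sigma> permutes {1..n} \<and>
        (\<forall>k\<in>{1..n}. ?d k = int m * j k + int (\<alpha> (\<sigma> k))))" .
  \<comment> \<open>\<open>D\<close> is supported on the distinct places \<open>Q k\<close>, so its
    coefficients there determine it.\<close>
  have D_eq: "(\<forall>k\<in>{1..n}. ?d k = int m * j k + int (a k)) \<longleftrightarrow>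
      D = frag_cmul (int m) (\<Sum>k=1..n. frag_cmul (j k) (frag_of (Q k)))
          + (\<Sum>k=1..n. frag_cmul (int (a k)) (frag_of (Q k)))" (is "_ \<longleftrightarrow> D = ?E") for j and a :: "nat \<Rightarrow> nat"
  proof -
    have lE: "Poly_Mapping.lookup ?E (Q k) = int m * j k + int (a k)" if "k \<in> {1..n}" for k
      using lookup_sum_frag_of[OF Q(1) _ that] by (simp add: lookup_add lookup_frag_cmul)
    show ?thesis
    proof
      assume *: "\<forall>k\<in>{1..n}. ?d k = int m * j k + int (a k)"
      show "D = ?E"
      proof (rule poly_mapping_eqI)
        fix q
        show "Poly_Mapping.lookup D q = Poly_Mapping.lookup ?E q"
        proof (cases "q \<in> Q ` {1..n}")
          case True then show ?thesis using * lE by auto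
        next
          case False
          then have "Poly_Mapping.lookup D q = 0" using D by (auto simp: in_keys_iff)
          then show ?thesis using lookup_sum_frag_of_other[OF _ False] by (simp add: lookup_add lookup_frag_cmul)
        qed
      qed
    qed (use lE in metis)
  qed
  show ?thesis using main unfolding D_eq .
qed

end
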